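(* Let $s_1,s_2\in\mathbb R$, $0<\vec q\le\vec p\le\infty$, $0<\vec r,\vec\nu\le\infty$, $\vec\alpha_1=(\alpha_1^1,\dots,\alpha_n^1)\in\mathbb R^n$, $\vec\alpha_2=(\alpha_1^2,\dots,\alpha_n^2)\in\mathbb R^n$ and $0<\beta\le\infty$. Assume that $-\frac1{p_i}<\alpha_i^1\le\alpha_i^2$ for all $i\in\{1,\dots,n\}$, and $$s_1-\frac1{\mathbf p}-\boldsymbol\alpha_1\le s_2-\frac1{\mathbf q}-\boldsymbol\alpha_2.\qquad(\ast)$$ Then $$\dot E_{\vec q}^{\vec\alpha_2,\vec\theta}B_\beta^{s_2}\hookrightarrow\dot E_{\vec p}^{\vec\alpha_1,\vec r}B_\beta^{s_1},\qquad(\ast\ast)$$ where $$\vec\theta=\begin{cases}\vec r,&\text{if }\vec\alpha_2=\vec\alpha_1,\\ \vec\nu,&\text{if }\vec\alpha_2>\vec\alpha_1.\end{cases}$$ Moreover, condition $(\ast)$ is necessary for the embedding $(\ast\ast)$ to hold.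
   Context: Conventions: $0<\vec p\le\infty$ means $p_i\in(0,\infty]$ for every $i$; inequalities between vectors are componentwise; $1/\infty=0$; sums with exponent $\infty$ are replaced by suprema; $\frac1{\mathbf p}=\sum_i\frac1{p_i}$, $\frac1{\mathbf q}=\sum_i\frac1{q_i}$, $\boldsymbol\alpha_j=\sum_i\alpha_i^j$. $X\hookrightarrow Y$ means $X\subset Y$ with $\|f\|_Y\le C\|f\|_X$ for all $f\in X$. Mixed-norm Herz spaces: for $k\in\mathbb Z$ let $R_k=\{t\in\mathbb R:2^{k-1}\le|t|<2^k\}$. For $0<p,q\le\infty$, $\alpha\in\mathbb R$ and measurable $g$ on $\mathbb R$, $\|g\|_{\dot K_p^{\alpha,q}}=\big(\sum_{k\in\mathbb Z}2^{k\alpha q}\|g\chi_{R_k}\|_{L^p(\mathbb R)}^q\big)^{1/q}$. The space $\dot E_{\vec p}^{\vec\alpha,\vec q}(\mathbb R^n)$ consists of all measurable $f$ on $\mathbb R^n$ with $\|f\|_{\dot E_{\vec p}^{\vec\alpha,\vec q}(\mathbb R^n)}=\big\|\cdots\|f\|_{\dot K_{p_1}^{\alpha_1,q_1}}\cdots\big\|_{\dot K_{p_n}^{\alpha_n,q_n}}<\infty$, where the $\dot K_{p_i}^{\alpha_i,q_i}$-quasi-norm is taken in the variable $x_i$, successively for $i=1,\dots,n$ ($x_1$ innermost). Besov-type spaces: fix $\Phi,\varphi\in\mathcal S(\mathbb R^n)$ with $\operatorname{supp}\mathcal F\Phi\subset\{|\xi|\le2\}$, $|\mathcal F\Phi(\xi)|\ge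 c>0$ for $|\xi|\le\frac53$, $\operatorname{supp}\mathcal F\varphi\subset\{\frac12\le|\xi|\le2\}$, $|\mathcal F\varphi(\xi)|\ge c>0$ for $\frac35\le|\xi|\le\frac53$. Put $\varphi_0=\Phi$, $\varphi_k=2^{kn}\varphi(2^k\cdot)$ for $k\ge1$. $\dot E_{\vec p}^{\vec\alpha,\vec q}B_\beta^s$ is the set of $f\in\mathcal S'(\mathbb R^n)$ with quasi-norm $\big(\sum_{k\ge0}2^{ks\beta}\|\varphi_k*f\|_{\dot E_{\vec p}^{\vec\alpha,\vec q}(\mathbb R^n)}^\beta\big)^{1/\beta}<\infty$. *)

theory Defs
  imports "HOL-Analysis.Analysis" "HOL-Probability.Essential_Supremum"
begin

section \<open>Lebesgue and sequence quasi-norms with exponents in (0,\<infinity>]\<close>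

text \<open>Exponents \<open>p\<close> have type \<^typ>\<open>ennreal\<close>, so that \<open>0 < p\<close> means \<open>p \<in> (0,\<infinity>]\<close>.
  Quasi-norms take values in \<^typ>\<open>ennreal\<close> and are applied to moduli of functions, hence to
  functions with values in \<^typ>\<open>ennreal\<close>.\<close>

definition recip :: "ennreal \<Rightarrow> real"
  where "recip p = enn2real (1 / p)"

text \<open>Only used with exponents \<open>a > 0\<close>.\<close>

definition epow :: "ennreal \<Rightarrow> real \<Rightarrow> ennreal"
  where "epow x a = (if x = \<infinity> then \<infinity> else ennreal (enn2real x powr a))"

text \<open>The essential supremum of the library is \<open>\<infinity>\<close> on non-measurable functions. Below,
  everything is applied to continuous functions on \<open>\<real>\<^sup>n\<close> and to the partial norms of such functions,
  which are Borel measurable.\<close>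

definition Lp_norm :: "ennreal \<Rightarrow> (real \<Rightarrow> ennreal) \<Rightarrow> ennreal"
  where "Lp_norm p g =
    (if p = \<infinity> then esssup lborel g
     else epow (\<integral>\<^sup>+t. epow (g t) (enn2real p) \<partial>lborel) (1 / enn2real p))"

definition lq_norm :: "ennreal \<Rightarrow> ('i \<Rightarrow> ennreal) \<Rightarrow> ennreal"
  where "lq_norm q a =
    (if q = \<infinity> then (SUP k. a k)
     else epow (\<integral>\<^sup>+k. epow (a k) (enn2real q) \<partial>count_space UNIV) (1 / enn2real q))"

section \<open>Mixed-norm Herz spaces\<close>

definition annulus :: "int \<Rightarrow> real set"
  where "annulus k = {t. 2 powi (k - 1) \<le> \<bar>t\<bar> \<and> \<bar>t\<bar> < 2 powi k}"

definition herz_norm :: "ennreal \<Rightarrow> real \<Rightarrow> ennreal \<Rightarrow> (real \<Rightarrow> ennreal) \<Rightarrow> ennreal"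
  where "herz_norm p \<alpha> q g =
    lq_norm q (\<lambda>k::int. ennreal (2 powr (real_of_int k * \<alpha>)) *
                        Lp_norm p (\<lambda>t. g t * indicator (annulus k) t))"

text \<open>The Herz quasi-norms are taken in the variables listed, the head of the list first (innermost).
  After a variable has been processed, the resulting function no longer depends on it.\<close>

primrec herz_partial_norm ::
  "ennreal^'n \<Rightarrow> real^'n \<Rightarrow> ennreal^'n \<Rightarrow> 'n list \<Rightarrow> (real^'n \<Rightarrow> ennreal) \<Rightarrow> (real^'n \<Rightarrow> ennreal)"
  where
    "herz_partial_norm p \<alpha> q [] g = g"
  | "herz_partial_norm p \<alpha> q (i # is) g =
       herz_partial_norm p \<alpha> q is
         (\<lambda>x. herz_norm (p $ i) (\<alpha> $ i) (q $ i) (\<lambda>t. g (\<chi> j. if j = i then t else x $ j)))"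

text \<open>The linear order on the index type provides the order \<open>x\<^sub>1, \<dots>, x\<^sub>n\<close> of the variables. All of
  them have been processed in the end, so the value at the (arbitrary) point \<open>0\<close> is the norm.\<close>

definition herz_mixed_norm ::
  "ennreal^'n::{finite,linorder} \<Rightarrow> real^'n::{finite,linorder} \<Rightarrow> ennreal^'n::{finite,linorder} \<Rightarrow> (real^'n::{finite,linorder} \<Rightarrow> complex) \<Rightarrow> ennreal"
  where "herz_mixed_norm p \<alpha> q f =
    herz_partial_norm p \<alpha> q (sorted_list_of_set UNIV) (\<lambda>x. ennreal (norm (f x))) 0"

section \<open>Schwartz functions and tempered distributions\<close>

definition partial :: "'n \<Rightarrow> (real^'n \<Rightarrow> complex) \<Rightarrow> (real^'n::finite \<Rightarrow> complex)"
  where "partial i f x = vector_derivative (\<lambda>t. f (x + t *\<^sub>R axis i 1)) (at 0)"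

primrec partials :: "'n list \<Rightarrow> (real^'n \<Rightarrow> complex) \<Rightarrow> (real^'n::finite \<Rightarrow> complex)"
  where
    "partials [] f = f"
  | "partials (i # is) f = partial i (partials is f)"

text \<open>Frechet differentiability of all iterated partial derivatives amounts to \<open>C\<^sup>\<infinity>\<close>.\<close>

definition schwartz :: "(real^'n::finite \<Rightarrow> complex) set"
  where "schwartz = {\<phi>. \<forall>is. partials is \<phi> differentiable_on UNIV \<and>
    (\<forall>N::nat. \<exists>C. \<forall>x. (1 + norm x) ^ N * norm (partials is \<phi> x) \<le> C)}"

definition schwartz_seminorm :: "nat \<Rightarrow> (real^'n::finite \<Rightarrow> complex) \<Rightarrow> real"
  where "schwartz_seminorm N \<phi> =
    (SUP (is, x) \<in> {is. length is \<le> N} \<times> UNIV. (1 + norm x) ^ N * norm (partials is \<phi> x))"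

text \<open>A tempered distribution is a continuous linear functional on the Schwartz space, represented
  as an extensional function; continuity is expressed by the increasing family of seminorms above.\<close>

definition tempered_distributions :: "((real^'n::finite \<Rightarrow> complex) \<Rightarrow> complex) set"
  where "tempered_distributions = {T. T \<in> extensional schwartz \<and>
    (\<forall>\<phi>\<in>schwartz. \<forall>\<psi>\<in>schwartz. T (\<lambda>x. \<phi> x + \<psi> x) = T \<phi> + T \<psi>) \<and>
    (\<forall>\<phi>\<in>schwartz. \<forall>c. T (\<lambda>x. c * \<phi> x) = c * T \<phi>) \<and>
    (\<exists>C N. \<forall>\<phi>\<in>schwartz. norm (T \<phi>) \<le> C * schwartz_seminorm N \<phi>)}"

definition conv :: "(real^'n \<Rightarrow> complex) \<Rightarrow> ((real^'n \<Rightarrow> complex) \<Rightarrow> complex) \<Rightarrow> (real^'n::finite \<Rightarrow> complex)"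
  where "conv \<phi> T x = T (\<lambda>y. \<phi> (x - y))"

definition fourier :: "(real^'n \<Rightarrow> complex) \<Rightarrow> (real^'n::finite \<Rightarrow> complex)"
  where "fourier \<phi> \<xi> = (LINT x|lborel. cis (- (x \<bullet> \<xi>)) * \<phi> x)"

definition supp :: "(real^'n \<Rightarrow> complex) \<Rightarrow> (real^'n::finite) set"
  where "supp g = closure {\<xi>. g \<xi> \<noteq> 0}"

section \<open>Besov-type spaces\<close>

definition admissible :: "(real^'n \<Rightarrow> complex) \<Rightarrow> (real^'n::finite \<Rightarrow> complex) \<Rightarrow> bool"
  where "admissible \<Phi> \<phi> \<longleftrightarrow>
    \<Phi> \<in> schwartz \<and> \<phi> \<in> schwartz \<and>
    supp (fourier \<Phi>) \<subseteq> {\<xi>. norm \<xi> \<le> 2} \<and>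
    (\<exists>c>0. \<forall>\<xi>. norm \<xi> \<le> 5/3 \<longrightarrow> c \<le> norm (fourier \<Phi> \<xi>)) \<and>
    supp (fourier \<phi>) \<subseteq> {\<xi>. 1/2 \<le> norm \<xi> \<and> norm \<xi> \<le> 2} \<and>
    (\<exists>c>0. \<forall>\<xi>. 3/5 \<le> norm \<xi> \<and> norm \<xi> \<le> 5/3 \<longrightarrow> c \<le> norm (fourier \<phi> \<xi>))"

definition resolution ::
  "(real^'n \<Rightarrow> complex) \<Rightarrow> (real^'n \<Rightarrow> complex) \<Rightarrow> nat \<Rightarrow> (real^'n::finite \<Rightarrow> complex)"
  where "resolution \<Phi> \<phi> k =
    (if k = 0 then \<Phi> else (\<lambda>x. 2 ^ (k * CARD('n)) * \<phi> (2 ^ k *\<^sub>R x)))"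

definition besov_norm ::
  "(real^'n::{finite,linorder} \<Rightarrow> complex) \<Rightarrow> (real^'n::{finite,linorder} \<Rightarrow> complex) \<Rightarrow> ennreal^'n::{finite,linorder} \<Rightarrow> real^'n::{finite,linorder} \<Rightarrow> ennreal^'n::{finite,linorder} \<Rightarrow>
   real \<Rightarrow> ennreal \<Rightarrow> ((real^'n::{finite,linorder} \<Rightarrow> complex) \<Rightarrow> complex) \<Rightarrow> ennreal"
  where "besov_norm \<Phi> \<phi> p \<alpha> q s \<beta> f =
    lq_norm \<beta> (\<lambda>k::nat. ennreal (2 powr (real k * s)) *
                        herz_mixed_norm p \<alpha> q (conv (resolution \<Phi> \<phi> k) f))"

definition besov_space ::
  "(real^'n::{finite,linorder} \<Rightarrow> complex) \<Rightarrow> (real^'n::{finite,linorder} \<Rightarrow> complex) \<Rightarrow> ennreal^'n::{finite,linorder} \<Rightarrow> real^'n::{finite,linorder} \<Rightarrow> ennreal^'n::{finite,linorder} \<Rightarrow>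
   real \<Rightarrow> ennreal \<Rightarrow> ((real^'n::{finite,linorder} \<Rightarrow> complex) \<Rightarrow> complex) set"
  where "besov_space \<Phi> \<phi> p \<alpha> q s \<beta> =
    {f \<in> tempered_distributions. besov_norm \<Phi> \<phi> p \<alpha> q s \<beta> f < \<infinity>}"

definition embedded :: "'a set \<Rightarrow> ('a \<Rightarrow> ennreal) \<Rightarrow> 'a set \<Rightarrow> ('a \<Rightarrow> ennreal) \<Rightarrow> bool"
  where "embedded X normX Y normY \<longleftrightarrow>
    X \<subseteq> Y \<and> (\<exists>C::real. \<forall>f\<in>X. normY f \<le> ennreal C * normX f)"

definition besov_embedding ::
  "(real^'n::{finite,linorder} \<Rightarrow> complex) \<Rightarrow> (real^'n::{finite,linorder} \<Rightarrow> complex) \<Rightarrow>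
   ennreal^'n::{finite,linorder} \<Rightarrow> real^'n::{finite,linorder} \<Rightarrow> ennreal^'n::{finite,linorder} \<Rightarrow> real \<Rightarrow>
   ennreal^'n::{finite,linorder} \<Rightarrow> real^'n::{finite,linorder} \<Rightarrow> ennreal^'n::{finite,linorder} \<Rightarrow> real \<Rightarrow> ennreal \<Rightarrow> bool"
  where "besov_embedding \<Phi> \<phi> q \<alpha>2 \<theta> s2 p \<alpha>1 r s1 \<beta> \<longleftrightarrow>
    embedded
      (besov_space \<Phi> \<phi> q \<alpha>2 \<theta> s2 \<beta>) (besov_norm \<Phi> \<phi> q \<alpha>2 \<theta> s2 \<beta>)
      (besov_space \<Phi> \<phi> p \<alpha>1 r s1 \<beta>) (besov_norm \<Phi> \<phi> p \<alpha>1 r s1 \<beta>)"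

end

theory Submission
  imports Defs "HOL-Probability.Sinc_Integral" "HOL-Probability.Characteristic_Functions"
    "HOL-Complex_Analysis.Complex_Analysis"
begin

text \<open>Sufficiency reduces, by scaling, to a Nikolskii-type inequality between mixed Herz norms of
  \<open>g = \<phi> * T\<close>, where \<open>T\<close> is tempered and \<open>\<phi>\<close> has its spectrum in a fixed ball. In one variable, \<open>g\<close> is
  recovered from its values on every translate of the integer lattice (oversampling), with the kernel
  \<open>sinc(\<pi>u) sinc(\<delta>u)\<^sup>M sinc(\<epsilon>u)\<^sup>N\<close>. Raising this series to a power \<open>t \<le> 1\<close> and averaging over the
  translates bounds \<open>\<bar>g\<bar>\<^sup>t\<close> by its convolution, in that variable alone, with a rapidly decaying function.
  For small \<open>t\<close> all exponents divided by \<open>t\<close> are at least \<open>1\<close>, and convolution in one variable with such a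
  function maps the one Herz space into the other; Minkowski's inequality allows the variables to be
  treated one after the other. Powers of \<open>2\<close> scale the Herz norms exactly, so the blocks of a distribution
  satisfy the inequality with constants that are uniform under the parameter condition. Conversely, testing the
  embedding on the dilates of one band-limited function forces that condition.\<close>

section \<open>Integral quasi-norms with exponents in \<open>(0,\<infinity>]\<close>\<close>

text \<open>The power t has a second task. Convolution with a decaying kernel acts on a Herz space
  only for weight exponents in a bounded range, while the theorem puts no upper bound on
  \<open>\<alpha>2\<close>. Passing from |g| to |g|^t multiplies \<open>\<alpha>2\<close> + 1/q by
  t, so a small t brings it below 1; the sign of \<open>\<alpha>1\<close> + 1/p, the lower
  condition, is kept. The growth of g is polynomial with an order depending on T, so a maximal
  function of fixed order may be infinite; a reproducing series avoids it. For the same reason the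
  kernel has two groups of decaying factors: M is dictated by t and the exponents and enters the
  constant, N is dictated by the order of T, only makes the series converge and leaves no trace in
  the estimate. The integer lattice is dense enough because frequencies are at most 2: the gap
  between 2 and \<pi> exceeds 1, and the two groups share the total exponential type 1. The
  summation exponents r and \<theta> interact only between neighbouring annuli, and only if
  \<open>\<alpha>1\<close> = \<open>\<alpha>2\<close>; elsewhere geometric decay absorbs any change
  of exponent.\<close>

lemma epow_0 [simp]: "epow 0 a = 0"
  by (simp add: epow_def)

lemma epow_top [simp]: "epow \<infinity> a = \<infinity>" "epow top a = top"
  by (simp_all add: epow_def infinity_ennreal_def)

lemma epow_1 [simp]: "epow 1 a = 1"
  by (simp add: epow_def)

lemma epow_ennreal: "0 \<le> r \<Longrightarrow> epow (ennreal r) a = ennreal (r powr a)"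
  by (simp add: epow_def)

lemma epow_one [simp]: "epow x 1 = x"
  by (cases x) (simp_all add: epow_ennreal infinity_ennreal_def)

lemma epow_epow: "epow (epow x a) b = epow x (a * b)"
  by (cases x) (simp_all add: epow_ennreal infinity_ennreal_def powr_powr)

lemma epow_eq_0_iff [simp]: "epow x a = 0 \<longleftrightarrow> x = 0"
  by (cases x) (simp_all add: epow_ennreal infinity_ennreal_def)

lemma epow_mult: "epow (x * y) a = epow x a * epow y a"
proof (cases "x = 0 \<or> y = 0")
  case False
  then show ?thesis
    by (cases x; cases y)
       (auto simp: epow_ennreal infinity_ennreal_def ennreal_mult[symmetric] powr_mult
         ennreal_top_mult ennreal_mult_top top_unique)
qed auto

lemma epow_mono: "0 \<le> a \<Longrightarrow> x \<le> y \<Longrightarrow> epow x a \<le> epow y a"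
  by (cases x; cases y)
     (auto simp: epow_ennreal infinity_ennreal_def powr_mono2 ennreal_leI top_unique)

lemma epow_inverse [simp]: "a \<noteq> 0 \<Longrightarrow> epow (epow x a) (1 / a) = x" "a \<noteq> 0 \<Longrightarrow> epow (epow x (1 / a)) a = x"
  by (simp_all add: epow_epow)

lemma epow_le_iff: "0 < a \<Longrightarrow> epow x a \<le> epow y a \<longleftrightarrow> x \<le> y"
  by (metis epow_inverse(1) epow_mono less_eq_real_def zero_le_divide_1_iff less_irrefl)

lemma epow_le_iff_left: "0 < a \<Longrightarrow> epow x a \<le> y \<longleftrightarrow> x \<le> epow y (1 / a)"
  by (metis epow_inverse(2) epow_le_iff less_irrefl)

lemma epow_add: "0 < a \<Longrightarrow> 0 < b \<Longrightarrow> epow x (a + b) = epow x a * epow x b"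
  by (cases x) (simp_all add: epow_ennreal infinity_ennreal_def powr_add ennreal_mult[symmetric])

lemma borel_measurable_epow [measurable]:
  "f \<in> borel_measurable M \<Longrightarrow> (\<lambda>x. epow (f x) a) \<in> borel_measurable M"
proof -
  have "epow x a = (if x < \<infinity> then ennreal (enn2real x powr a) else \<infinity>)" for x
    by (auto simp: epow_def less_top infinity_ennreal_def)
  moreover assume [measurable]: "f \<in> borel_measurable M"
  ultimately show ?thesis by simp
qed

text \<open>After division by a + b the two terms lie in [0,1], where u \<le> u^t. This is the
  inequality that turns a series for a function into a series for the t-th power of its
  modulus.\<close>

lemma epow_sum_le:
  assumes "finite I" "0 < t" "t \<le> 1"
  shows "epow (\<Sum>i\<in>I. f i) t \<le> (\<Sum>i\<in>I. epow (f i) t)"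
proof -
  have add: "epow (x + y) t \<le> epow x t + epow y t" for x y
  proof (cases x; cases y)
    fix a b assume *: "x = ennreal a" "0 \<le> a" "y = ennreal b" "0 \<le> b"
    have "(a + b) powr t \<le> a powr t + b powr t"
    proof (cases "a + b = 0")
      case False
      then have s: "0 < a + b" using * by auto
      have 1: "u \<le> u powr t" if "0 \<le> u" "u \<le> 1" for u :: real
      proof (cases "u = 0")
        case False
        then show ?thesis using powr_mono'[of t 1 u] that assms by simp
      qed auto
      have "1 = a / (a + b) + b / (a + b)" using s by (simp add: add_divide_distrib[symmetric])
      also have "\<dots> \<le> (a / (a + b)) powr t + (b / (a + b)) powr t"
        using s * by (intro add_mono 1) auto
      also have "\<dots> = (a powr t + b powr t) / (a + b) powr t"
        using * s by (simp add: powr_divide add_divide_distrib)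
      finally show ?thesis using s by (simp add: field_simps)
    qed (use * in auto)
    then show ?thesis using *
      by (simp add: epow_ennreal ennreal_plus[symmetric] ennreal_leI del: ennreal_plus)
  qed auto
  show ?thesis using assms(1)
    by induct (auto intro: order_trans[OF add] add_left_mono)
qed

text \<open>One quasi-norm for every measure: Lebesgue measure gives \<open>Lp_norm\<close> and
  counting measure gives \<open>lq_norm\<close>. Both layers of a Herz norm can then be treated by
  the same inequalities.\<close>

definition eLp :: "'a measure \<Rightarrow> ennreal \<Rightarrow> ('a \<Rightarrow> ennreal) \<Rightarrow> ennreal"
  where "eLp N p g =
    (if p = \<infinity> then esssup N g
     else epow (\<integral>\<^sup>+t. epow (g t) (enn2real p) \<partial>N) (1 / enn2real p))"

lemma Lp_norm_eq: "Lp_norm p = eLp lborel p"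
  by (simp add: fun_eq_iff Lp_norm_def eLp_def)

lemma esssup_le_iff:
  assumes "f \<in> borel_measurable M"
  shows "esssup M f \<le> c \<longleftrightarrow> (AE x in M. f x \<le> c)"
  using esssup_AE[of f M] esssup_I[OF assms] by (auto elim: eventually_mono)

text \<open>For counting measure only the empty set is null, so the essential supremum has the same
  upper bounds as the supremum.\<close>

lemma lq_norm_eq: "lq_norm q = eLp (count_space UNIV) q"
proof (rule ext)
  fix a :: "'a \<Rightarrow> ennreal"
  have "esssup (count_space UNIV) a \<le> c \<longleftrightarrow> (SUP k. a k) \<le> c" for c
    by (subst esssup_le_iff) (auto simp: AE_count_space SUP_le_iff)
  then have "esssup (count_space UNIV) a = (SUP k. a k)"
    by (meson antisym order_refl)
  then show "lq_norm q a = eLp (count_space UNIV) q a"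
    by (simp add: lq_norm_def eLp_def)
qed

lemma enn2real_pos: "0 < p \<Longrightarrow> p \<noteq> \<infinity> \<Longrightarrow> 0 < enn2real p"
  by (cases p) (auto simp: infinity_ennreal_def)

lemma eLp_mono:
  assumes "f \<in> borel_measurable N" "\<And>x. f x \<le> g x"
  shows "eLp N p f \<le> eLp N p g"
  using assms by (auto simp: eLp_def intro!: esssup_mono epow_mono nn_integral_mono)

lemma eLp_AE_mono:
  assumes "f \<in> borel_measurable N" "AE x in N. f x \<le> g x"
  shows "eLp N p f \<le> eLp N p g"
  using assms by (auto simp: eLp_def intro!: esssup_AE_mono epow_mono nn_integral_mono_AE
     elim!: eventually_mono)

lemma eLp_AE_cong:
  assumes "f \<in> borel_measurable N" "g \<in> borel_measurable N" "AE x in N. f x = g x"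
  shows "eLp N p f = eLp N p g"
  using assms by (intro antisym eLp_AE_mono) (auto elim: eventually_mono)

lemma eLp_infinity_le_iff:
  "f \<in> borel_measurable N \<Longrightarrow> eLp N \<infinity> f \<le> c \<longleftrightarrow> (AE x in N. f x \<le> c)"
  by (simp add: eLp_def esssup_le_iff)

text \<open>Trades exponents below 1 for exponents at least 1. At p = \<infinity> both sides are
  identified through their upper bounds, since \<open>epow\<close> with a positive exponent has a
  monotone inverse.\<close>

lemma eLp_epow:
  assumes "0 < t" "0 < p" and [measurable]: "f \<in> borel_measurable N"
  shows "eLp N (p / ennreal t) (\<lambda>x. epow (f x) t) = epow (eLp N p f) t"
proof (cases "p = \<infinity>")
  case True
  have "esssup N (\<lambda>x. epow (f x) t) \<le> c \<longleftrightarrow> epow (esssup N f) t \<le> c" for c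
    using assms(1) by (simp add: esssup_le_iff epow_le_iff_left)
  then have "esssup N (\<lambda>x. epow (f x) t) = epow (esssup N f) t"
    by (meson antisym order_refl)
  moreover have "p / ennreal t = \<infinity>" using True assms
    by (simp add: infinity_ennreal_def ennreal_top_divide)
  ultimately show ?thesis using True by (simp add: eLp_def)
next
  case False
  then obtain r where r: "p = ennreal r" "0 < r"
    using assms(2) by (cases p) (auto simp: infinity_ennreal_def)
  have "p / ennreal t = ennreal (r / t)" using r assms by (simp add: divide_ennreal)
  then show ?thesis using r assms
    by (simp add: eLp_def epow_epow infinity_ennreal_def)
qed

lemma eLp_cmult:
  assumes "0 < p" and [measurable]: "f \<in> borel_measurable N" and c: "c \<noteq> 0" "c \<noteq> \<infinity>"
  shows "eLp N p (\<lambda>x. c * f x) = c * eLp N p f"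
proof (cases "p = \<infinity>")
  case True
  obtain d where d: "d * c = 1"
  proof -
    obtain r where "c = ennreal r" "0 < r"
      using c by (cases c) (auto simp: infinity_ennreal_def)
    then show thesis
      by (intro that[of "ennreal (1 / r)"]) (simp add: ennreal_mult[symmetric])
  qed
  have *: "c * a \<le> b \<longleftrightarrow> a \<le> d * b" for a b
    using mult_left_mono[of "c * a" b d] mult_left_mono[of a "d * b" c] d
    by (auto simp: mult.assoc[symmetric] mult.commute[of c d])
  have "esssup N (\<lambda>x. c * f x) \<le> b \<longleftrightarrow> c * esssup N f \<le> b" for b
    by (simp add: esssup_le_iff *)
  then have "esssup N (\<lambda>x. c * f x) = c * esssup N f"
    by (meson antisym order_refl)
  then show ?thesis using True by (simp add: eLp_def)
next
  case False
  have "0 < enn2real p" using False assms enn2real_pos by simp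
  then show ?thesis using False
    by (simp add: eLp_def epow_mult nn_integral_cmult)
qed

lemma eLp_cmult_le:
  assumes "0 < p" and [measurable]: "f \<in> borel_measurable N" and "0 \<le> c"
  shows "eLp N p (\<lambda>x. ennreal c * f x) \<le> ennreal c * eLp N p f"
proof (cases "c = 0")
  case True
  then show ?thesis
    using esssup_I[of "\<lambda>x. 0::ennreal" N 0] by (auto simp: eLp_def)
next
  case False
  then show ?thesis using assms
    by (subst eLp_cmult) auto
qed

text \<open>At p = \<infinity> the sublevel set at c consists of the x for which the section of {g >
  c} is a null set, and the measure of a section depends measurably on x because N is
  sigma-finite.\<close>

lemma eLp_measurable:
  assumes "sigma_finite_measure N" and [measurable]: "case_prod g \<in> borel_measurable (M \<Otimes>\<^sub>M N)"
  shows "(\<lambda>x. eLp N p (g x)) \<in> borel_measurable M"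
proof -
  interpret sigma_finite_measure N by fact
  have gx: "g x \<in> borel_measurable N" if "x \<in> space M" for x
    using that by measurable
  show ?thesis
  proof (cases "p = \<infinity>")
    case True
    have "(\<lambda>x. esssup N (g x)) \<in> borel_measurable M"
    proof (rule borel_measurableI_le)
      fix c
      have "{x\<in>space M. esssup N (g x) \<le> c} = {x\<in>space M. emeasure N {t\<in>space N. \<not> g x t \<le> c} = 0}"
        using gx by (auto simp: esssup_le_iff AE_iff_measurable[OF _ refl])
      also have "\<dots> \<in> sets M"
        by measurable
      finally show "{x\<in>space M. esssup N (g x) \<le> c} \<in> sets M" .
    qed
    then show ?thesis using True by (simp add: eLp_def)
  next
    case False
    then show ?thesis unfolding eLp_def by simp
  qed
qed

section \<open>Jensen's and Minkowski's inequalities for functions with values in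
  [0,\<infinity>]\<close>

lemma Young_ennreal:
  assumes "1 \<le> p" "0 < c"
  shows "u \<le> ennreal (c powr (1 - p) / p) * epow u p + ennreal ((1 - 1 / p) * c)"
proof (cases u)
  case (real r)
  have "r \<le> c powr (1 - p) / p * r powr p + (1 - 1 / p) * c"
  proof (cases "r = 0")
    case False
    then have r: "0 < r" using real by simp
    have "r = (r powr p * c powr (1 - p)) powr (1 / p) * c powr (1 - 1 / p)"
      using r assms by (simp add: powr_mult powr_powr diff_divide_distrib powr_add[symmetric] mult.assoc)
    also have "\<dots> \<le> (1 / p) * (r powr p * c powr (1 - p)) + (1 - 1 / p) * c"
      using assms r by (intro Youngs_inequality_0) auto
    finally show ?thesis by (simp add: field_simps)
  qed (use assms in simp)
  then show ?thesis using real assms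
    by (simp add: epow_ennreal ennreal_mult[symmetric] ennreal_plus[symmetric] ennreal_leI del: ennreal_plus)
next
  case top
  then show ?thesis using assms by (simp add: ennreal_mult_top)
qed

text \<open>Integrating \<open>Young_ennreal\<close> against \<open>\<phi>\<close> gives a bound
  with a free parameter c. With B the integral on the right, the bound is smallest at c =
  (B/A)^(1/p), where its two terms add up to c A. The values B = 0 and B = \<infinity> have no such
  minimiser and are immediate.\<close>

lemma Jensen_ennreal:
  assumes "1 \<le> p" and [measurable]: "\<phi> \<in> borel_measurable M" "u \<in> borel_measurable M"
    and A: "(\<integral>\<^sup>+x. \<phi> x \<partial>M) = ennreal A" "0 < A"
  shows "epow (\<integral>\<^sup>+x. \<phi> x * u x \<partial>M) p \<le> ennreal (A powr (p - 1)) * (\<integral>\<^sup>+x. \<phi> x * epow (u x) p \<partial>M)"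
proof (cases "\<integral>\<^sup>+x. \<phi> x * epow (u x) p \<partial>M")
  case top
  then show ?thesis using A by (simp add: ennreal_mult_top)
next
  case (real B)
  show ?thesis
  proof (cases "B = 0")
    case True
    then have "AE x in M. \<phi> x * epow (u x) p = 0"
      using real by (simp add: nn_integral_0_iff_AE)
    then have "AE x in M. \<phi> x * u x = 0" by simp
    then have "(\<integral>\<^sup>+x. \<phi> x * u x \<partial>M) = 0" by (simp add: nn_integral_0_iff_AE)
    then show ?thesis by simp
  next
    case False
    then have B: "0 < B" using real by simp
    define c where "c = (B / A) powr (1 / p)"
    have c: "0 < c" using B A by (simp add: c_def)
    have cp: "c powr p = B / A" using B A assms by (simp add: c_def powr_powr)
    have "(\<integral>\<^sup>+x. \<phi> x * u x \<partial>M) \<le> (\<integral>\<^sup>+x. ennreal (c powr (1 - p) / p) * (\<phi> x * epow (u x) p) + ennreal ((1 - 1 / p) * c) * \<phi> x \<partial>M)"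
    proof (rule nn_integral_mono)
      fix x
      have "\<phi> x * u x \<le> \<phi> x * (ennreal (c powr (1 - p) / p) * epow (u x) p + ennreal ((1 - 1 / p) * c))"
        by (intro mult_left_mono Young_ennreal assms c) auto
      then show "\<phi> x * u x \<le> ennreal (c powr (1 - p) / p) * (\<phi> x * epow (u x) p) + ennreal ((1 - 1 / p) * c) * \<phi> x"
        by (simp add: algebra_simps)
    qed
    also have "\<dots> = ennreal (c powr (1 - p) / p * B + (1 - 1 / p) * c * A)"
      using assms c B real A
      by (simp add: nn_integral_add nn_integral_cmult ennreal_mult[symmetric] ennreal_plus[symmetric] del: ennreal_plus)
    also have "c powr (1 - p) / p * B + (1 - 1 / p) * c * A = c * A"
    proof -
      have "c powr (1 - p) * B = c * A"
        using cp c A by (simp add: powr_diff field_simps)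
      then have "c powr (1 - p) / p * B = c * A / p" by (simp add: field_simps)
      then show ?thesis using assms by (simp add: field_simps)
    qed
    finally have "epow (\<integral>\<^sup>+x. \<phi> x * u x \<partial>M) p \<le> epow (ennreal (c * A)) p"
      using assms by (intro epow_mono) auto
    also have "\<dots> = ennreal (A powr (p - 1) * B)"
    proof -
      have "(c * A) powr p = A powr (p - 1) * B"
        using c A cp by (simp add: powr_mult powr_diff)
      then show ?thesis using c A by (simp add: epow_ennreal)
    qed
    finally show ?thesis using real B by (simp add: ennreal_mult)
  qed
qed

text \<open>Duality is not involved. With n y the norm of the slice \<open>g y\<close>, the inner
  integral is an average of g y t / n y against the density n. Jensen's inequality for this density
  and Tonelli's theorem leave the r-th powers of the norms of the normalised slices, which are at
  most 1, and the powers of the total mass A combine to A^r.\<close>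

lemma Minkowski_eLp:
  assumes M: "sigma_finite_measure M" and N: "sigma_finite_measure N" and p: "1 \<le> p"
    and g[measurable]: "case_prod g \<in> borel_measurable (M \<Otimes>\<^sub>M N)"
  shows "eLp N p (\<lambda>t. \<integral>\<^sup>+y. g y t \<partial>M) \<le> (\<integral>\<^sup>+y. eLp N p (g y) \<partial>M)"
proof -
  interpret M: sigma_finite_measure M by fact
  interpret N: sigma_finite_measure N by fact
  interpret MN: pair_sigma_finite M N ..
  interpret NM: pair_sigma_finite N M ..
  define n where "n y = eLp N p (g y)" for y
  have n[measurable]: "n \<in> borel_measurable M"
    unfolding n_def by (intro eLp_measurable N) simp
  have [measurable]: "(\<lambda>(t, y). g y t) \<in> borel_measurable (N \<Otimes>\<^sub>M M)"
    by measurable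
  have gy[measurable]: "y \<in> space M \<Longrightarrow> g y \<in> borel_measurable N" for y
    by measurable
  have swap: "AE t in N. AE y in M. Q y t" if "AE y in M. AE t in N. Q y t" "Measurable.pred (M \<Otimes>\<^sub>M N) (case_prod Q)" for Q
    using that MN.AE_commute[of Q] by (simp add: pred_def case_prod_beta)
  show ?thesis
  proof (cases "p = \<infinity>")
    case True
    have "AE y in M. AE t in N. g y t \<le> n y"
      by (rule AE_I2) (simp add: n_def eLp_def True esssup_AE)
    then have "AE t in N. AE y in M. g y t \<le> n y"
      by (rule swap) measurable
    then have "AE t in N. (\<integral>\<^sup>+y. g y t \<partial>M) \<le> (\<integral>\<^sup>+y. n y \<partial>M)"
      by (auto elim!: eventually_mono intro: nn_integral_mono_AE)
    then show ?thesis unfolding True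
      by (subst eLp_infinity_le_iff) (auto simp: n_def True)
  next
    case False
    define r where "r = enn2real p"
    have r: "1 \<le> r" "p = ennreal r"
      using False p unfolding r_def by (cases p; simp add: infinity_ennreal_def)+
    show ?thesis
    proof (cases "\<integral>\<^sup>+y. n y \<partial>M")
      case top
      then show ?thesis by (simp add: n_def)
    next
      case (real A)
      have nn: "epow (n y) r = (\<integral>\<^sup>+t. epow (g y t) r \<partial>N)" for y
        using r by (simp add: n_def eLp_def epow_epow)
      have fin: "AE y in M. n y \<noteq> \<infinity>"
        by (rule nn_integral_noteq_infinite) (use real in auto)
      have zero: "AE y in M. AE t in N. n y = 0 \<longrightarrow> g y t = 0"
      proof (rule AE_I2)
        fix y assume y: "y \<in> space M"
        show "AE t in N. n y = 0 \<longrightarrow> g y t = 0"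
        proof (cases "n y = 0")
          case True
          then have "(\<integral>\<^sup>+t. epow (g y t) r \<partial>N) = 0" using nn[of y] by simp
          then show ?thesis using y by (auto simp: nn_integral_0_iff_AE)
        qed simp
      qed
      \<comment> \<open>Writing g y t as n y times a quotient fails where n y = \<infinity>, or
        where n y = 0 and g y t is not 0. Both sets are negligible, but this is known slice by slice
        in y and is used at fixed t.\<close>
      have ae: "AE t in N. AE y in M. n y \<noteq> \<infinity> \<and> (n y = 0 \<longrightarrow> g y t = 0)"
        by (rule swap) (use fin zero in \<open>auto elim: eventually_elim2 simp: AE_conj_iff\<close>)
      have div: "a = b * (a / b)" if "b \<noteq> \<infinity>" "b = 0 \<longrightarrow> a = 0" for a b :: ennreal
        using that ennreal_mult_divide_eq[of b a]
        by (cases "b = 0") (simp_all add: ennreal_times_divide mult.commute[of b] infinity_ennreal_def)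
      have eq: "AE t in N. (\<integral>\<^sup>+y. g y t \<partial>M) = (\<integral>\<^sup>+y. n y * (g y t / n y) \<partial>M)"
        using ae
      proof eventually_elim
        case (elim t)
        then have "AE y in M. g y t = n y * (g y t / n y)"
          by (rule eventually_mono) (use div in blast)
        then show ?case by (rule nn_integral_cong_AE)
      qed
      have key: "(\<integral>\<^sup>+t. epow (\<integral>\<^sup>+y. g y t \<partial>M) r \<partial>N) \<le> epow (ennreal A) r"
      proof (cases "A = 0")
        case True
        then have "AE y in M. n y = 0" using real by (simp add: nn_integral_0_iff_AE)
        then have "AE y in M. AE t in N. g y t = 0"
          using zero by eventually_elim auto
        then have "AE t in N. AE y in M. g y t = 0"
          by (rule swap) measurable
        then have "AE t in N. (\<integral>\<^sup>+y. g y t \<partial>M) = 0"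
        proof eventually_elim
          case (elim t)
          then have "(\<integral>\<^sup>+y. g y t \<partial>M) = (\<integral>\<^sup>+y. 0 \<partial>M)"
            by (rule nn_integral_cong_AE)
          then show ?case by simp
        qed
        then have "(\<integral>\<^sup>+t. epow (\<integral>\<^sup>+y. g y t \<partial>M) r \<partial>N) = 0"
          by (subst nn_integral_0_iff_AE) (auto elim: eventually_mono)
        then show ?thesis by simp
      next
        case False
        then have A: "0 < A" using real by simp
        have "(\<integral>\<^sup>+t. epow (\<integral>\<^sup>+y. g y t \<partial>M) r \<partial>N)
            = (\<integral>\<^sup>+t. epow (\<integral>\<^sup>+y. n y * (g y t / n y) \<partial>M) r \<partial>N)"
          by (intro nn_integral_cong_AE) (use eq in \<open>auto elim: eventually_mono\<close>)
        also have "\<dots> \<le> (\<integral>\<^sup>+t. ennreal (A powr (r - 1)) * (\<integral>\<^sup>+y. n y * epow (g y t / n y) r \<partial>M) \<partial>N)"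
          by (intro nn_integral_mono Jensen_ennreal) (use r A real in auto)
        also have "\<dots> = ennreal (A powr (r - 1)) * (\<integral>\<^sup>+t. (\<integral>\<^sup>+y. n y * epow (g y t / n y) r \<partial>M) \<partial>N)"
          by (intro nn_integral_cmult) measurable
        also have "(\<integral>\<^sup>+t. (\<integral>\<^sup>+y. n y * epow (g y t / n y) r \<partial>M) \<partial>N)
            = (\<integral>\<^sup>+y. (\<integral>\<^sup>+t. n y * epow (g y t / n y) r \<partial>N) \<partial>M)"
          by (rule MN.Fubini') measurable
        also have "\<dots> \<le> (\<integral>\<^sup>+y. n y \<partial>M)"
        proof (rule nn_integral_mono_AE)
          show "AE y in M. (\<integral>\<^sup>+t. n y * epow (g y t / n y) r \<partial>N) \<le> n y"
            using fin AE_space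
          proof (eventually_elim, goal_cases)
            case (1 y)
            then have [measurable]: "g y \<in> borel_measurable N" by simp
            show ?case
            proof (cases "n y = 0")
              case True
              then show ?thesis by simp
            next
              case False
              then obtain b where b: "n y = ennreal b" "0 < b"
                using 1 by (cases "n y") (auto simp: infinity_ennreal_def)
              have "(\<integral>\<^sup>+t. n y * epow (g y t / n y) r \<partial>N) = (\<integral>\<^sup>+t. n y * epow (1 / n y) r * epow (g y t) r \<partial>N)"
                by (simp add: ennreal_times_divide epow_mult[symmetric] divide_ennreal_def mult_ac)
              also have "\<dots> = n y * epow (1 / n y) r * (\<integral>\<^sup>+t. epow (g y t) r \<partial>N)"
                by (intro nn_integral_cmult) measurable
              also have "\<dots> = n y * epow (1 / n y * n y) r"
                by (simp add: nn[symmetric] epow_mult mult.assoc)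
              also have "1 / n y * n y = 1"
                using b by (simp add: divide_ennreal_def inverse_ennreal ennreal_mult[symmetric])
              finally show ?thesis by simp
            qed
          qed
        qed
        finally show ?thesis using real A
          by (simp add: epow_ennreal ennreal_mult[symmetric] powr_diff mult_left_mono)
      qed
      have "eLp N p (\<lambda>t. \<integral>\<^sup>+y. g y t \<partial>M) \<le> ennreal A"
        using key r by (simp add: eLp_def epow_le_iff_left infinity_ennreal_def)
      then show ?thesis using real by (simp add: n_def)
    qed
  qed
qed

section \<open>Herz quasi-norms in one variable\<close>

lemma sigma_finite_count_int [simp]: "sigma_finite_measure (count_space (UNIV :: 'a::countable set))"
  by (rule sigma_finite_measure_count_space_countable) simp

lemma sigma_finite_lborel [simp]: "sigma_finite_measure lborel"
  by (rule lborel.sigma_finite_measure_axioms)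

text \<open>The triangle inequality is Minkowski's integral inequality for the counting measure on
  two points.\<close>

lemma eLp_add:
  assumes N: "sigma_finite_measure N" and p: "1 \<le> p"
    and [measurable]: "f \<in> borel_measurable N" "g \<in> borel_measurable N"
  shows "eLp N p (\<lambda>x. f x + g x) \<le> eLp N p f + eLp N p g"
proof -
  have [measurable]: "case_prod (\<lambda>b::bool. if b then f else g) \<in> borel_measurable (count_space UNIV \<Otimes>\<^sub>M N)"
    unfolding measurable_count_space_eq1
    by (rule measurable_pair_measure_countable1) auto
  have "eLp N p (\<lambda>x. \<integral>\<^sup>+b. (if b then f else g) x \<partial>count_space UNIV)
      \<le> (\<integral>\<^sup>+b. eLp N p (if b then f else g) \<partial>count_space UNIV)"
    by (rule Minkowski_eLp) (use assms in auto)
  then show ?thesis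
    by (simp add: nn_integral_count_space_finite UNIV_bool add.commute)
qed

lemma nn_integral_count_int_decode:
  "(\<integral>\<^sup>+k. f k \<partial>count_space (UNIV :: int set)) = (\<Sum>n. f (int_decode n))"
  using nn_integral_bij_count_space[OF bij_int_decode, of f]
  by (simp add: nn_integral_count_space_nat)

lemma abs_int_decode: "real n \<le> 2 * \<bar>real_of_int (int_decode n)\<bar> + 1"
proof -
  have "real n = 2 * real (n div 2) + real (n mod 2)"
    by (metis of_nat_add of_nat_mult of_nat_numeral mult_div_mod_eq)
  then show ?thesis
    using mod_less_divisor[of 2 n] by (cases "even n") (auto simp: int_decode_def sum_decode_def)
qed

text \<open>Under the enumeration \<open>int_decode\<close> the n-th integer has modulus at least (n
  - 1) / 2, so the two-sided series is dominated by a geometric series with ratio 2^(-e/2).\<close>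

lemma summable_int_geometric:
  assumes "0 < e"
  obtains E where "0 < E" "(\<integral>\<^sup>+k. ennreal (2 powr (- e * \<bar>real_of_int k\<bar>)) \<partial>count_space UNIV) \<le> ennreal E"
proof -
  define q where "q = 2 powr (- e / 2)"
  have q: "0 < q" "q < 1" using assms by (auto simp: q_def powr_less_one)
  have *: "2 powr (- e * \<bar>real_of_int (int_decode n)\<bar>) \<le> 2 powr (e / 2) * q ^ n" for n
  proof -
    have "2 powr (- e * \<bar>real_of_int (int_decode n)\<bar>) \<le> 2 powr (- e * ((real n - 1) / 2))"
      using abs_int_decode[of n] assms by (intro powr_mono) auto
    also have "\<dots> = 2 powr (e / 2) * q ^ n"
      by (simp add: q_def powr_realpow[symmetric] powr_powr powr_add[symmetric] algebra_simps add_divide_distrib diff_divide_distrib)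
    finally show ?thesis .
  qed
  have "(\<integral>\<^sup>+k. ennreal (2 powr (- e * \<bar>real_of_int k\<bar>)) \<partial>count_space UNIV)
      \<le> (\<Sum>n. ennreal (2 powr (e / 2) * q ^ n))"
    unfolding nn_integral_count_int_decode
    by (intro suminf_le summableI ennreal_leI *)
  also have "\<dots> = ennreal (\<Sum>n. 2 powr (e / 2) * q ^ n)"
    using q by (intro suminf_ennreal2) (auto intro!: summable_mult summable_geometric)
  also have "\<dots> \<le> ennreal (2 powr (e / 2) / (1 - q))"
    using q by (simp add: suminf_mult suminf_geometric summable_geometric)
  finally show thesis using q by (intro that) auto
qed

section \<open>Dyadic annuli and the structure of the Herz quasi-norm\<close>

lemma annulus_measurable [measurable]: "annulus k \<in> sets borel"
  unfolding annulus_def by measurable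

lemma emeasure_annulus: "emeasure lborel (annulus k) = ennreal (2 powi k)"
proof -
  define P where "P = (2::real) powi (k - 1)"
  define Q where "Q = (2::real) powi k"
  have P: "0 < P" 
    by (auto simp: P_def)
  have Q: "Q = P + P"
    by (auto simp: P_def Q_def power_int_diff)
  have Q': "P < Q" "P \<le> Q" using P Q by auto
  have "annulus k = {P..<Q} \<union> {-Q<..-P}"
    unfolding annulus_def P_def[symmetric] Q_def[symmetric]
    using P Q' by (auto simp: abs_if split: if_splits)
  moreover have d: "{P..<Q} \<inter> {-Q<..-P} = {}"
    using P by auto
  have "emeasure lborel ({P..<Q} \<union> {-Q<..-P}) = emeasure lborel {P..<Q} + emeasure lborel {-Q<..-P}"
    by (rule plus_emeasure[symmetric]) (simp_all add: d)
  moreover have "\<dots> = ennreal P + ennreal P"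
    using Q'(2) Q by simp
  moreover have "\<dots> = ennreal Q"
    unfolding Q using P by (intro ennreal_plus[symmetric]) auto
  ultimately show ?thesis
    unfolding Q_def by metis
qed

lemma two_powi_eq_powr: "(2::real) powi k = 2 powr real_of_int k"
  by (rule powr_real_of_int'[symmetric]) auto

lemma annulus_iff_log: "t \<noteq> 0 \<Longrightarrow> t \<in> annulus k \<longleftrightarrow> k = \<lfloor>log 2 \<bar>t\<bar>\<rfloor> + 1"
proof -
  assume "t \<noteq> 0"
  then have "t \<in> annulus k \<longleftrightarrow> real_of_int (k - 1) \<le> log 2 \<bar>t\<bar> \<and> log 2 \<bar>t\<bar> < real_of_int (k - 1) + 1"
    by (simp add: annulus_def two_powi_eq_powr le_log_iff log_less_iff)
  also have "\<dots> \<longleftrightarrow> k - 1 = \<lfloor>log 2 \<bar>t\<bar>\<rfloor>"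
    using floor_eq_iff[of "log 2 \<bar>t\<bar>" "k - 1"] by auto
  finally show ?thesis by auto
qed

text \<open>The annuli partition the line without the origin. The missing point is a null set, so a
  function may be split over the annuli under the integral sign.\<close>

lemma sum_indicator_annulus:
  assumes "t \<noteq> 0"
  shows "(\<integral>\<^sup>+k. indicator (annulus k) t \<partial>count_space UNIV) = (1::ennreal)"
proof -
  have "(\<integral>\<^sup>+k. indicator (annulus k) t \<partial>count_space UNIV)
      = (\<integral>\<^sup>+k. indicator {\<lfloor>log 2 \<bar>t\<bar>\<rfloor> + 1} k \<partial>count_space UNIV :: ennreal)"
    by (intro nn_integral_cong) (auto simp: annulus_iff_log[OF assms] indicator_def)
  then show ?thesis by simp
qed

lemma herz_norm_eLp:
  "herz_norm p \<alpha> q g = eLp (count_space UNIV) q (\<lambda>k::int. ennreal (2 powr (real_of_int k * \<alpha>)) *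
     eLp lborel p (\<lambda>t. g t * indicator (annulus k) t))"
  by (simp add: herz_norm_def lq_norm_eq Lp_norm_eq)

lemma herz_norm_mono:
  assumes [measurable]: "f \<in> borel_measurable borel" and "\<And>t. f t \<le> g t"
  shows "herz_norm p \<alpha> q f \<le> herz_norm p \<alpha> q g"
  unfolding herz_norm_eLp
  by (intro eLp_mono mult_left_mono mult_right_mono assms(2)) auto

lemma herz_norm_epow:
  assumes "0 < t" "0 < p" "0 < q" and [measurable]: "g \<in> borel_measurable borel"
  shows "herz_norm (p / ennreal t) (t * \<alpha>) (q / ennreal t) (\<lambda>s. epow (g s) t) = epow (herz_norm p \<alpha> q g) t"
proof -
  have ind: "epow (g s) t * indicator S s = epow (g s * indicator S s) t" for s and S :: "real set"
    by (auto simp: indicator_def)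
  have pw: "ennreal (2 powr (real_of_int k * (t * \<alpha>))) = epow (ennreal (2 powr (real_of_int k * \<alpha>))) t" for k
    by (simp add: epow_ennreal powr_powr mult_ac)
  have "eLp lborel (p / ennreal t) (\<lambda>s. epow (g s * indicator (annulus k) s) t)
      = epow (eLp lborel p (\<lambda>s. g s * indicator (annulus k) s)) t" for k
    using assms by (intro eLp_epow) auto
  then have "herz_norm (p / ennreal t) (t * \<alpha>) (q / ennreal t) (\<lambda>s. epow (g s) t)
     = eLp (count_space UNIV) (q / ennreal t) (\<lambda>k. epow (ennreal (2 powr (real_of_int k * \<alpha>)) *
     eLp lborel p (\<lambda>t. g t * indicator (annulus k) t)) t)"
    by (simp only: herz_norm_eLp ind pw epow_mult[of "ennreal _"])
  also have "\<dots> = epow (herz_norm p \<alpha> q g) t"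
    unfolding herz_norm_eLp using assms by (intro eLp_epow) auto
  finally show ?thesis .
qed

lemma herz_norm_cmult:
  assumes "0 < p" "0 < q" and [measurable]: "f \<in> borel_measurable borel" and c: "c \<noteq> 0" "c \<noteq> \<infinity>"
  shows "herz_norm p \<alpha> q (\<lambda>t. c * f t) = c * herz_norm p \<alpha> q f"
proof -
  have "eLp lborel p (\<lambda>t. c * f t * indicator (annulus k) t) = c * eLp lborel p (\<lambda>t. f t * indicator (annulus k) t)" for k
    unfolding mult.assoc by (subst eLp_cmult) (use assms in auto)
  then show ?thesis
    unfolding herz_norm_eLp
    by (subst eLp_cmult[symmetric]) (use assms in \<open>auto simp: mult_ac\<close>)
qed

lemma measurable_pair_countable2:
  assumes "countable A" "\<And>k. k \<in> A \<Longrightarrow> (\<lambda>x. f (x, k)) \<in> measurable M L"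
  shows "f \<in> measurable (M \<Otimes>\<^sub>M count_space A) L"
  by (subst measurable_pair_swap_iff, rule measurable_pair_measure_countable1)
     (use assms in auto)

lemma herz_norm_measurable:
  assumes [measurable]: "case_prod g \<in> borel_measurable (M \<Otimes>\<^sub>M borel)"
  shows "(\<lambda>x. herz_norm p \<alpha> q (g x)) \<in> borel_measurable M"
  unfolding herz_norm_eLp
proof (intro eLp_measurable)
  have [measurable]: "case_prod g \<in> borel_measurable (M \<Otimes>\<^sub>M lborel)"
    using assms by (simp cong: measurable_cong_sets)
  have k: "(\<lambda>x. eLp lborel p (\<lambda>t. g x t * indicator (annulus k) t)) \<in> borel_measurable M" for k
    by (rule eLp_measurable) simp_all
  show "(\<lambda>(x, k). ennreal (2 powr (real_of_int k * \<alpha>)) *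
     eLp lborel p (\<lambda>t. g x t * indicator (annulus k) t)) \<in> borel_measurable (M \<Otimes>\<^sub>M count_space UNIV)"
    by (rule measurable_pair_countable2) (use k in simp_all)
qed simp

text \<open>Minkowski's inequality is used twice, for Lebesgue measure on each annulus and then for
  the sequence of the annular norms.\<close>

lemma herz_norm_Minkowski:
  assumes M: "sigma_finite_measure M" and pq: "1 \<le> p" "1 \<le> q"
    and [measurable]: "case_prod g \<in> borel_measurable (M \<Otimes>\<^sub>M borel)"
  shows "herz_norm p \<alpha> q (\<lambda>t. \<integral>\<^sup>+y. g y t \<partial>M) \<le> (\<integral>\<^sup>+y. herz_norm p \<alpha> q (g y) \<partial>M)"
proof -
  interpret M: sigma_finite_measure M by fact
  have g[measurable]: "case_prod g \<in> borel_measurable (M \<Otimes>\<^sub>M lborel)"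
    using assms(4) by (simp cong: measurable_cong_sets)
  have [measurable]: "(\<lambda>(t, y). g y t) \<in> borel_measurable (lborel \<Otimes>\<^sub>M M)" by measurable
  define G where "G y k = ennreal (2 powr (real_of_int k * \<alpha>)) * eLp lborel p (\<lambda>t. g y t * indicator (annulus k) t)" for y and k :: int
  have Gk[measurable]: "(\<lambda>y. eLp lborel p (\<lambda>t. g y t * indicator (annulus k) t)) \<in> borel_measurable M" for k
    by (intro eLp_measurable) simp_all
  have G[measurable]: "case_prod G \<in> borel_measurable (M \<Otimes>\<^sub>M count_space UNIV)"
    unfolding G_def by (rule measurable_pair_countable2) auto
  have "herz_norm p \<alpha> q (\<lambda>t. \<integral>\<^sup>+y. g y t \<partial>M) \<le> eLp (count_space UNIV) q (\<lambda>k. \<integral>\<^sup>+y. G y k \<partial>M)"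
    unfolding herz_norm_eLp
  proof (rule eLp_mono)
    fix k :: int
    have "eLp lborel p (\<lambda>t. (\<integral>\<^sup>+y. g y t \<partial>M) * indicator (annulus k) t)
       = eLp lborel p (\<lambda>t. (\<integral>\<^sup>+y. g y t * indicator (annulus k) t \<partial>M))"
      by (intro eLp_AE_cong AE_I2 nn_integral_multc[symmetric]) auto
    also have "\<dots> \<le> (\<integral>\<^sup>+y. eLp lborel p (\<lambda>t. g y t * indicator (annulus k) t) \<partial>M)"
      by (rule Minkowski_eLp) (use M pq in auto)
    finally show "ennreal (2 powr (real_of_int k * \<alpha>)) * eLp lborel p (\<lambda>t. (\<integral>\<^sup>+y. g y t \<partial>M) * indicator (annulus k) t)
        \<le> (\<integral>\<^sup>+y. G y k \<partial>M)"
      by (simp add: G_def nn_integral_cmult mult_left_mono)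
  qed simp
  also have "\<dots> \<le> (\<integral>\<^sup>+y. eLp (count_space UNIV) q (G y) \<partial>M)"
    by (rule Minkowski_eLp) (use M pq in auto)
  also have "G = (\<lambda>y k. ennreal (2 powr (real_of_int k * \<alpha>)) * eLp lborel p (\<lambda>t. g y t * indicator (annulus k) t))"
    by (simp add: G_def fun_eq_iff)
  finally show ?thesis by (simp only: herz_norm_eLp)
qed

lemma AE_lborel_scale:
  fixes c :: real
  assumes "c \<noteq> 0" and [measurable]: "Measurable.pred borel Q"
  shows "(AE t in lborel. Q (c * t)) \<longleftrightarrow> (AE t in lborel. Q t)"
proof -
  have "lborel = density (distr lborel borel (\<lambda>x. 0 + c * x)) (\<lambda>_. ennreal \<bar>c\<bar>)"
    using lborel_real_affine[OF assms(1), of 0] .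
  then have "(AE t in lborel. Q t) \<longleftrightarrow> (AE t in density (distr lborel borel (\<lambda>x. 0 + c * x)) (\<lambda>_. ennreal \<bar>c\<bar>). Q t)"
    by (rule arg_cong)
  also have "\<dots> \<longleftrightarrow> (AE t in lborel. Q (c * t))"
    using assms(1) by (simp add: AE_density AE_distr_iff)
  finally show ?thesis by simp
qed

lemma eLp_scale:
  assumes "0 < p" and [measurable]: "f \<in> borel_measurable borel" and c: "0 < c"
  shows "eLp lborel p (\<lambda>t. f (c * t)) = ennreal (c powr (- recip p)) * eLp lborel p f"
proof (cases "p = \<infinity>")
  case True
  have "esssup lborel (\<lambda>t. f (c * t)) \<le> b \<longleftrightarrow> esssup lborel f \<le> b" for b
    using c by (simp add: esssup_le_iff AE_lborel_scale[of c "\<lambda>t. f t \<le> b"])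
  then have "esssup lborel (\<lambda>t. f (c * t)) = esssup lborel f"
    by (meson antisym order_refl)
  then show ?thesis using True c by (simp add: eLp_def recip_def)
next
  case False
  then obtain r where r: "p = ennreal r" "0 < r"
    using assms(1) by (cases p) (auto simp: infinity_ennreal_def)
  have rr: "recip p = 1 / r" using r by (simp add: recip_def divide_ennreal flip: ennreal_1)
  have "(\<integral>\<^sup>+t. epow (f t) r \<partial>lborel) = ennreal c * (\<integral>\<^sup>+t. epow (f (c * t)) r \<partial>lborel)"
    using nn_integral_real_affine[of "\<lambda>t. epow (f t) r" c 0] c by simp
  then have "ennreal (1 / c) * (\<integral>\<^sup>+t. epow (f t) r \<partial>lborel) = (\<integral>\<^sup>+t. epow (f (c * t)) r \<partial>lborel)"
    using c by (simp add: mult.assoc[symmetric] ennreal_mult[symmetric])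
  moreover have "epow (ennreal (1 / c)) (1 / r) = ennreal (c powr (- (1 / r)))"
    using c by (simp add: epow_ennreal powr_minus powr_divide inverse_eq_divide)
  moreover have "epow (ennreal (1 / c) * (\<integral>\<^sup>+t. epow (f t) r \<partial>lborel)) (1 / r)
      = epow (ennreal (1 / c)) (1 / r) * epow (\<integral>\<^sup>+t. epow (f t) r \<partial>lborel) (1 / r)"
    by (rule epow_mult)
  ultimately have "epow (\<integral>\<^sup>+t. epow (f (c * t)) r \<partial>lborel) (1 / r)
      = ennreal (c powr (- (1 / r))) * epow (\<integral>\<^sup>+t. epow (f t) r \<partial>lborel) (1 / r)"
    by (simp only:)
  then show ?thesis using r rr
    by (simp add: eLp_def infinity_ennreal_def)
qed

lemma eLp_count_shift:
  "eLp (count_space UNIV) q (\<lambda>k::int. a (k + m)) = eLp (count_space UNIV) q a"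
proof -
  have bij: "bij (\<lambda>k::int. k + m)"
    by (rule o_bij[of "\<lambda>k. k - m"]) (auto simp: fun_eq_iff)
  have "range (\<lambda>k. a (k + m)) = a ` range (\<lambda>k. k + m)"
    by (simp only: image_image)
  then have "range (\<lambda>k. a (k + m)) = range a"
    by (simp only: bij_is_surj[OF bij])
  then show ?thesis
    using nn_integral_bij_count_space[OF bij, of "\<lambda>k. epow (a k) (enn2real q)"]
    by (simp add: lq_norm_eq[symmetric] lq_norm_def)
qed

lemma annulus_scale: "2 powi m * t \<in> annulus (k + m) \<longleftrightarrow> t \<in> annulus k"
proof -
  have "(2::real) powi (k + m - 1) = 2 powi m * 2 powi (k - 1)" "(2::real) powi (k + m) = 2 powi m * 2 powi k"
    by (simp_all add: two_powi_eq_powr powr_add[symmetric] algebra_simps)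
  then show ?thesis by (simp add: annulus_def abs_mult)
qed

text \<open>Dilation by a power of 2 permutes the annuli. The change of variable costs the factor
  with 1/p, the shift of the index the factor with \<alpha>. Since annuli are mapped onto annuli,
  this is an identity and not merely an equivalence of norms.\<close>

lemma herz_norm_scale:
  assumes "0 < p" "0 < q" and [measurable]: "g \<in> borel_measurable borel"
  shows "herz_norm p \<alpha> q (\<lambda>t. g (2 powi m * t))
       = ennreal (2 powr (- real_of_int m * (recip p + \<alpha>))) * herz_norm p \<alpha> q g"
proof -
  define a where "a k = ennreal (2 powr (real_of_int k * \<alpha>)) * eLp lborel p (\<lambda>t. g t * indicator (annulus k) t)" for k
  have "ennreal (2 powr (real_of_int k * \<alpha>)) * eLp lborel p (\<lambda>t. g (2 powi m * t) * indicator (annulus k) t)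
      = ennreal (2 powr (- real_of_int m * (recip p + \<alpha>))) * a (k + m)" for k
  proof -
    have "eLp lborel p (\<lambda>t. g (2 powi m * t) * indicator (annulus k) t)
        = eLp lborel p (\<lambda>t. (\<lambda>t. g t * indicator (annulus (k + m)) t) (2 powi m * t))"
      by (simp add: indicator_def annulus_scale)
    also have "\<dots> = ennreal ((2 powi m) powr (- recip p)) * eLp lborel p (\<lambda>t. g t * indicator (annulus (k + m)) t)"
      by (intro eLp_scale) (use assms in auto)
    moreover have "ennreal (2 powr (real_of_int k * \<alpha>)) * ennreal ((2 powi m) powr (- recip p))
       = ennreal (2 powr (- real_of_int m * (recip p + \<alpha>))) * ennreal (2 powr (real_of_int (k + m) * \<alpha>))"
    proof -
      have "real_of_int k * \<alpha> + real_of_int m * (- recip p) = - real_of_int m * (recip p + \<alpha>) + real_of_int (k + m) * \<alpha>"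
        by (simp add: algebra_simps)
      then have "2 powr (real_of_int k * \<alpha>) * (2 powi m) powr (- recip p)
        = 2 powr (- real_of_int m * (recip p + \<alpha>)) * 2 powr (real_of_int (k + m) * \<alpha>)"
        by (simp only: two_powi_eq_powr powr_powr powr_add[symmetric])
      then show ?thesis by (simp only: ennreal_mult[symmetric] powr_ge_zero)
    qed
    ultimately show ?thesis
      by (simp only: a_def mult.assoc[symmetric])
  qed
  then have "herz_norm p \<alpha> q (\<lambda>t. g (2 powi m * t))
      = eLp (count_space UNIV) q (\<lambda>k. ennreal (2 powr (- real_of_int m * (recip p + \<alpha>))) * a (k + m))"
    by (simp only: herz_norm_eLp)
  also have "\<dots> = ennreal (2 powr (- real_of_int m * (recip p + \<alpha>))) * eLp (count_space UNIV) q (\<lambda>k. a (k + m))"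
    using assms by (intro eLp_cmult) auto
  also have "eLp (count_space UNIV) q (\<lambda>k. a (k + m)) = herz_norm p \<alpha> q g"
    using eLp_count_shift[of q a m] by (simp only: herz_norm_eLp a_def[abs_def])
  finally show ?thesis .
qed

section \<open>Smoothing in one variable\<close>

lemma recip_infinity [simp]: "recip \<infinity> = 0" "recip top = 0"
  by (simp_all add: recip_def)

lemma recip_ennreal: "0 < r \<Longrightarrow> recip (ennreal r) = 1 / r"
  by (simp add: recip_def divide_ennreal flip: ennreal_1)

lemma recip_nonneg: "0 \<le> recip p"
  by (simp add: recip_def)

lemma exponent_cases:
  assumes "0 < p"
  obtains "p = \<infinity>" | r where "p = ennreal r" "0 < r" "p \<noteq> \<infinity>" "p \<noteq> top" "enn2real p = r" "recip p = 1 / r"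
  using assms by (cases p) (auto simp: infinity_ennreal_def recip_ennreal)

lemma eLp_indicator_le:
  assumes [measurable]: "S \<in> sets borel" and m: "emeasure lborel S = ennreal m" "0 < m" and "0 < P"
  shows "eLp lborel P (\<lambda>x. c * indicator S x) \<le> c * ennreal (m powr recip P)"
  using \<open>0 < P\<close>
proof (cases rule: exponent_cases)
  case 1
  have "eLp lborel \<infinity> (\<lambda>x. c * indicator S x) \<le> c"
    by (subst eLp_infinity_le_iff) (auto intro!: AE_I2 simp: indicator_def)
  then show ?thesis
    using m 1 by simp
next
  case (2 r)
  have "epow (c * indicator S x) r = epow c r * indicator S x" for x
    by (auto simp: indicator_def)
  then have "eLp lborel P (\<lambda>x. c * indicator S x) = epow (epow c r * ennreal m) (1 / r)"
    using 2 m by (simp add: eLp_def nn_integral_cmult)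
  also have "\<dots> = c * ennreal (m powr recip P)"
    using 2 m by (simp add: epow_mult epow_epow epow_ennreal)
  finally show ?thesis by simp
qed

text \<open>H\<ddieresis>older's inequality against a constant, obtained from Jensen's inequality
  with the density \<open>indicator S\<close>.\<close>

lemma Hoelder_indicator:
  assumes [measurable]: "S \<in> sets borel" "h \<in> borel_measurable borel"
    and m: "emeasure lborel S = ennreal m" "0 < m" and Q: "1 \<le> Q"
  shows "(\<integral>\<^sup>+t. h t * indicator S t \<partial>lborel) \<le> ennreal (m powr (1 - recip Q)) * eLp lborel Q (\<lambda>t. h t * indicator S t)"
proof -
  have "0 < Q" using Q by (rule less_le_trans[rotated]) simp
  then show ?thesis
  proof (cases rule: exponent_cases)
    case 1
    define b where "b = eLp lborel Q (\<lambda>t. h t * indicator S t)"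
    have "AE t in lborel. h t * indicator S t \<le> b"
      by (subst eLp_infinity_le_iff[symmetric]) (simp_all add: b_def 1)
    then have "AE t in lborel. h t * indicator S t \<le> b * indicator S t"
      by eventually_elim (auto simp: indicator_def)
    then have "(\<integral>\<^sup>+t. h t * indicator S t \<partial>lborel) \<le> (\<integral>\<^sup>+t. b * indicator S t \<partial>lborel)"
      by (rule nn_integral_mono_AE)
    also have "\<dots> = b * ennreal m"
      using m by (simp add: nn_integral_cmult)
    finally show ?thesis using m 1 by (simp add: b_def mult.commute)
  next
    case (2 r)
    have r: "1 \<le> r" using 2 Q by (simp flip: ennreal_1)
    have "epow (\<integral>\<^sup>+t. h t * indicator S t \<partial>lborel) r
        = epow (\<integral>\<^sup>+t. indicator S t * (h t * indicator S t) \<partial>lborel) r"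
      by (intro arg_cong2[where f=epow] nn_integral_cong) (auto simp: indicator_def)
    also have "\<dots> \<le> ennreal (m powr (r - 1)) * (\<integral>\<^sup>+t. indicator S t * epow (h t * indicator S t) r \<partial>lborel)"
      by (rule Jensen_ennreal) (use m r in auto)
    also have "(\<integral>\<^sup>+t. indicator S t * epow (h t * indicator S t) r \<partial>lborel) = (\<integral>\<^sup>+t. epow (h t * indicator S t) r \<partial>lborel)"
      by (intro nn_integral_cong) (auto simp: indicator_def)
    finally have "(\<integral>\<^sup>+t. h t * indicator S t \<partial>lborel) \<le> epow (ennreal (m powr (r - 1)) * (\<integral>\<^sup>+t. epow (h t * indicator S t) r \<partial>lborel)) (1 / r)"
      using r by (simp add: epow_le_iff_left)
    also have "\<dots> = ennreal (m powr (1 - recip Q)) * eLp lborel Q (\<lambda>t. h t * indicator S t)"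
      using 2 r by (simp add: epow_mult epow_ennreal powr_powr eLp_def diff_divide_distrib)
    finally show ?thesis .
  qed
qed

text \<open>By interpolation between the exponents \<open>Q\<close> and \<open>\<infinity>\<close>.\<close>

lemma eLp_conv_le:
  fixes w :: "real \<Rightarrow> real"
  assumes w[measurable]: "w \<in> borel_measurable borel" and w01: "\<And>u. 0 \<le> w u" "\<And>u. w u \<le> 1"
    and W: "(\<integral>\<^sup>+u. ennreal (w u) \<partial>lborel) = ennreal W" "0 < W" and QP: "1 \<le> Q" "Q \<le> P"
    and h[measurable]: "h \<in> borel_measurable borel"
  shows "eLp lborel P (\<lambda>x. \<integral>\<^sup>+t. ennreal (w (x - t)) * h t \<partial>lborel) \<le> ennreal (max 1 W) * eLp lborel Q h"
proof -
  define Th where "Th x = (\<integral>\<^sup>+t. ennreal (w (x - t)) * h t \<partial>lborel)" for x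
  have Th[measurable]: "Th \<in> borel_measurable borel"
    unfolding Th_def by (simp cong: measurable_cong_sets)
  define C where "C = max 1 W"
  have C: "1 \<le> C" "W \<le> C" by (auto simp: C_def)
  have int1: "(\<integral>\<^sup>+t. ennreal (w (x - t)) \<partial>lborel) = ennreal W" for x
    using nn_integral_real_affine[of "\<lambda>u. ennreal (w u)" "-1" x] W by simp
  have int2: "(\<integral>\<^sup>+x. ennreal (w (x - t)) \<partial>lborel) = ennreal W" for t
    using nn_integral_real_affine[of "\<lambda>u. ennreal (w u)" "1" "-t"] W by (simp add: algebra_simps)
  define b where "b = eLp lborel Q h"
  have "0 < Q" using QP(1) by (rule less_le_trans[rotated]) simp
  then have "eLp lborel P Th \<le> ennreal C * b"
  proof (cases rule: exponent_cases)
    case 1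
    then have P: "P = \<infinity>" using QP by (simp add: infinity_ennreal_def top_unique)
    have "AE t in lborel. h t \<le> b"
      by (subst eLp_infinity_le_iff[symmetric]) (simp_all add: b_def 1)
    have "Th x \<le> ennreal C * b" for x
    proof -
      have "Th x \<le> (\<integral>\<^sup>+t. ennreal (w (x - t)) * b \<partial>lborel)"
        unfolding Th_def using \<open>AE t in lborel. h t \<le> b\<close>
        by (intro nn_integral_mono_AE) (auto elim!: eventually_mono intro: mult_left_mono)
      also have "\<dots> = ennreal W * b"
        by (simp add: nn_integral_multc int1)
      also have "\<dots> \<le> ennreal C * b"
        using C by (intro mult_right_mono ennreal_leI) auto
      finally show ?thesis .
    qed
    then show ?thesis unfolding P by (subst eLp_infinity_le_iff) auto
  next
    case (2 r)
    have r: "1 \<le> r" using 2 QP by (simp flip: ennreal_1)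
    have br: "epow b r = (\<integral>\<^sup>+t. epow (h t) r \<partial>lborel)"
      using 2 r by (simp add: b_def eLp_def)
    have J: "epow (Th x) r \<le> ennreal (W powr (r - 1)) * (\<integral>\<^sup>+t. ennreal (w (x - t)) * epow (h t) r \<partial>lborel)" for x
      unfolding Th_def by (rule Jensen_ennreal) (use r int1 W in auto)
    have sup: "Th x \<le> ennreal C * b" for x
    proof -
      have "(\<integral>\<^sup>+t. ennreal (w (x - t)) * epow (h t) r \<partial>lborel) \<le> (\<integral>\<^sup>+t. 1 * epow (h t) r \<partial>lborel)"
        using w01 by (intro nn_integral_mono mult_right_mono) auto
      then have "epow (Th x) r \<le> ennreal (W powr (r - 1)) * epow b r"
        using order_trans[OF J[of x] mult_left_mono] br by simp
      also have "\<dots> \<le> ennreal (C powr r) * epow b r"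
      proof (intro mult_right_mono ennreal_leI)
        have "W powr (r - 1) \<le> C powr (r - 1)" using C W r by (intro powr_mono2) auto
        also have "\<dots> \<le> C powr r" using C by (intro powr_mono) auto
        finally show "W powr (r - 1) \<le> C powr r" .
      qed auto
      also have "\<dots> = epow (ennreal C * b) r"
        using C by (simp add: epow_mult epow_ennreal)
      finally show ?thesis using r by (simp add: epow_le_iff)
    qed
    have int: "(\<integral>\<^sup>+x. epow (Th x) r \<partial>lborel) \<le> epow (ennreal C * b) r"
    proof -
      have "(\<integral>\<^sup>+x. epow (Th x) r \<partial>lborel)
          \<le> (\<integral>\<^sup>+x. ennreal (W powr (r - 1)) * (\<integral>\<^sup>+t. ennreal (w (x - t)) * epow (h t) r \<partial>lborel) \<partial>lborel)"
        by (intro nn_integral_mono J)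
      also have "\<dots> = ennreal (W powr (r - 1)) * (\<integral>\<^sup>+x. (\<integral>\<^sup>+t. ennreal (w (x - t)) * epow (h t) r \<partial>lborel) \<partial>lborel)"
        by (intro nn_integral_cmult) measurable
      also have "(\<integral>\<^sup>+x. (\<integral>\<^sup>+t. ennreal (w (x - t)) * epow (h t) r \<partial>lborel) \<partial>lborel)
          = (\<integral>\<^sup>+t. (\<integral>\<^sup>+x. ennreal (w (x - t)) * epow (h t) r \<partial>lborel) \<partial>lborel)"
        by (rule lborel_pair.Fubini') measurable
      also have "\<dots> = ennreal W * epow b r"
        by (simp add: nn_integral_multc int2 nn_integral_cmult br)
      also have "ennreal (W powr (r - 1)) * (ennreal W * epow b r) = ennreal (W powr r) * epow b r"
        using W by (simp add: mult.assoc[symmetric] ennreal_mult[symmetric] powr_diff)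
      also have "\<dots> \<le> ennreal (C powr r) * epow b r"
        using C W r by (intro mult_right_mono ennreal_leI powr_mono2) auto
      also have "\<dots> = epow (ennreal C * b) r"
        using C by (simp add: epow_mult epow_ennreal)
      finally show ?thesis .
    qed
    have "0 < P" using \<open>0 < Q\<close> QP by auto
    then show ?thesis
    proof (cases rule: exponent_cases)
      case 1
      then show ?thesis using sup by (simp only:) (subst eLp_infinity_le_iff, auto)
    next
      case P: (2 s)
      have rs: "r \<le> s" using P 2 QP by simp
      have "(\<integral>\<^sup>+x. epow (Th x) s \<partial>lborel) \<le> (\<integral>\<^sup>+x. epow (ennreal C * b) (s - r) * epow (Th x) r \<partial>lborel)"
      proof (rule nn_integral_mono)
        fix x
        show "epow (Th x) s \<le> epow (ennreal C * b) (s - r) * epow (Th x) r"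
        proof (cases "r = s")
          case True
          show ?thesis
          proof (cases "ennreal C * b")
            case (real y)
            then show ?thesis using sup[of x] True
              by (cases "y = 0") (auto simp: epow_ennreal)
          next
            case top
            then show ?thesis using True by (cases "Th x = 0") (simp_all add: ennreal_top_mult)
          qed
        next
          case False
          have "epow (Th x) s = epow (Th x) (s - r) * epow (Th x) r"
            using False rs r by (subst epow_add[symmetric]) auto
          also have "\<dots> \<le> epow (ennreal C * b) (s - r) * epow (Th x) r"
            using sup[of x] rs by (intro mult_right_mono epow_mono) auto
          finally show ?thesis .
        qed
      qed
      also have "\<dots> = epow (ennreal C * b) (s - r) * (\<integral>\<^sup>+x. epow (Th x) r \<partial>lborel)"
        by (intro nn_integral_cmult) measurable
      also have "\<dots> \<le> epow (ennreal C * b) (s - r) * epow (ennreal C * b) r"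
        by (intro mult_left_mono int) auto
      also have "\<dots> = epow (ennreal C * b) s"
      proof (cases "r = s")
        case True
        show ?thesis
        proof (cases "ennreal C * b")
          case (real y)
          then show ?thesis using True
            by (cases "y = 0") (auto simp: epow_ennreal)
        next
          case top
          then show ?thesis using True by (simp add: ennreal_mult_top)
        qed
      next
        case False
        then show ?thesis using rs r by (subst epow_add[symmetric]) auto
      qed
      finally show ?thesis using P r rs
        by (simp add: eLp_def epow_le_iff_left)
    qed
  qed
  then show ?thesis by (simp add: Th_def[abs_def] C_def b_def)
qed

definition decay :: "real \<Rightarrow> real \<Rightarrow> real"
  where "decay L u = (1 + \<bar>u\<bar>) powr (- L)"

lemma decay_measurable [measurable]: "decay L \<in> borel_measurable borel"
  unfolding decay_def by measurable

lemma decay_pos: "0 < decay L u"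
  by (auto simp: decay_def)

lemma decay_le_1: "0 \<le> L \<Longrightarrow> decay L u \<le> 1"
  by (simp add: decay_def powr_minus_divide ge_one_powr_ge_zero)

lemma decay_integral:
  assumes "2 \<le> L"
  obtains W where "0 < W" "(\<integral>\<^sup>+u. ennreal (decay L u) \<partial>lborel) = ennreal W"
proof -
  have int: "integrable lborel (\<lambda>x::real. inverse (1 + x^2))"
    using integrable_inverse_1_plus_square by (simp add: set_integrable_def)
  have "(\<integral>\<^sup>+u. ennreal (decay L u) \<partial>lborel) \<le> (\<integral>\<^sup>+u. ennreal (inverse (1 + u^2)) \<partial>lborel)"
  proof (intro nn_integral_mono ennreal_leI)
    fix u :: real
    have "decay L u \<le> (1 + \<bar>u\<bar>) powr (- 2)"
      unfolding decay_def using assms by (intro powr_mono) auto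
    also have "\<dots> = inverse ((1 + \<bar>u\<bar>)^2)"
      by (simp add: powr_minus powr_numeral)
    also have "\<dots> \<le> inverse (1 + u^2)"
      by (intro le_imp_inverse_le) (auto simp: power2_sum add_pos_nonneg)
    finally show "decay L u \<le> inverse (1 + u^2)" .
  qed
  also have "\<dots> < \<infinity>"
    using int by (simp add: integrable_iff_bounded)
  finally obtain W where W: "(\<integral>\<^sup>+u. ennreal (decay L u) \<partial>lborel) = ennreal W" "0 \<le> W"
    by (cases "\<integral>\<^sup>+u. ennreal (decay L u) \<partial>lborel") auto
  have "W \<noteq> 0"
  proof
    assume "W = 0"
    then have "AE u in lborel. ennreal (decay L u) = 0" using W by (simp add: nn_integral_0_iff_AE)
    then have "AE u::real in lborel. False"
      by (rule eventually_mono) (metis decay_pos ennreal_eq_0_iff not_le)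
    then have "emeasure lborel (UNIV :: real set) = 0"
      by (simp add: AE_iff_measurable[OF _ refl])
    then show False by simp
  qed
  then show thesis using that[of W] W by auto
qed

lemma eLp_count_ge:
  assumes "0 < q"
  shows "a k \<le> eLp (count_space UNIV) q a"
  using assms
proof (cases rule: exponent_cases)
  case 1
  then show ?thesis by (simp add: lq_norm_eq[symmetric] lq_norm_def SUP_upper)
next
  case (2 r)
  have "epow (a k) r = (\<integral>\<^sup>+j. epow (a j) r * indicator {k} j \<partial>count_space UNIV)"
    by simp
  also have "\<dots> \<le> (\<integral>\<^sup>+j. epow (a j) r \<partial>count_space UNIV)"
    by (intro nn_integral_mono) (auto simp: indicator_def)
  finally show ?thesis using 2 by (simp add: eLp_def epow_le_iff_left)
qed

lemma eLp_count_single: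
  assumes "0 < q"
  shows "eLp (count_space UNIV) q (\<lambda>k. c * indicator {i} k) \<le> c"
  using assms
proof (cases rule: exponent_cases)
  case 1
  then show ?thesis by (auto simp: lq_norm_eq[symmetric] lq_norm_def intro!: SUP_least split: split_indicator)
next
  case (2 r)
  have "epow (c * indicator {i} k) r = epow c r * indicator {i} k" for k
    by (auto simp: indicator_def)
  then show ?thesis using 2 by (simp add: eLp_def)
qed

text \<open>Minkowski's inequality for the decomposition of a sequence into its one-point pieces,
  each of which has norm at most its only entry.\<close>

lemma eLp_count_le_sum:
  fixes a :: "'a::countable \<Rightarrow> ennreal"
  assumes "1 \<le> q"
  shows "eLp (count_space UNIV) q a \<le> (\<integral>\<^sup>+k. a k \<partial>count_space UNIV)"
proof -
  have q: "0 < q" using assms by (rule less_le_trans[rotated]) simp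
  have "a = (\<lambda>k. \<integral>\<^sup>+i. a i * indicator {i} k \<partial>count_space UNIV)"
  proof
    fix k
    have "(\<integral>\<^sup>+i. a i * indicator {i} k \<partial>count_space UNIV) = (\<integral>\<^sup>+i. a i * indicator {k} i \<partial>count_space UNIV)"
      by (intro nn_integral_cong) (auto simp: indicator_def)
    then show "a k = (\<integral>\<^sup>+i. a i * indicator {i} k \<partial>count_space UNIV)" by simp
  qed
  then have "eLp (count_space UNIV) q a = eLp (count_space UNIV) q (\<lambda>k. \<integral>\<^sup>+i. a i * indicator {i} k \<partial>count_space UNIV)"
    by (rule arg_cong)
  also have "\<dots> \<le> (\<integral>\<^sup>+i. eLp (count_space UNIV) q (\<lambda>k. a i * indicator {i} k) \<partial>count_space UNIV)"
    using assms by (intro Minkowski_eLp measurable_pair_countable2) auto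
  also have "\<dots> \<le> (\<integral>\<^sup>+k. a k \<partial>count_space UNIV)"
    by (intro nn_integral_mono eLp_count_single q)
  finally show ?thesis .
qed

text \<open>With m the larger index, points of annuli at least two indices apart have distance at
  least 2^(m-1) - 2^(m-2) = 2^(m-2); the loss of a quarter is the factor 4^L. Neighbouring annuli
  touch and admit no such bound. If both annuli lie in the unit ball, the bound 1 for the kernel is
  enough.\<close>

lemma decay_annuli:
  assumes x: "x \<in> annulus k" and t: "t \<in> annulus j" and L: "0 \<le> L"
    and jk: "2 \<le> \<bar>j - k\<bar> \<or> max j k \<le> 0"
  shows "decay L (x - t) \<le> 4 powr L * 2 powr (- L * real_of_int (max 0 (max j k)))"
proof (cases "max j k \<le> 0")
  case True
  then show ?thesis
    using decay_le_1[OF L, of "x - t"] ge_one_powr_ge_zero[of 4 L] L by simp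
next
  case False
  define m where "m = max j k"
  have "(2::real) powi (m - 2) \<le> \<bar>x - t\<bar>"
  proof -
    have *: "(2::real) powi (m - 2) \<le> \<bar>y - z\<bar>" if "y \<in> annulus m" "z \<in> annulus i" "i \<le> m - 2" for y z i
    proof -
      have "(2::real) powi i \<le> 2 powi (m - 2)"
        using that(3) by (intro power_int_increasing) auto
      moreover have "(2::real) powi (m - 1) = 2 * 2 powi (m - 2)"
        using power_int_add[of "2::real" 1 "m - 2"] by simp
      ultimately show ?thesis using that(1,2) by (auto simp: annulus_def)
    qed
    show ?thesis
    proof (cases "j \<le> k")
      case True
      then show ?thesis using *[of x t j] x t jk False by (auto simp: m_def max_def)
    next
      case False
      then show ?thesis using *[of t x k] x t jk \<open>\<not> max j k \<le> 0\<close> by (auto simp: m_def max_def)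
    qed
  qed
  then have "decay L (x - t) \<le> (2 powi (m - 2)) powr (- L)"
    unfolding decay_def using L by (intro powr_mono2') auto
  also have "\<dots> = (2 powr 2) powr L * 2 powr (- L * real_of_int m)"
    unfolding two_powi_eq_powr powr_powr powr_add[symmetric] by (simp add: algebra_simps)
  also have "m = max 0 (max j k)" using False unfolding m_def by linarith
  finally show ?thesis by simp
qed

text \<open>The part of h on annulus j contributes to the output on annulus k through a matrix
  coefficient. If the annuli are separated, or both lie in the unit ball, the supremum of the kernel
  and H\<ddieresis>older's inequality give the coefficient 2^(k u + j v - L m) up to a constant,
  with m = max(0, j, k). Positivity of u gives decay for k to -\<infinity>, positivity of v for j to
  -\<infinity>, and L for m to \<infinity>. The matrix is thus dominated by the rank-one matrix e k
  e j, and for a rank-one matrix with summable factors the summation exponents \<theta> and r may be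
  arbitrary. Neighbouring annuli outside the unit ball remain. There the coefficient behaves like
  2^(k (a1 - a2)): it is again of rank-one type if a1 < a2, and a bounded band if a1 = a2, which is
  where \<theta> = r enters.\<close>

lemma herz_smoothing:
  assumes QP: "1 \<le> Q" "Q \<le> P" and r: "1 \<le> r" and \<theta>: "1 \<le> \<theta>" "a1 = a2 \<Longrightarrow> \<theta> = r"
    and a: "0 < a1 + recip P" "a1 \<le> a2" "a2 + recip Q < 1"
    and L: "(a1 + recip P) + (1 - recip Q - a2) + 2 \<le> L"
  obtains C where "0 < C" "\<And>h. h \<in> borel_measurable borel \<Longrightarrow>
     herz_norm P a1 r (\<lambda>x. \<integral>\<^sup>+t. ennreal (decay L (x - t)) * h t \<partial>lborel) \<le> ennreal C * herz_norm Q a2 \<theta> h"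
proof -
  define u v where "u = a1 + recip P" and "v = 1 - recip Q - a2"
  have uv: "0 < u" "0 < v" "u + v + 2 \<le> L" using a L by (auto simp: u_def v_def)
  \<comment> \<open>One rate for all regimes: u and v are the rates at -\<infinity>, and a2 - a1 is
    the rate along the diagonal, where e k e j with j close to k costs about 2 \<epsilon> k. This
    explains the division by 2.\<close>
  define \<epsilon> where "\<epsilon> = min 1 (min (min u v) (if a1 < a2 then (a2 - a1) / 2 else 1))"
  have \<epsilon>: "0 < \<epsilon>" "\<epsilon> \<le> 1" "\<epsilon> \<le> u" "\<epsilon> \<le> v" "a1 < a2 \<Longrightarrow> 2 * \<epsilon> \<le> a2 - a1"
    using uv a by (auto simp: \<epsilon>_def min_def)
  have L2: "2 \<le> L" using uv by auto
  obtain W where W: "0 < W" "(\<integral>\<^sup>+u. ennreal (decay L u) \<partial>lborel) = ennreal W"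
    using decay_integral[OF L2] .
  define M where "M = max 1 W"
  have M: "1 \<le> M" by (simp add: M_def)
  \<comment> \<open>The first entry is for separated annuli, the second for neighbours. In the
    latter |a2| pays for the weight 2^(j a2) in place of 2^(k a2), and the additional 1 for |j|
    \<le> k + 1, using \<epsilon> \<le> 1.\<close>
  define D where "D = max (4 powr L) (M * 2 powr (\<bar>a2\<bar> + 1))"
  have D: "0 < D" "4 powr L \<le> D" "M * 2 powr (\<bar>a2\<bar> + 1) \<le> D"
    by (auto simp: D_def less_max_iff_disj)
  define e where "e k = 2 powr (- \<epsilon> * \<bar>real_of_int k\<bar>)" for k
  obtain E where E: "0 < E" "(\<integral>\<^sup>+k. ennreal (e k) \<partial>count_space UNIV) \<le> ennreal E"
    using summable_int_geometric[OF \<epsilon>(1)] unfolding e_def .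
  have pos: "0 < P" "0 < Q" "0 < r" "0 < \<theta>"
    using QP r \<theta> by (auto intro: less_le_trans[OF zero_less_one] order_trans)
  show thesis
  proof (rule that)
    \<comment> \<open>The rank-one part uses E twice, for the sum \<open>S\<close> over j and for
      the sum of \<open>e k\<close> over k; 3 counts the diagonals of the band.\<close>
    show "0 < D * (E * E + 3)" using D E by (simp add: add_pos_pos)
    fix h :: "real \<Rightarrow> ennreal" assume [measurable]: "h \<in> borel_measurable borel"
    define n where "n j = eLp lborel Q (\<lambda>t. h t * indicator (annulus j) t)" for j
    define b where "b j = ennreal (2 powr (real_of_int j * a2)) * n j" for j
    define T where "T j x = (\<integral>\<^sup>+t. ennreal (decay L (x - t)) * (h t * indicator (annulus j) t) \<partial>lborel)" for j x
    have [measurable]: "T j \<in> borel_measurable borel" for j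
      unfolding T_def by (simp cong: measurable_cong_sets)
    define I where "I k j = (if a1 = a2 \<and> \<bar>j - k\<bar> \<le> 1 then 1 else 0 :: real)" for k j :: int
    have claim1: "ennreal (2 powr (real_of_int k * a1)) * eLp lborel P (\<lambda>x. T j x * indicator (annulus k) x)
        \<le> ennreal (D * (e k * e j + I k j)) * b j" for k j
    proof (cases "2 \<le> \<bar>j - k\<bar> \<or> max j k \<le> 0")
      case True
      define m where "m = max 0 (max j k)"
      define w where "w = 4 powr L * 2 powr (- L * real_of_int m)"
      define i where "i = (\<integral>\<^sup>+t. h t * indicator (annulus j) t \<partial>lborel)"
      have "T j x * indicator (annulus k) x \<le> (ennreal w * i) * indicator (annulus k) x" for x
      proof (cases "x \<in> annulus k")
        case x: True
        have "T j x \<le> (\<integral>\<^sup>+t. ennreal w * (h t * indicator (annulus j) t) \<partial>lborel)"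
          unfolding T_def
        proof (rule nn_integral_mono)
          fix t
          show "ennreal (decay L (x - t)) * (h t * indicator (annulus j) t) \<le> ennreal w * (h t * indicator (annulus j) t)"
            using decay_annuli[OF x, of t j L] True L2
            by (cases "t \<in> annulus j") (auto intro!: mult_right_mono ennreal_leI simp: w_def m_def)
        qed
        also have "\<dots> = ennreal w * i" unfolding i_def by (intro nn_integral_cmult) measurable
        finally show ?thesis using x by simp
      qed simp
      then have "eLp lborel P (\<lambda>x. T j x * indicator (annulus k) x) \<le> eLp lborel P (\<lambda>x. (ennreal w * i) * indicator (annulus k) x)"
        by (intro eLp_mono) auto
      also have "\<dots> \<le> ennreal w * i * ennreal ((2 powi k) powr recip P)"
        by (intro eLp_indicator_le pos) (auto simp: emeasure_annulus)
      finally have 1: "eLp lborel P (\<lambda>x. T j x * indicator (annulus k) x) \<le> ennreal w * i * ennreal ((2 powi k) powr recip P)" .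
      have "i \<le> ennreal ((2 powi j) powr (1 - recip Q)) * n j"
        unfolding i_def n_def by (intro Hoelder_indicator QP) (auto simp: emeasure_annulus)
      then have "ennreal (2 powr (real_of_int k * a1)) * eLp lborel P (\<lambda>x. T j x * indicator (annulus k) x)
         \<le> ennreal (2 powr (real_of_int k * a1)) * (ennreal w * (ennreal ((2 powi j) powr (1 - recip Q)) * n j) * ennreal ((2 powi k) powr recip P))"
        by (intro mult_left_mono order_trans[OF 1] mult_right_mono) auto
      also have "\<dots> = ennreal (2 powr (real_of_int k * a1) * w * (2 powi j) powr (1 - recip Q) * (2 powi k) powr recip P) * n j"
        by (simp add: ennreal_mult w_def mult_ac)
      also have "2 powr (real_of_int k * a1) * w * (2 powi j) powr (1 - recip Q) * (2 powi k) powr recip P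
        = 4 powr L * 2 powr (k * u + j * v - L * m) * 2 powr (j * a2)"
      proof -
        have "real_of_int k * a1 + (- L * real_of_int m) + real_of_int j * (1 - recip Q) + real_of_int k * recip P
           = (k * u + j * v - L * m) + (j * a2)"
          by (simp add: u_def v_def algebra_simps)
        then show ?thesis
          by (simp add: w_def two_powi_eq_powr powr_powr powr_add[symmetric] mult_ac)
             (simp add: powr_add[symmetric] algebra_simps)
      qed
      also have "ennreal (4 powr L * 2 powr (k * u + j * v - L * m) * 2 powr (j * a2)) * n j
        = ennreal (4 powr L * 2 powr (k * u + j * v - L * m)) * b j"
        by (simp add: b_def ennreal_mult mult_ac)
      also have "\<dots> \<le> ennreal (D * (e k * e j + I k j)) * b j"
      proof (intro mult_right_mono ennreal_leI)
        \<comment> \<open>For y \<ge> 0 the term (s + \<epsilon>) m pays for both y s and \<epsilon>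
          |y|; for y < 0 the rate s \<ge> \<epsilon> alone suffices. Used once with u and once with
          v, this consumes u + v + 2 \<epsilon> of L, hence the summand 2 in the hypothesis on
          L.\<close>
        have 1: "y * s \<le> (s + \<epsilon>) * real_of_int m - \<epsilon> * \<bar>y\<bar>" if "y \<le> real_of_int m" "\<epsilon> \<le> s" for y s
        proof (cases "0 \<le> y")
          case True
          have "y * (s + \<epsilon>) \<le> real_of_int m * (s + \<epsilon>)" using that \<epsilon> by (intro mult_right_mono) auto
          then show ?thesis using True by (simp add: algebra_simps)
        next
          case False
          have "y * s \<le> y * \<epsilon>" using False that by (intro mult_left_mono_neg) auto
          moreover have "0 \<le> (s + \<epsilon>) * real_of_int m" using that \<epsilon> by (auto simp: m_def)
          moreover have "\<bar>y\<bar> = - y" using False by simp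
          ultimately show ?thesis by (simp only:) (simp only: mult_minus_right mult.commute[of \<epsilon>])
        qed
        have "k * u + j * v - L * m \<le> (u + \<epsilon>) * m - \<epsilon> * \<bar>real_of_int k\<bar> + ((v + \<epsilon>) * m - \<epsilon> * \<bar>real_of_int j\<bar>) - L * m"
        proof -
          have "real_of_int k \<le> real_of_int m" "real_of_int j \<le> real_of_int m" by (auto simp: m_def)
          then show ?thesis using 1[of k u] 1[of j v] \<epsilon> by linarith
        qed
        also have "\<dots> \<le> - \<epsilon> * \<bar>real_of_int k\<bar> + - \<epsilon> * \<bar>real_of_int j\<bar>"
        proof -
          have "(u + v + 2 * \<epsilon>) * real_of_int m \<le> L * real_of_int m"
            using uv \<epsilon> by (intro mult_right_mono) (auto simp: m_def)
          then show ?thesis by (simp add: algebra_simps)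
        qed
        finally have "2 powr (k * u + j * v - L * m) \<le> e k * e j"
          by (simp add: e_def powr_add[symmetric])
        moreover have "0 \<le> I k j" by (simp add: I_def)
        ultimately show "4 powr L * 2 powr (k * u + j * v - L * m) \<le> D * (e k * e j + I k j)"
          using D by (intro mult_mono) auto
      qed auto
      finally show ?thesis .
    next
      case False
      \<comment> \<open>Here max j k \<ge> 1 and the indices differ by at most 1, so k cannot be
        negative. This sign is what makes 2^(k (a1 - a2)) small.\<close>
      then have jk: "\<bar>j - k\<bar> \<le> 1" "0 \<le> k" by (auto simp: max_def split: if_splits)
      have "eLp lborel P (\<lambda>x. T j x * indicator (annulus k) x) \<le> eLp lborel P (T j)"
        by (intro eLp_mono) (auto simp: indicator_def)
      also have "\<dots> \<le> ennreal M * n j"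
        unfolding T_def n_def M_def
        by (intro eLp_conv_le QP W) (use L2 decay_pos[of L] decay_le_1[of L] in \<open>auto intro: less_imp_le\<close>)
      finally have "ennreal (2 powr (real_of_int k * a1)) * eLp lborel P (\<lambda>x. T j x * indicator (annulus k) x)
         \<le> ennreal (2 powr (real_of_int k * a1)) * (ennreal M * n j)"
        by (intro mult_left_mono) auto
      also have "\<dots> = ennreal (M * 2 powr (k * a1 - j * a2)) * b j"
      proof -
        have "2 powr (k * a1) * M = M * 2 powr (k * a1 - j * a2) * 2 powr (j * a2)"
          by (simp add: powr_add[symmetric])
        moreover have "ennreal (2 powr (k * a1)) * (ennreal M * n j) = ennreal (2 powr (k * a1) * M) * n j"
          using M by (simp add: ennreal_mult mult.assoc)
        moreover have "ennreal (M * 2 powr (k * a1 - j * a2)) * b j = ennreal (M * 2 powr (k * a1 - j * a2) * 2 powr (j * a2)) * n j"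
          using M by (simp add: ennreal_mult b_def mult.assoc)
        ultimately show ?thesis by (simp only:)
      qed
      also have "\<dots> \<le> ennreal (D * (e k * e j + I k j)) * b j"
      proof (intro mult_right_mono ennreal_leI)
        have kj: "(k - j) * a2 \<le> \<bar>a2\<bar>"
        proof -
          have "\<bar>real_of_int (k - j) * a2\<bar> \<le> 1 * \<bar>a2\<bar>"
            unfolding abs_mult using jk by (intro mult_right_mono) linarith+
          then show ?thesis by linarith
        qed
        have eq: "k * a1 - j * a2 = k * (a1 - a2) + (k - j) * a2" by (simp add: algebra_simps)
        have "2 powr (k * a1 - j * a2) \<le> 2 powr (\<bar>a2\<bar> + 1) * (e k * e j + I k j)"
        proof (cases "a1 = a2")
          case True
          have "2 powr (k * a1 - j * a2) \<le> 2 powr (\<bar>a2\<bar> + 1)"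
            using kj eq True by (intro powr_mono) auto
          also have "\<dots> \<le> 2 powr (\<bar>a2\<bar> + 1) * (e k * e j + I k j)"
            using True jk by (simp add: I_def e_def)
          finally show ?thesis .
        next
          case False
          then have "2 * \<epsilon> \<le> a2 - a1" using \<epsilon> a by auto
          then have "real_of_int k * (2 * \<epsilon>) \<le> real_of_int k * (a2 - a1)" using jk by (intro mult_left_mono) auto
          moreover have "\<epsilon> * (\<bar>real_of_int k\<bar> + \<bar>real_of_int j\<bar>) \<le> \<epsilon> * (2 * real_of_int k + 1)"
            using jk \<epsilon> by (intro mult_left_mono) linarith+
          ultimately have "k * a1 - j * a2 \<le> (\<bar>a2\<bar> + 1) + (- \<epsilon> * \<bar>real_of_int k\<bar> + - \<epsilon> * \<bar>real_of_int j\<bar>)"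
            using kj eq \<epsilon>(2) by (simp add: algebra_simps)
          then have "2 powr (k * a1 - j * a2) \<le> 2 powr ((\<bar>a2\<bar> + 1) + (- \<epsilon> * \<bar>real_of_int k\<bar> + - \<epsilon> * \<bar>real_of_int j\<bar>))"
            by (intro powr_mono) auto
          also have "\<dots> = 2 powr (\<bar>a2\<bar> + 1) * (e k * e j)"
            by (simp only: e_def powr_add)
          finally show ?thesis using False by (simp add: I_def)
        qed
        then have "M * 2 powr (k * a1 - j * a2) \<le> M * (2 powr (\<bar>a2\<bar> + 1) * (e k * e j + I k j))"
          using M by (intro mult_left_mono) auto
        also have "\<dots> \<le> D * (e k * e j + I k j)"
          unfolding mult.assoc[symmetric] using D
          by (intro mult_right_mono) (auto simp: e_def I_def)
        finally show "M * 2 powr (k * a1 - j * a2) \<le> D * (e k * e j + I k j)" .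
      qed auto
      finally show ?thesis .
    qed
    define Th where "Th x = (\<integral>\<^sup>+t. ennreal (decay L (x - t)) * h t \<partial>lborel)" for x
    have Th_eq: "Th x = (\<integral>\<^sup>+j. T j x \<partial>count_space UNIV)" for x
    proof -
      have "Th x = (\<integral>\<^sup>+t. (\<integral>\<^sup>+j. ennreal (decay L (x - t)) * (h t * indicator (annulus j) t) \<partial>count_space UNIV) \<partial>lborel)"
        unfolding Th_def
      proof (rule nn_integral_cong_AE)
        show "AE t in lborel. ennreal (decay L (x - t)) * h t = (\<integral>\<^sup>+j. ennreal (decay L (x - t)) * (h t * indicator (annulus j) t) \<partial>count_space UNIV)"
          using AE_lborel_singleton[of "0::real"]
          by eventually_elim (simp add: nn_integral_cmult sum_indicator_annulus)
      qed
      also have "\<dots> = (\<integral>\<^sup>+j. T j x \<partial>count_space UNIV)"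
        unfolding T_def by (intro nn_integral_count_space_nn_integral) auto
      finally show ?thesis .
    qed
    define N where "N k = (if a1 = a2 then b (k - 1) + b k + b (k + 1) else 0)" for k
    define S where "S = (\<integral>\<^sup>+j. ennreal (e j) * b j \<partial>count_space UNIV)"
    have claim3: "ennreal (2 powr (real_of_int k * a1)) * eLp lborel P (\<lambda>x. Th x * indicator (annulus k) x)
        \<le> ennreal D * (ennreal (e k) * S + N k)" for k
    proof -
      have "eLp lborel P (\<lambda>x. Th x * indicator (annulus k) x)
          = eLp lborel P (\<lambda>x. \<integral>\<^sup>+j. T j x * indicator (annulus k) x \<partial>count_space UNIV)"
        by (simp add: Th_eq nn_integral_multc)
      also have "\<dots> \<le> (\<integral>\<^sup>+j. eLp lborel P (\<lambda>x. T j x * indicator (annulus k) x) \<partial>count_space UNIV)"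
        using QP by (intro Minkowski_eLp measurable_pair_measure_countable1) auto
      finally have "ennreal (2 powr (real_of_int k * a1)) * eLp lborel P (\<lambda>x. Th x * indicator (annulus k) x)
         \<le> ennreal (2 powr (real_of_int k * a1)) * (\<integral>\<^sup>+j. eLp lborel P (\<lambda>x. T j x * indicator (annulus k) x) \<partial>count_space UNIV)"
        by (intro mult_left_mono) auto
      also have "\<dots> = (\<integral>\<^sup>+j. ennreal (2 powr (real_of_int k * a1)) * eLp lborel P (\<lambda>x. T j x * indicator (annulus k) x) \<partial>count_space UNIV)"
        by (intro nn_integral_cmult[symmetric]) auto
      also have "\<dots> \<le> (\<integral>\<^sup>+j. ennreal (D * (e k * e j + I k j)) * b j \<partial>count_space UNIV)"
        by (intro nn_integral_mono claim1)
      also have "\<dots> = (\<integral>\<^sup>+j. ennreal D * (ennreal (e k) * (ennreal (e j) * b j) + ennreal (I k j) * b j) \<partial>count_space UNIV)"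
        using D by (intro nn_integral_cong) (simp add: ennreal_mult e_def I_def distrib_left distrib_right mult.assoc)
      also have "\<dots> = ennreal D * (ennreal (e k) * S + (\<integral>\<^sup>+j. ennreal (I k j) * b j \<partial>count_space UNIV))"
        unfolding S_def by (simp add: nn_integral_cmult nn_integral_add)
      also have "(\<integral>\<^sup>+j. ennreal (I k j) * b j \<partial>count_space UNIV) = N k"
      proof (cases "a1 = a2")
        case True
        have "(\<integral>\<^sup>+j. ennreal (I k j) * b j \<partial>count_space UNIV) = (\<Sum>j\<in>{k-1, k, k+1}. ennreal (I k j) * b j)"
          by (rule nn_integral_count_space') (auto simp: I_def)
        then show ?thesis using True by (simp add: I_def N_def add.assoc)
      qed (simp add: I_def N_def)
      finally show ?thesis .
    qed
    define B where "B = herz_norm Q a2 \<theta> h"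
    have B: "B = eLp (count_space UNIV) \<theta> b"
      unfolding B_def herz_norm_eLp b_def[abs_def] n_def ..
    have "herz_norm P a1 r Th \<le> ennreal (D * (E * E + 3)) * B"
    proof (cases B)
      case top
      have "0 < D * (E * E + 3)" using D E by (simp add: add_pos_pos)
      then have "ennreal (D * (E * E + 3)) \<noteq> 0" by (simp only: ennreal_eq_0_iff not_le simp_thms)
      then show ?thesis by (simp only: top ennreal_mult_top if_False top_greatest)
    next
      case (real B')
      have "S \<le> (\<integral>\<^sup>+j. ennreal (e j) * B \<partial>count_space UNIV)"
        unfolding S_def B using pos by (intro nn_integral_mono mult_left_mono eLp_count_ge) auto
      also have "\<dots> \<le> ennreal E * B"
        using E by (simp add: nn_integral_multc mult_right_mono)
      finally have S: "S \<le> ennreal (E * B')" using real E by (simp add: ennreal_mult)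
      have "herz_norm P a1 r Th \<le> eLp (count_space UNIV) r (\<lambda>k. ennreal D * (ennreal (e k) * S + N k))"
        unfolding herz_norm_eLp by (intro eLp_mono claim3) auto
      also have "\<dots> \<le> ennreal D * eLp (count_space UNIV) r (\<lambda>k. ennreal (e k) * S + N k)"
        using D pos by (intro eLp_cmult_le) auto
      finally have 1: "herz_norm P a1 r Th \<le> ennreal D * eLp (count_space UNIV) r (\<lambda>k. ennreal (e k) * S + N k)" .
      have 2: "eLp (count_space UNIV) r (\<lambda>k. ennreal (e k) * S + N k)
           \<le> eLp (count_space UNIV) r (\<lambda>k. ennreal (e k) * S) + eLp (count_space UNIV) r N"
        using r by (intro eLp_add) auto
      have "eLp (count_space UNIV) r (\<lambda>k. ennreal (e k) * S) \<le> (\<integral>\<^sup>+k. ennreal (e k) * S \<partial>count_space UNIV)"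
        by (rule eLp_count_le_sum[OF r])
      also have "\<dots> \<le> ennreal E * ennreal (E * B')"
        using E S by (simp add: nn_integral_multc mult_mono)
      finally have 3: "eLp (count_space UNIV) r (\<lambda>k. ennreal (e k) * S) \<le> ennreal E * ennreal (E * B')" .
      have 4: "eLp (count_space UNIV) r N \<le> ennreal (3 * B')"
      proof (cases "a1 = a2")
        case True
        then have N: "N = (\<lambda>k. b (k - 1) + b k + b (k + 1))" by (auto simp: N_def)
        have "eLp (count_space UNIV) r N \<le> eLp (count_space UNIV) r (\<lambda>k. b (k - 1) + b k) + eLp (count_space UNIV) r (\<lambda>k. b (k + 1))"
          unfolding N using r by (intro eLp_add) auto
        also have "\<dots> \<le> (eLp (count_space UNIV) r (\<lambda>k. b (k - 1)) + eLp (count_space UNIV) r b) + eLp (count_space UNIV) r (\<lambda>k. b (k + 1))"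
          using r by (intro add_right_mono eLp_add) auto
        finally have "eLp (count_space UNIV) r N \<le> ennreal B' + ennreal B' + ennreal B'"
          using eLp_count_shift[of r b "-1"] eLp_count_shift[of r b 1] B real True \<theta> by simp
        also have "\<dots> = ennreal (3 * B')" using real by (simp add: ennreal_plus[symmetric] del: ennreal_plus)
        finally show ?thesis .
      next
        case False
        then have "N = (\<lambda>k. ennreal 0 * 1)" by (auto simp: N_def)
        then have "eLp (count_space UNIV) r N \<le> ennreal 0 * eLp (count_space UNIV) r (\<lambda>k::int. 1)"
          using pos by (simp only:) (intro eLp_cmult_le, auto)
        then show ?thesis by simp
      qed
      have "herz_norm P a1 r Th \<le> ennreal D * (ennreal E * ennreal (E * B') + ennreal (3 * B'))"
        by (intro order_trans[OF 1] mult_left_mono order_trans[OF 2] add_mono 3 4) auto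
      also have "\<dots> = ennreal (D * (E * E + 3)) * B"
        using real D E by (simp add: ennreal_mult[symmetric] ennreal_plus[symmetric] algebra_simps del: ennreal_plus)
      finally show ?thesis .
    qed
    then show "herz_norm P a1 r (\<lambda>x. \<integral>\<^sup>+t. ennreal (decay L (x - t)) * h t \<partial>lborel) \<le> ennreal (D * (E * E + 3)) * herz_norm Q a2 \<theta> h"
      unfolding Th_def B_def .
  qed
qed

section \<open>Smoothing in mixed norms\<close>

definition slice :: "'n \<Rightarrow> real^'n \<Rightarrow> real \<Rightarrow> real^'n"
  where "slice i x t = (\<chi> j. if j = i then t else x $ j)"

lemma slice_nth [simp]: "slice i x t $ j = (if j = i then t else x $ j)"
  by (simp add: slice_def)

lemma slice_same [simp]: "slice i x (x $ i) = x"
  by (simp add: vec_eq_iff)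

lemma slice_slice [simp]: "slice i (slice i x s) t = slice i x t"
  by (simp add: vec_eq_iff)

lemma slice_commute: "i \<noteq> j \<Longrightarrow> slice i (slice j x s) t = slice j (slice i x t) s"
  by (auto simp: vec_eq_iff)

lemma slice_axis: "slice i x t = x + (t - x $ i) *\<^sub>R axis i 1"
  by (auto simp: vec_eq_iff axis_def)

lemma slice_measurable [measurable (raw)]:
  fixes f :: "'a \<Rightarrow> real^'n::finite"
  assumes [measurable]: "f \<in> borel_measurable M" "g \<in> borel_measurable M"
  shows "(\<lambda>x. slice i (f x) (g x)) \<in> borel_measurable M"
  unfolding slice_axis cart_eq_inner_axis by measurable

definition slice_norm ::
  "ennreal^'n \<Rightarrow> real^'n \<Rightarrow> ennreal^'n \<Rightarrow> 'n \<Rightarrow> (real^'n \<Rightarrow> ennreal) \<Rightarrow> real^'n \<Rightarrow> ennreal"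
  where "slice_norm p \<alpha> q i g x = herz_norm (p $ i) (\<alpha> $ i) (q $ i) (\<lambda>t. g (slice i x t))"

lemma herz_partial_norm_Cons:
  "herz_partial_norm p \<alpha> q (i # is) g = herz_partial_norm p \<alpha> q is (slice_norm p \<alpha> q i g)"
  by (simp add: slice_norm_def[abs_def] slice_def)

declare herz_partial_norm.simps(2) [simp del]

context
  fixes p q :: "ennreal^'n::finite" and \<alpha> :: "real^'n"
begin

lemma slice_norm_measurable [measurable]:
  assumes [measurable]: "g \<in> borel_measurable borel"
  shows "slice_norm p \<alpha> q i g \<in> borel_measurable borel"
  unfolding slice_norm_def[abs_def] by (rule herz_norm_measurable) measurable

lemma slice_norm_mono:
  assumes [measurable]: "f \<in> borel_measurable borel" and "\<And>x. f x \<le> g x"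
  shows "slice_norm p \<alpha> q i f x \<le> slice_norm p \<alpha> q i g x"
  unfolding slice_norm_def by (intro herz_norm_mono assms(2)) measurable

lemma herz_partial_norm_mono:
  assumes "f \<in> borel_measurable borel" and "\<And>x. f x \<le> g x"
  shows "herz_partial_norm p \<alpha> q is f x \<le> herz_partial_norm p \<alpha> q is g x"
  using assms
proof (induction "is" arbitrary: f g x)
  case (Cons i "is")
  then show ?case
    by (simp add: herz_partial_norm_Cons slice_norm_mono slice_norm_measurable)
qed simp

lemma herz_partial_norm_cmult:
  assumes pq: "\<And>i. 0 < p $ i" "\<And>i. 0 < q $ i" and "f \<in> borel_measurable borel" and c: "c \<noteq> 0" "c \<noteq> \<infinity>"
  shows "herz_partial_norm p \<alpha> q is (\<lambda>x. c * f x) x = c * herz_partial_norm p \<alpha> q is f x"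
  using assms(3)
proof (induction "is" arbitrary: f x)
  case (Cons i "is")
  note [measurable] = Cons.prems
  have "slice_norm p \<alpha> q i (\<lambda>x. c * f x) = (\<lambda>x. c * slice_norm p \<alpha> q i f x)"
    unfolding slice_norm_def by (intro ext herz_norm_cmult pq c) measurable
  then show ?case
    by (simp add: herz_partial_norm_Cons Cons.IH)
qed simp

lemma herz_partial_norm_epow:
  assumes pq: "\<And>i. 0 < p $ i" "\<And>i. 0 < q $ i" and "f \<in> borel_measurable borel" and t: "0 < t"
  shows "herz_partial_norm (\<chi> i. p $ i / ennreal t) (\<chi> i. t * \<alpha> $ i) (\<chi> i. q $ i / ennreal t) is (\<lambda>x. epow (f x) t) x
     = epow (herz_partial_norm p \<alpha> q is f x) t"
  using assms(3)
proof (induction "is" arbitrary: f x)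
  case (Cons i "is")
  note [measurable] = Cons.prems
  have "slice_norm (\<chi> i. p $ i / ennreal t) (\<chi> i. t * \<alpha> $ i) (\<chi> i. q $ i / ennreal t) i (\<lambda>x. epow (f x) t)
      = (\<lambda>x. epow (slice_norm p \<alpha> q i f x) t)"
    unfolding slice_norm_def vec_lambda_beta by (intro ext herz_norm_epow pq t) measurable
  then show ?case
    by (simp add: herz_partial_norm_Cons Cons.IH)
qed simp

text \<open>The point of evaluation is dilated along with the function, because a partial norm still
  depends on the variables outside \<open>is\<close>. At the point 0 this dilation is
  invisible.\<close>

lemma herz_partial_norm_scale:
  assumes pq: "\<And>i. 0 < p $ i" "\<And>i. 0 < q $ i" and "f \<in> borel_measurable borel"
  shows "herz_partial_norm p \<alpha> q is (\<lambda>x. f (2 powi m *\<^sub>R x)) x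
    = ennreal (2 powr (- real_of_int m * (\<Sum>i\<leftarrow>is. recip (p $ i) + \<alpha> $ i))) * herz_partial_norm p \<alpha> q is f (2 powi m *\<^sub>R x)"
  using assms(3)
proof (induction "is" arbitrary: f x)
  case (Cons i "is")
  note [measurable] = Cons.prems
  define c where "c = ennreal (2 powr (- real_of_int m * (recip (p $ i) + \<alpha> $ i)))"
  have sl: "2 powi m *\<^sub>R slice i x t = slice i (2 powi m *\<^sub>R x) (2 powi m * t)" for x :: "real^'n" and t
    by (simp add: vec_eq_iff)
  have "slice_norm p \<alpha> q i (\<lambda>x. f (2 powi m *\<^sub>R x)) = (\<lambda>x. c * slice_norm p \<alpha> q i f (2 powi m *\<^sub>R x))"
    unfolding slice_norm_def sl c_def by (intro ext herz_norm_scale pq) measurable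
  moreover have "c \<noteq> 0" "c \<noteq> \<infinity>" by (auto simp: c_def)
  ultimately have "herz_partial_norm p \<alpha> q (i # is) (\<lambda>x. f (2 powi m *\<^sub>R x)) x
     = c * herz_partial_norm p \<alpha> q is (\<lambda>x. slice_norm p \<alpha> q i f (2 powi m *\<^sub>R x)) x"
    by (simp add: herz_partial_norm_Cons herz_partial_norm_cmult pq)
  also have "\<dots> = (c * ennreal (2 powr (- real_of_int m * (\<Sum>i\<leftarrow>is. recip (p $ i) + \<alpha> $ i)))) * herz_partial_norm p \<alpha> q (i # is) f (2 powi m *\<^sub>R x)"
    by (simp add: Cons.IH herz_partial_norm_Cons mult.assoc)
  also have "c * ennreal (2 powr (- real_of_int m * (\<Sum>i\<leftarrow>is. recip (p $ i) + \<alpha> $ i)))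
     = ennreal (2 powr (- real_of_int m * (\<Sum>i\<leftarrow>i # is. recip (p $ i) + \<alpha> $ i)))"
    by (simp add: c_def ennreal_mult[symmetric] powr_add[symmetric] distrib_left algebra_simps)
  finally show ?case .
qed simp

end

definition slice_conv :: "real \<Rightarrow> 'n \<Rightarrow> (real^'n \<Rightarrow> ennreal) \<Rightarrow> real^'n \<Rightarrow> ennreal"
  where "slice_conv L i h x = (\<integral>\<^sup>+t. ennreal (decay L (x $ i - t)) * h (slice i x t) \<partial>lborel)"

text \<open>Only one variable is smoothed at a time: an estimate \<open>h \<le> K w * h\<close> in every remaining
  variable survives taking the norm in another variable, by Minkowski's integral inequality.\<close>

lemma herz_partial_norm_smoothing:
  fixes P Q r \<theta> :: "ennreal^'n::finite" and a1 a2 :: "real^'n"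
  assumes QP: "\<And>i. 1 \<le> Q $ i" "\<And>i. Q $ i \<le> P $ i" and r: "\<And>i. 1 \<le> r $ i"
    and \<theta>: "\<And>i. 1 \<le> \<theta> $ i" "\<And>i. a1 $ i = a2 $ i \<Longrightarrow> \<theta> $ i = r $ i"
    and a: "\<And>i. 0 < a1 $ i + recip (P $ i)" "\<And>i. a1 $ i \<le> a2 $ i" "\<And>i. a2 $ i + recip (Q $ i) < 1"
    and L: "\<And>i. (a1 $ i + recip (P $ i)) + (1 - recip (Q $ i) - a2 $ i) + 2 \<le> L"
    and K: "0 < K"
  obtains C where "0 < C" "\<And>is h x. distinct is \<Longrightarrow> h \<in> borel_measurable borel \<Longrightarrow>
      (\<And>i x. i \<in> set is \<Longrightarrow> h x \<le> ennreal K * slice_conv L i h x) \<Longrightarrow>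
      herz_partial_norm P a1 r is h x \<le> ennreal (C ^ length is) * herz_partial_norm Q a2 \<theta> is h x"
proof -
  have "\<exists>C>0. \<forall>h\<in>borel_measurable borel.
     herz_norm (P $ i) (a1 $ i) (r $ i) (\<lambda>x. \<integral>\<^sup>+t. ennreal (decay L (x - t)) * h t \<partial>lborel)
     \<le> ennreal C * herz_norm (Q $ i) (a2 $ i) (\<theta> $ i) h" for i
    by (rule herz_smoothing[OF QP(1)[of i] QP(2) r \<theta>(1) \<theta>(2) a(1) a(2) a(3) L]) blast+
  then have "\<forall>i. \<exists>C. 0 < C \<and> (\<forall>h\<in>borel_measurable borel.
     herz_norm (P $ i) (a1 $ i) (r $ i) (\<lambda>x. \<integral>\<^sup>+t. ennreal (decay L (x - t)) * h t \<partial>lborel)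
     \<le> ennreal C * herz_norm (Q $ i) (a2 $ i) (\<theta> $ i) h)"
    by blast
  from choice[OF this] obtain c where c: "\<And>i. 0 < c i" "\<And>i h. h \<in> borel_measurable borel \<Longrightarrow>
     herz_norm (P $ i) (a1 $ i) (r $ i) (\<lambda>x. \<integral>\<^sup>+t. ennreal (decay L (x - t)) * h t \<partial>lborel)
     \<le> ennreal (c i) * herz_norm (Q $ i) (a2 $ i) (\<theta> $ i) h"
    by blast
  define C where "C = K * sum c UNIV"
  have ci: "c i \<le> sum c UNIV" for i
    using c by (intro member_le_sum) (auto intro: less_imp_le)
  have C: "0 < C"
    using K c by (auto simp: C_def intro!: mult_pos_pos sum_pos)
  have pos: "0 < P $ i" "0 < Q $ i" "0 < r $ i" "0 < \<theta> $ i" for i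
    using QP[of i] r[of i] \<theta>(1)[of i] by (auto intro: less_le_trans[OF zero_less_one] order_trans)
  show thesis
  proof (rule that[OF C])
    fix "is" and h :: "real^'n \<Rightarrow> ennreal" and x
    assume "distinct is" "h \<in> borel_measurable borel"
      "\<And>i x. i \<in> set is \<Longrightarrow> h x \<le> ennreal K * slice_conv L i h x"
    then show "herz_partial_norm P a1 r is h x \<le> ennreal (C ^ length is) * herz_partial_norm Q a2 \<theta> is h x"
    proof (induction "is" arbitrary: h x)
      case (Cons i "is")
      note [measurable] = Cons.prems(2)
      define h1 where "h1 = slice_norm Q a2 \<theta> i h"
      have hs: "(\<lambda>t. h (slice i y t)) \<in> borel_measurable borel" for y
        by measurable
      have h1[measurable]: "h1 \<in> borel_measurable borel"
        unfolding h1_def by measurable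
      \<comment> \<open>In the variable being processed the smoothing is spent: it buys the passage
        from the Herz norm with Q, a2, \<theta> to the one with P, a1, r.\<close>
      have 1: "slice_norm P a1 r i h y \<le> ennreal C * h1 y" for y
      proof -
        have "slice_norm P a1 r i h y \<le> herz_norm (P $ i) (a1 $ i) (r $ i)
            (\<lambda>t. ennreal K * (\<integral>\<^sup>+s. ennreal (decay L (t - s)) * h (slice i y s) \<partial>lborel))"
          unfolding slice_norm_def
        proof (rule herz_norm_mono)
          fix t
          show "h (slice i y t) \<le> ennreal K * (\<integral>\<^sup>+s. ennreal (decay L (t - s)) * h (slice i y s) \<partial>lborel)"
            using Cons.prems(3)[of i "slice i y t"] by (simp add: slice_conv_def)
        qed measurable
        also have "\<dots> = ennreal K * herz_norm (P $ i) (a1 $ i) (r $ i)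
            (\<lambda>t. \<integral>\<^sup>+s. ennreal (decay L (t - s)) * h (slice i y s) \<partial>lborel)"
        proof (rule herz_norm_cmult[OF pos(1) pos(3)])
        qed (use K in \<open>measurable, auto\<close>)
        also have "\<dots> \<le> ennreal K * (ennreal (c i) * h1 y)"
          unfolding h1_def slice_norm_def by (rule mult_left_mono[OF c(2)[OF hs]]) simp
        also have "\<dots> \<le> ennreal K * (ennreal (sum c UNIV) * h1 y)"
          by (intro mult_left_mono mult_right_mono ennreal_leI ci) auto
        also have "\<dots> = ennreal C * h1 y"
          using K ci[of i] c(1)[of i] by (simp add: C_def ennreal_mult mult.assoc)
        finally show ?thesis .
      qed
      have 2: "h1 y \<le> ennreal K * slice_conv L j h1 y" if j: "j \<in> set is" for j y
      proof -
        have ij: "i \<noteq> j" using j Cons.prems(1) by auto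
        have "h1 y \<le> herz_norm (Q $ i) (a2 $ i) (\<theta> $ i)
            (\<lambda>t. ennreal K * (\<integral>\<^sup>+s. ennreal (decay L (y $ j - s)) * h (slice i (slice j y s) t) \<partial>lborel))"
          unfolding h1_def slice_norm_def
        proof (rule herz_norm_mono)
          fix t
          show "h (slice i y t) \<le> ennreal K * (\<integral>\<^sup>+s. ennreal (decay L (y $ j - s)) * h (slice i (slice j y s) t) \<partial>lborel)"
            using Cons.prems(3)[of j "slice i y t"] j ij by (simp add: slice_conv_def slice_commute[OF ij])
        qed measurable
        also have "\<dots> = ennreal K * herz_norm (Q $ i) (a2 $ i) (\<theta> $ i)
            (\<lambda>t. \<integral>\<^sup>+s. ennreal (decay L (y $ j - s)) * h (slice i (slice j y s) t) \<partial>lborel)"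
        proof (rule herz_norm_cmult[OF pos(2) pos(4)])
        qed (use K in \<open>measurable, auto\<close>)
        also have "\<dots> \<le> ennreal K * (\<integral>\<^sup>+s. herz_norm (Q $ i) (a2 $ i) (\<theta> $ i)
            (\<lambda>t. ennreal (decay L (y $ j - s)) * h (slice i (slice j y s) t)) \<partial>lborel)"
        proof (rule mult_left_mono)
          have [measurable]: "(\<lambda>(s, t). ennreal (decay L (y $ j - s)) * h (slice i (slice j y s) t)) \<in> borel_measurable (lborel \<Otimes>\<^sub>M borel)"
            by measurable
          show "herz_norm (Q $ i) (a2 $ i) (\<theta> $ i) (\<lambda>t. \<integral>\<^sup>+s. ennreal (decay L (y $ j - s)) * h (slice i (slice j y s) t) \<partial>lborel)
            \<le> (\<integral>\<^sup>+s. herz_norm (Q $ i) (a2 $ i) (\<theta> $ i) (\<lambda>t. ennreal (decay L (y $ j - s)) * h (slice i (slice j y s) t)) \<partial>lborel)"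
            by (rule herz_norm_Minkowski[OF sigma_finite_lborel QP(1) \<theta>(1)]) measurable
        qed simp
        also have "\<dots> = ennreal K * slice_conv L j h1 y"
          unfolding slice_conv_def h1_def slice_norm_def
          by (intro arg_cong2[where f="(*)"] refl nn_integral_cong herz_norm_cmult pos)
             (auto simp: ennreal_eq_0_iff not_le decay_pos)
        finally show ?thesis .
      qed
      have "herz_partial_norm P a1 r (i # is) h x \<le> herz_partial_norm P a1 r is (\<lambda>x. ennreal C * h1 x) x"
        unfolding herz_partial_norm_Cons by (rule herz_partial_norm_mono[OF _ 1]) simp
      also have "\<dots> = ennreal C * herz_partial_norm P a1 r is h1 x"
        using C pos by (intro herz_partial_norm_cmult) auto
      also have "\<dots> \<le> ennreal C * (ennreal (C ^ length is) * herz_partial_norm Q a2 \<theta> is h1 x)"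
        using 2 Cons.prems(1) by (intro mult_left_mono Cons.IH) auto
      also have "\<dots> = ennreal (C ^ length (i # is)) * herz_partial_norm Q a2 \<theta> (i # is) h x"
        using C by (simp add: herz_partial_norm_Cons h1_def ennreal_mult mult.assoc)
      finally show ?case .
    qed simp
  qed
qed

section \<open>A sampling series for exponentials\<close>

definition sinc :: "real \<Rightarrow> real"
  where "sinc x = (if x = 0 then 1 else sin x / x)"

definition csinc :: "complex \<Rightarrow> complex"
  where "csinc z = (if z = 0 then 1 else sin z / z)"

lemma csinc_of_real: "csinc (of_real x) = of_real (sinc x)"
  by (simp add: csinc_def sinc_def sin_of_real)

lemma sinc_0 [simp]: "sinc 0 = 1"
  by (simp add: sinc_def)

lemma abs_sinc_le_1: "\<bar>sinc x\<bar> \<le> 1"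
  using abs_sin_x_le_abs_x[of x] by (simp add: sinc_def divide_le_eq_1)

lemma abs_sinc_le: "x \<noteq> 0 \<Longrightarrow> \<bar>sinc x\<bar> \<le> 1 / \<bar>x\<bar>"
  by (simp add: sinc_def divide_right_mono)

text \<open>The singularity at 0 is removable, since \<open>csinc\<close> is the difference quotient
  of the sine at 0.\<close>

lemma csinc_holomorphic [holomorphic_intros]:
  assumes "f holomorphic_on S"
  shows "(\<lambda>z. csinc (f z)) holomorphic_on S"
proof -
  have "csinc = (\<lambda>z. if z = 0 then deriv sin 0 else (sin z - sin 0) / (z - 0))"
    by (auto simp: csinc_def fun_eq_iff DERIV_imp_deriv[OF DERIV_sin])
  moreover have "\<dots> holomorphic_on UNIV"
    by (intro pole_lemma_open holomorphic_intros) auto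
  ultimately have "csinc holomorphic_on UNIV" by simp
  then show ?thesis
    using holomorphic_on_compose_gen[OF assms, of csinc UNIV] by (simp add: o_def)
qed

lemma norm_sin_le: "norm (sin z) \<le> exp \<bar>Im z\<bar>"
proof (rule power2_le_imp_le)
  define E where "E = exp (2 * \<bar>Im z\<bar>)"
  have "exp (2 * Im z) \<le> E" "exp (- (2 * Im z)) \<le> E" "1 \<le> E" "-1 \<le> cos (2 * Re z)"
    by (auto simp: E_def)
  moreover have "(p + q - 2 * u) / 4 \<le> E" if "p \<le> E" "q \<le> E" "1 \<le> E" "-1 \<le> u" for p q u
    using that by simp
  ultimately have "(exp (2 * Im z) + exp (- (2 * Im z)) - 2 * cos (2 * Re z)) / 4 \<le> E"
    by blast
  then have "(norm (sin z))^2 \<le> exp (2 * \<bar>Im z\<bar>)"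
    unfolding norm_sin_squared E_def by (simp add: exp_minus[symmetric])
  then show "(norm (sin z))^2 \<le> (exp \<bar>Im z\<bar>)^2"
    by (simp add: exp_double)
qed simp

lemma norm_csinc_le: "1 \<le> norm z \<Longrightarrow> norm (csinc z) \<le> exp \<bar>Im z\<bar> / norm z"
  using norm_sin_le[of z] by (auto simp: csinc_def norm_divide divide_right_mono)

text \<open>The squared modulus of sin(x + i y) is (cosh(2 y) - cos(2 x)) / 2. On vertical lines
  through half-integers the cosine is -1 and helps; once |Im z| \<ge> 1/2 the exponential outweighs
  it. The boundary of a square of half-integer half-side consists of such points.\<close>

lemma norm_sin_pi_ge:
  assumes "\<bar>Re z\<bar> = real n + 1 / 2 \<or> 1 / 2 \<le> \<bar>Im z\<bar>"
  shows "exp (pi * \<bar>Im z\<bar>) / 4 \<le> norm (sin (of_real pi * z))"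
proof (rule power2_le_imp_le)
  define y where "y = pi * \<bar>Im z\<bar>"
  have y: "0 \<le> y" by (simp add: y_def)
  have sq: "(norm (sin (of_real pi * z)))^2 = (exp (2 * y) + exp (- (2 * y)) - 2 * cos (2 * pi * Re z)) / 4"
    unfolding norm_sin_squared by (cases "0 \<le> Im z") (auto simp: y_def exp_minus[symmetric] algebra_simps)
  have "exp (2 * y) / 4 \<le> exp (2 * y) + exp (- (2 * y)) - 2 * cos (2 * pi * Re z)"
    using assms
  proof
    assume a: "\<bar>Re z\<bar> = real n + 1 / 2"
    have "cos (2 * pi * Re z) = cos (2 * pi * \<bar>Re z\<bar>)"
      by (cases "0 \<le> Re z") auto
    also have "\<dots> = cos (2 * pi * real n + pi)"
      unfolding a by (simp add: algebra_simps)
    also have "\<dots> = - 1"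
      using cos_periodic_pi[of "2 * pi * real n"] by (metis cos_int_2pin mult.commute mult.left_commute of_int_of_nat_eq)
    finally have "cos (2 * pi * Re z) = -1" .
    moreover have "exp (2 * y) / 4 \<le> exp (2 * y)" by simp
    ultimately show ?thesis by simp
  next
    assume a: "1 / 2 \<le> \<bar>Im z\<bar>"
    have "pi * (1 / 2) \<le> y" unfolding y_def using a by (intro mult_left_mono) auto
    then have "3 \<le> 2 * y" using pi_gt3 by simp
    then have "4 \<le> exp (2 * y)" using exp_ge_add_one_self[of "2 * y"] by linarith
    moreover have "cos (2 * pi * Re z) \<le> 1" by simp
    moreover have "0 \<le> exp (- (2 * y))" by simp
    ultimately show ?thesis by linarith
  qed
  then have "(exp y / 4)^2 \<le> (norm (sin (of_real pi * z)))^2"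
    unfolding sq by (simp add: power_divide exp_double[symmetric])
  then show "(exp (pi * \<bar>Im z\<bar>) / 4)^2 \<le> (norm (sin (of_real pi * z)))^2"
    by (simp add: y_def)
qed simp

lemma contour_integral_square_bound:
  fixes R :: real
  defines "a \<equiv> Complex (-R) (-R)" and "c \<equiv> Complex R R"
  assumes f: "continuous_on (path_image (rectpath a c)) f" and R: "0 \<le> R" and B: "0 \<le> B"
    "\<And>z. z \<in> path_image (rectpath a c) \<Longrightarrow> norm (f z) \<le> B"
  shows "norm (contour_integral (rectpath a c) f) \<le> 8 * R * B"
proof -
  define b d where "b = Complex R (-R)" and "d = Complex (-R) R"
  have eq: "rectpath a c = linepath a b +++ linepath b c +++ linepath c d +++ linepath d a"
    by (simp add: rectpath_def Let_def a_def b_def c_def d_def)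
  have im: "path_image (rectpath a c) = closed_segment a b \<union> closed_segment b c \<union> closed_segment c d \<union> closed_segment d a"
    unfolding eq by (simp add: path_image_join Un_assoc)
  have co: "f contour_integrable_on linepath x y" if "closed_segment x y \<subseteq> path_image (rectpath a c)" for x y
    using continuous_on_subset[OF f that] by (rule contour_integrable_continuous_linepath)
  have bd: "norm (contour_integral (linepath x y) f) \<le> B * norm (y - x)" if "closed_segment x y \<subseteq> path_image (rectpath a c)" for x y
    using co[OF that] B that by (intro contour_integral_bound_linepath) auto
  have i: "f contour_integrable_on linepath a b" "f contour_integrable_on linepath b c"
    "f contour_integrable_on linepath c d" "f contour_integrable_on linepath d a"
    by (intro co; auto simp: im)+
  have tri: "norm (p + (q + (r + t))) \<le> norm p + (norm q + (norm r + norm t))" for p q r t :: complex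
    using norm_triangle_ineq[of p "q + (r + t)"] norm_triangle_ineq[of q "r + t"] norm_triangle_ineq[of r t] by linarith
  have "norm (contour_integral (rectpath a c) f) = norm (contour_integral (linepath a b) f + (contour_integral (linepath b c) f
     + (contour_integral (linepath c d) f + contour_integral (linepath d a) f)))"
    unfolding eq using i by simp
  also have "\<dots> \<le> norm (contour_integral (linepath a b) f) + (norm (contour_integral (linepath b c) f)
     + (norm (contour_integral (linepath c d) f) + norm (contour_integral (linepath d a) f)))"
    by (rule tri)
  also have "\<dots> \<le> B * norm (b - a) + (B * norm (c - b) + (B * norm (d - c) + B * norm (a - d)))"
    by (intro add_mono bd) (auto simp: im)
  finally have "norm (contour_integral (rectpath a c) f)
    \<le> B * norm (b - a) + (B * norm (c - b) + (B * norm (d - c) + B * norm (a - d)))" .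
  moreover have "norm (b - a) = 2 * R" "norm (c - b) = 2 * R" "norm (d - c) = 2 * R" "norm (a - d) = 2 * R"
    using R cmod_eq_Re[of "b - a"] cmod_eq_Im[of "c - b"] cmod_eq_Re[of "d - c"] cmod_eq_Im[of "a - d"]
    unfolding a_def b_def c_def d_def by simp_all
  ultimately show ?thesis by (simp only:) (simp add: algebra_simps)
qed

text \<open>The first factor alone is the classical interpolation kernel for the integers. The
  further factors are 1 at 0 and leave its zeros in place; they buy decay of orders M and N at the
  price of the exponential type M \<delta> + N \<epsilon>.\<close>

definition sampling_kernel :: "nat \<Rightarrow> real \<Rightarrow> nat \<Rightarrow> real \<Rightarrow> real \<Rightarrow> real"
  where "sampling_kernel M \<delta> N \<epsilon> u = sinc (pi * u) * sinc (\<delta> * u) ^ M * sinc (\<epsilon> * u) ^ N"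

lemma sampling_kernel_int:
  "sampling_kernel M \<delta> N \<epsilon> (real_of_int m) = (if m = 0 then 1 else 0)"
  by (simp add: sampling_kernel_def sinc_def)

text \<open>The residue theorem for \<open>exp (i \<xi> z) g(s - z) / ((z - s) sin (\<pi> z))\<close>, where \<open>g\<close> is the product of
  the factors \<open>sinc\<close> of type less than \<open>\<pi>\<close>: the residues are the terms of the series.\<close>

lemma sampling_exponential:
  assumes \<delta>: "0 < \<delta>" "0 < \<epsilon>" "real M * \<delta> + real N * \<epsilon> \<le> 1" "1 \<le> M" and \<xi>: "\<bar>\<xi>\<bar> \<le> 2"
  shows "(\<lambda>n. \<Sum>m\<in>{- int n..int n}. of_real (sampling_kernel M \<delta> N \<epsilon> (s - real_of_int m)) * cis (\<xi> * real_of_int m))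
     \<longlonglongrightarrow> cis (\<xi> * s)" (is "?S \<longlonglongrightarrow> _")
proof (cases "s \<in> \<int>")
  \<comment> \<open>For an integer s the pole at s would coincide with a zero of the sine and become
    double. The series then has a single non-zero term.\<close>
  case True
  then obtain k where k: "s = of_int k" by (elim Ints_cases)
  have "?S n = cis (\<xi> * s)" if "n \<ge> nat \<bar>k\<bar>" for n
  proof -
    have "?S n = (\<Sum>m\<in>{- int n..int n}. if m = k then cis (\<xi> * s) else 0)"
    proof (rule sum.cong[OF refl])
      fix m
      show "of_real (sampling_kernel M \<delta> N \<epsilon> (s - real_of_int m)) * cis (\<xi> * real_of_int m) = (if m = k then cis (\<xi> * s) else 0)"
        using sampling_kernel_int[of M \<delta> N \<epsilon> "k - m"] by (auto simp: k)
    qed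
    also have "\<dots> = cis (\<xi> * s)"
    proof -
      have "- int n \<le> k \<and> k \<le> int n" using that by linarith
      then show ?thesis by simp
    qed
    finally show ?thesis .
  qed
  then show ?thesis
    by (intro tendsto_eventually) (auto simp: eventually_at_top_linorder)
next
  case s: False
  define g where "g z = csinc (of_real \<delta> * (of_real s - z)) ^ M * csinc (of_real \<epsilon> * (of_real s - z)) ^ N" for z
  define e where "e z = exp (\<i> * of_real \<xi> * z)" for z :: complex
  define v where "v z = (z - of_real s) * sin (of_real pi * z)" for z :: complex
  define f where "f z = e z * g z / v z" for z
  have e_hol: "e holomorphic_on A" and g_hol: "g holomorphic_on A" and v_hol: "v holomorphic_on A" for A
    unfolding e_def g_def v_def by (intro holomorphic_intros)+
  have sin0: "sin (of_real pi * z) = 0 \<longleftrightarrow> z \<in> \<int>" for z :: complex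
  proof -
    have "sin (of_real pi * z) = 0 \<longleftrightarrow> (\<exists>n::int. of_real pi * z = of_real (of_int n * pi))"
      by (rule sin_eq_0)
    also have "\<dots> \<longleftrightarrow> (\<exists>n::int. z = of_int n)"
      by (simp add: mult.commute[of "complex_of_real pi"])
    finally show ?thesis by (auto simp: Ints_def)
  qed
  have v0: "v z = 0 \<longleftrightarrow> z = of_real s \<or> z \<in> \<int>" for z
    by (simp add: v_def sin0)
  have sC: "complex_of_real s \<notin> \<int>"
    using s by (simp add: of_real_in_Ints_iff)
  have sins: "sin (complex_of_real pi * of_real s) \<noteq> 0" using sC sin0 by blast
  define a c where "a n = Complex (- (real n + 1/2)) (- (real n + 1/2))" and "c n = Complex (real n + 1/2) (real n + 1/2)" for n
  define t where "t m = of_real (sampling_kernel M \<delta> N \<epsilon> (s - real_of_int m)) * cis (\<xi> * real_of_int m)" for m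
  have gr: "g (of_real x) = of_real (sinc (\<delta> * (s - x)) ^ M * sinc (\<epsilon> * (s - x)) ^ N)" for x
    by (simp add: g_def csinc_of_real[symmetric])
  have er: "e (of_real x) = cis (\<xi> * x)" for x
    by (simp add: e_def cis_conv_exp mult_ac)
  have res_s: "residue f (of_real s) = cis (\<xi> * s) / sin (of_real pi * of_real s)"
  proof -
    define S where "S = {w::complex. sin (of_real pi * w) \<noteq> 0}"
    have "open S" unfolding S_def by (intro open_Collect_neq continuous_intros)
    have "residue (\<lambda>w. (e w * g w / sin (of_real pi * w)) / (w - of_real s)) (of_real s)
       = e (of_real s) * g (of_real s) / sin (of_real pi * of_real s)"
      by (rule residue_simple[OF \<open>open S\<close>])
         (use sins e_hol g_hol in \<open>auto simp: S_def intro!: holomorphic_intros\<close>)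
    then show ?thesis by (simp add: f_def[abs_def] v_def gr er mult.commute)
  qed
  have res_m: "residue f (of_int m) = - t m / sin (of_real pi * of_real s)" for m
  proof -
    define x where "x = real_of_int m"
    have x: "complex_of_int m = of_real x" by (simp add: x_def)
    have xs: "s - x \<noteq> 0" using s by (auto simp: x_def)
    \<comment> \<open>This is the sign (-1)^m. It enters the kernel and the residue once each, on
      opposite sides of a fraction, and its square is 1.\<close>
    define k where "k = cos (pi * x)"
    have sx: "sin (pi * x) = 0" unfolding x_def by (rule sin_npi_int)
    have k: "k * k = 1"
      using sin_cos_squared_add[of "pi * x"] sx by (simp add: k_def power2_eq_square)
    have sinpi: "sin (pi * (s - x)) = sin (pi * s) * k"
      by (simp add: right_diff_distrib sin_diff sx k_def)
    have tm: "t m = of_real (sin (pi * s) * k / (pi * (s - x))) * g (of_real x) * e (of_real x)"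
      using xs by (simp add: t_def sampling_kernel_def gr er x_def[symmetric] sinc_def[of "pi * (s - x)"] sinpi mult.assoc)
    \<comment> \<open>The simple zero of the sine at the integer x is split off with a holomorphic
      cofactor, so that the residue can be read off as a value.\<close>
    have sinw: "sin (of_real pi * w) = of_real k * (of_real pi * (w - of_real x)) * csinc (of_real pi * (w - of_real x))" for w
    proof -
      have "sin (of_real pi * w) = sin (of_real pi * (w - of_real x) + of_real (pi * x))"
        by (simp add: algebra_simps)
      also have "\<dots> = sin (of_real pi * (w - of_real x)) * of_real k"
        by (simp only: sin_add sin_of_real cos_of_real sx k_def) simp
      finally show ?thesis by (simp add: csinc_def)
    qed
    define d where "d w = (w - of_real s) * (of_real k * of_real pi * csinc (of_real pi * (w - of_real x)))" for w
    have d_hol: "d holomorphic_on A" for A unfolding d_def by (intro holomorphic_intros)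
    define S where "S = {w. d w \<noteq> 0}"
    have "open S" unfolding S_def
      by (intro open_Collect_neq continuous_on_const holomorphic_on_imp_continuous_on d_hol)
    have dx: "d (of_real x) = - of_real ((s - x) * k * pi)"
      by (simp add: d_def csinc_def algebra_simps)
    have "residue (\<lambda>w. (e w * g w / d w) / (w - of_real x)) (of_real x)
       = e (of_real x) * g (of_real x) / d (of_real x)"
    proof (rule residue_simple[OF \<open>open S\<close>])
      show "complex_of_real x \<in> S" unfolding S_def mem_Collect_eq dx using xs k
        by (auto simp flip: of_real_diff)
    qed (use e_hol g_hol d_hol in \<open>auto simp: S_def intro!: holomorphic_intros\<close>)
    also have "(\<lambda>w. (e w * g w / d w) / (w - of_real x)) = f"
      unfolding f_def v_def d_def sinw by (simp add: fun_eq_iff mult_ac)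
    finally have "residue f (of_int m) = - (e (of_real x) * g (of_real x) / of_real ((s - x) * k * pi))"
      by (simp add: x dx)
    also have "\<dots> = - t m / sin (of_real pi * of_real s)"
    proof -
      have sS: "sin (complex_of_real pi * of_real s) = of_real (sin (pi * s))"
        by (simp only: of_real_mult[symmetric] sin_of_real)
      have sne: "sin (pi * s) \<noteq> 0" using sins unfolding sS of_real_eq_0_iff .
      have "k \<noteq> 0" using k by auto
      then have "1 / k = k" using k by (simp add: field_simps)
      have "1 / ((s - x) * k * pi) = (1 / k) / (pi * (s - x))" by (simp add: mult_ac)
      also have "\<dots> = (sin (pi * s) * k / (pi * (s - x))) / sin (pi * s)"
        unfolding \<open>1 / k = k\<close> using sne by simp
      finally have "complex_of_real (1 / ((s - x) * k * pi)) = of_real ((sin (pi * s) * k / (pi * (s - x))) / sin (pi * s))"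
        by (rule arg_cong)
      then have eq: "1 / of_real ((s - x) * k * pi) = of_real (sin (pi * s) * k / (pi * (s - x))) / sin (of_real pi * of_real s :: complex)"
        unfolding of_real_divide[of _ "sin (pi * s)"] sS of_real_divide[of 1] of_real_1 .
      have "- (e (of_real x) * g (of_real x) / of_real ((s - x) * k * pi))
        = - (e (of_real x) * g (of_real x) * (1 / of_real ((s - x) * k * pi)))" by simp
      also have "\<dots> = - t m / sin (of_real pi * of_real s)"
        unfolding eq tm by (simp add: mult_ac)
      finally show ?thesis .
    qed
    finally show ?thesis .
  qed
  have R: "Re (a n) \<le> Re (c n)" "Im (a n) \<le> Im (c n)" for n
    by (auto simp: a_def c_def)
  have path: "\<bar>Re z\<bar> = real n + 1/2 \<or> \<bar>Im z\<bar> = real n + 1/2"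
    "\<bar>Re z\<bar> \<le> real n + 1/2" "\<bar>Im z\<bar> \<le> real n + 1/2"
    if "z \<in> path_image (rectpath (a n) (c n))" for z n
    using that R by (auto simp: path_image_rectpath a_def c_def)
  have int: "contour_integral (rectpath (a n) (c n)) f = 2 * pi * \<i> * ((cis (\<xi> * s) - ?S n) / sin (of_real pi * of_real s))"
    if n: "\<bar>s\<bar> \<le> real n" for n
  proof -
    \<comment> \<open>The half-side n + 3/4 exceeds that of the contour, n + 1/2, and stays below n
      + 1, so that no poles besides \<open>pts\<close> lie in the domain.\<close>
    define S where "S = box (Complex (- (real n + 3/4)) (- (real n + 3/4))) (Complex (real n + 3/4) (real n + 3/4))"
    define pts where "pts = insert (complex_of_real s) (of_int ` {- int n..int n})"
    have pts_box: "p \<in> box (a n) (c n)" if "p \<in> pts" for p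
      using that n by (auto simp: pts_def in_box_complex_iff a_def c_def)
    have pS: "cbox (a n) (c n) \<subseteq> S"
      by (auto simp: S_def in_box_complex_iff in_cbox_complex_iff a_def c_def)
    have "contour_integral (rectpath (a n) (c n)) f
        = 2 * pi * \<i> * (\<Sum>p\<in>pts. winding_number (rectpath (a n) (c n)) p * residue f p)"
    proof (rule Residue_theorem)
      show "open S" "connected S" by (auto simp: S_def intro: convex_connected)
      show "finite pts" by (simp add: pts_def)
      show "f holomorphic_on S - pts"
        unfolding f_def
      proof (intro holomorphic_on_divide holomorphic_on_mult e_hol g_hol v_hol)
        fix z assume z: "z \<in> S - pts"
        have "z \<in> pts" if "z \<in> \<int>"
        proof -
          from that obtain m where "z = of_int m" by (elim Ints_cases)
          then have "\<bar>real_of_int m\<bar> < real n + 3/4" using z by (auto simp: S_def in_box_complex_iff)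
          then have "- int n \<le> m \<and> m \<le> int n" by linarith
          then show ?thesis using \<open>z = of_int m\<close> by (auto simp: pts_def)
        qed
        moreover have "z = of_real s \<Longrightarrow> z \<in> pts" by (simp add: pts_def)
        ultimately show "v z \<noteq> 0" using z v0[of z] by blast
      qed
      show "path_image (rectpath (a n) (c n)) \<subseteq> S - pts"
        using path_image_rectpath_cbox_minus_box[OF R] pS pts_box by auto
      show "\<forall>z. z \<notin> S \<longrightarrow> winding_number (rectpath (a n) (c n)) z = 0"
        using pS by (auto intro!: winding_number_rectpath_outside R)
    qed auto
    also have "(\<Sum>p\<in>pts. winding_number (rectpath (a n) (c n)) p * residue f p) = (\<Sum>p\<in>pts. residue f p)"
      by (intro sum.cong refl) (simp add: winding_number_rectpath pts_box)
    also have "\<dots> = residue f (of_real s) + (\<Sum>m\<in>{- int n..int n}. residue f (of_int m))"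
    proof -
      have "complex_of_real s \<notin> of_int ` {- int n..int n}" by (metis Ints_of_int imageE sC)
      moreover have "inj_on (of_int :: int \<Rightarrow> complex) {- int n..int n}" by (auto simp: inj_on_def)
      ultimately show ?thesis unfolding pts_def by (simp add: sum.reindex)
    qed
    also have "\<dots> = (cis (\<xi> * s) - ?S n) / sin (of_real pi * of_real s)"
      by (simp add: res_s res_m t_def[symmetric] sum_negf sum_divide_distrib[symmetric] diff_divide_distrib)
    finally show ?thesis .
  qed
  \<comment> \<open>From n0 on, the distance d from s to the contour is at least half of its
    half-side, and \<delta> d and \<epsilon> d are at least 1, so that the decay of
    \<open>csinc\<close> applies on the whole contour.\<close>
  define n0 where "n0 = nat \<lceil>2 * \<bar>s\<bar> + 2 / \<delta> + 2 / \<epsilon> + 2\<rceil>"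
  have bound: "norm (contour_integral (rectpath (a n) (c n)) f) \<le> 128 / \<delta> / real n" if n: "n0 \<le> n" for n
  proof -
    define r where "r = real n + 1/2"
    define d where "d = r - \<bar>s\<bar>"
    have nn: "2 * \<bar>s\<bar> + 2 / \<delta> + 2 / \<epsilon> + 2 \<le> real n"
      using n unfolding n0_def by linarith
    have de: "0 < 1 / \<delta>" "0 < 1 / \<epsilon>" using \<delta> by auto
    have nn': "2 * \<bar>s\<bar> + 2 * (1 / \<delta>) + 2 * (1 / \<epsilon>) + 2 \<le> real n" using nn by simp
    have d: "r / 2 \<le> d" "1 / \<delta> \<le> d" "1 / \<epsilon> \<le> d" "1 \<le> d"
      using nn' de abs_ge_zero[of s] d_def r_def by linarith+
    have r: "0 < r" "0 < real n" using nn' de abs_ge_zero[of s] r_def by linarith+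
    have dd: "1 \<le> \<delta> * d" "1 \<le> \<epsilon> * d" using d \<delta> by (auto simp: field_simps)
    have v_ne: "v z \<noteq> 0" if z: "z \<in> path_image (rectpath (a n) (c n))" for z
    proof
      assume "v z = 0"
      then consider "z = of_real s" | m where "z = of_int m" using v0 by (auto elim: Ints_cases)
      then show False
      proof cases
        case 1
        then show False using path(1)[OF z] d r by (auto simp: d_def r_def)
      next
        case (2 m)
        then have "\<bar>real_of_int m\<bar> = real n + 1/2" using path(1)[OF z] by auto
        then have "2 * \<bar>m\<bar> = 2 * int n + 1" by linarith
        then show False by presburger
      qed
    qed
    have fz: "norm (f z) \<le> 4 / (\<delta> * d^2)" if z: "z \<in> path_image (rectpath (a n) (c n))" for z
    proof -
      define y where "y = \<bar>Im z\<bar>"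
      have y: "0 \<le> y" by (simp add: y_def)
      have zs: "d \<le> norm (of_real s - z)"
        using path(1)[OF z] abs_Re_le_cmod[of "of_real s - z"] abs_Im_le_cmod[of "of_real s - z"]
        by (auto simp: d_def r_def)
      have cs: "norm (csinc (of_real \<eta> * (of_real s - z))) \<le> exp (\<eta> * y) / (\<eta> * d)" if \<eta>: "0 < \<eta>" "1 \<le> \<eta> * d" for \<eta>
      proof -
        have n1: "\<eta> * d \<le> norm (of_real \<eta> * (of_real s - z))"
          using zs \<eta> by (simp add: norm_mult)
        then have "norm (csinc (of_real \<eta> * (of_real s - z))) \<le> exp \<bar>Im (of_real \<eta> * (of_real s - z))\<bar> / norm (of_real \<eta> * (of_real s - z))"
          using \<eta> by (intro norm_csinc_le) linarith
        also have "\<dots> \<le> exp \<bar>Im (of_real \<eta> * (of_real s - z))\<bar> / (\<eta> * d)"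
          using n1 \<eta> d by (intro divide_left_mono mult_pos_pos) (assumption | linarith | simp)+
        also have "\<bar>Im (of_real \<eta> * (of_real s - z))\<bar> = \<eta> * y"
          using \<eta> by (simp add: y_def abs_mult)
        finally show ?thesis .
      qed
      have "norm (g z) \<le> (exp (\<delta> * y) / (\<delta> * d)) ^ M * (exp (\<epsilon> * y) / (\<epsilon> * d)) ^ N"
        unfolding g_def norm_mult norm_power using \<delta> dd
        by (intro mult_mono power_mono cs) (auto intro!: zero_le_power divide_nonneg_nonneg)
      also have "\<dots> = exp ((real M * \<delta> + real N * \<epsilon>) * y) * ((1 / (\<delta> * d)) ^ M * (1 / (\<epsilon> * d)) ^ N)"
        by (simp add: power_divide exp_of_nat_mult[symmetric] exp_add[symmetric] algebra_simps)
      also have "\<dots> \<le> exp (1 * y) * (1 / (\<delta> * d) * 1)"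
      proof (intro mult_mono)
        show "exp ((real M * \<delta> + real N * \<epsilon>) * y) \<le> exp (1 * y)"
          using mult_right_mono[OF \<delta>(3) y] by simp
        have "(1 / (\<delta> * d)) ^ M \<le> (1 / (\<delta> * d)) ^ 1"
          using dd \<delta>(4) by (intro power_decreasing) auto
        then show "(1 / (\<delta> * d)) ^ M \<le> 1 / (\<delta> * d)" by simp
        show "(1 / (\<epsilon> * d)) ^ N \<le> 1"
          using dd by (intro power_le_one) auto
      qed (use dd in auto)
      finally have gz: "norm (g z) \<le> exp y / (\<delta> * d)" by simp
      have ez: "norm (e z) \<le> exp (2 * y)"
      proof -
        have "- (\<xi> * Im z) \<le> \<bar>\<xi>\<bar> * \<bar>Im z\<bar>" by (metis abs_ge_minus_self abs_mult)
        also have "\<dots> \<le> 2 * y" unfolding y_def using \<xi> by (intro mult_right_mono) auto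
        finally show ?thesis by (simp add: e_def)
      qed
      have vz: "d * (exp (pi * y) / 4) \<le> norm (v z)"
      proof -
        have "exp (pi * y) / 4 \<le> norm (sin (of_real pi * z))"
          unfolding y_def using path(1)[OF z] by (intro norm_sin_pi_ge[of z n]) auto
        then show ?thesis unfolding v_def norm_mult
          using zs d by (intro mult_mono) (auto simp: norm_minus_commute)
      qed
      \<comment> \<open>The exponential rates in the numerator are 2 from the frequency and 1 from
        the kernel, against \<pi> in the denominator. Of the two powers of d one comes from z - s
        and one from g, thanks to M \<ge> 1; together they beat the length of the contour.\<close>
      have "norm (f z) \<le> (exp (2 * y) * (exp y / (\<delta> * d))) / (d * (exp (pi * y) / 4))"
        unfolding f_def norm_divide norm_mult using vz d \<delta>
        by (intro frac_le mult_mono ez gz) auto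
      also have "\<dots> = (4 / (\<delta> * d^2)) * (exp (3 * y) / exp (pi * y))"
        using d \<delta> by (simp add: field_simps power2_eq_square exp_add[symmetric])
      also have "\<dots> \<le> (4 / (\<delta> * d^2)) * 1"
        using y pi_gt3 \<delta> by (intro mult_left_mono) (auto intro!: mult_right_mono)
      finally show ?thesis by simp
    qed
    have ac: "a n = Complex (-r) (-r)" "c n = Complex r r" by (auto simp: a_def c_def r_def)
    have "norm (contour_integral (rectpath (a n) (c n)) f) \<le> 8 * r * (4 / (\<delta> * d^2))"
      unfolding ac
    proof (rule contour_integral_square_bound; (fold ac)?)
      show "continuous_on (path_image (rectpath (a n) (c n))) f"
        unfolding f_def using v_ne
        by (intro continuous_on_divide continuous_on_mult holomorphic_on_imp_continuous_on e_hol g_hol v_hol) auto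
    qed (use r \<delta> fz in auto)
    also have "\<dots> \<le> 8 * r * (4 / (\<delta> * (r / 2)^2))"
      using d r \<delta> by (intro mult_left_mono divide_left_mono power_mono mult_pos_pos) auto
    also have "\<dots> = 128 / \<delta> / r"
      using r \<delta> by (simp add: field_simps power2_eq_square)
    also have "\<dots> \<le> 128 / \<delta> / real n"
      using r \<delta> by (intro divide_left_mono) (auto simp: r_def)
    finally show ?thesis .
  qed
  define K where "K = norm (sin (complex_of_real pi * of_real s))"
  have ev: "norm (?S n - cis (\<xi> * s)) \<le> (K * 128 / \<delta>) * (1 / real n)" if n: "n0 \<le> n" for n
  proof -
    have "\<bar>s\<bar> \<le> real n"
    proof -
      have "2 * \<bar>s\<bar> + 2 / \<delta> + 2 / \<epsilon> + 2 \<le> real n" using n unfolding n0_def by linarith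
      moreover have "0 < 2 / \<delta>" "0 < 2 / \<epsilon>" using \<delta> by auto
      ultimately show ?thesis by linarith
    qed
    then have "2 * pi * (norm (?S n - cis (\<xi> * s)) / K) = norm (contour_integral (rectpath (a n) (c n)) f)"
      by (simp add: int K_def norm_mult norm_divide norm_minus_commute)
    also have "\<dots> \<le> 128 / \<delta> / real n" by (rule bound[OF n])
    finally have "2 * pi * (norm (?S n - cis (\<xi> * s)) / K) \<le> 128 / \<delta> / real n" .
    moreover have "1 * (norm (?S n - cis (\<xi> * s)) / K) \<le> 2 * pi * (norm (?S n - cis (\<xi> * s)) / K)"
      using pi_gt3 by (intro mult_right_mono) (auto simp: K_def)
    ultimately have "norm (?S n - cis (\<xi> * s)) / K \<le> 128 / \<delta> / real n" by linarith
    moreover have "0 < K" using sins by (simp add: K_def)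
    ultimately show ?thesis by (simp add: field_simps)
  qed
  have "(\<lambda>n. (K * 128 / \<delta>) * (1 / real n)) \<longlonglongrightarrow> (K * 128 / \<delta>) * 0"
    by (intro tendsto_mult tendsto_const lim_1_over_n)
  then have lim0: "(\<lambda>n. (K * 128 / \<delta>) * (1 / real n)) \<longlonglongrightarrow> 0" by simp
  have "(\<lambda>n. ?S n - cis (\<xi> * s)) \<longlonglongrightarrow> 0"
    by (rule Lim_null_comparison[OF eventually_sequentiallyI[of n0, OF ev] lim0])
  then show ?thesis by (rule LIM_zero_cancel)
qed

section \<open>Fourier inversion for band-limited Schwartz functions\<close>

lemma bij_betw_axis_Basis: "bij_betw (\<lambda>i. axis i (1::real)) (UNIV :: 'n::finite set) Basis"
  unfolding bij_betw_def by (auto simp: inj_on_def axis_eq_axis Basis_vec_def)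

lemma inj_axis: "inj (\<lambda>i::'n::finite. axis i (1::real))"
  using bij_betw_axis_Basis by (auto simp: bij_betw_def)

text \<open>Lebesgue measure on the vectors is an image of a product measure indexed by
  \<open>Basis\<close>. This rewrites a product over coordinates as a product over basis vectors,
  which makes the product theorems for integrals applicable.\<close>

lemma lborel_prod_transfer:
  fixes f :: "'n::finite \<Rightarrow> real \<Rightarrow> 'a::comm_monoid_mult"
  shows "(\<Prod>i\<in>UNIV. f i ((\<Sum>b\<in>Basis. h b *\<^sub>R b :: real^'n) $ i))
    = (\<Prod>b\<in>Basis. f (the_inv_into UNIV (\<lambda>i. axis i 1) b) (h b))"
proof -
  have "(\<Sum>b\<in>Basis. h b *\<^sub>R b :: real^'n) $ i = h (axis i 1)" for i
  proof -
    have "(\<Sum>b\<in>Basis. h b *\<^sub>R b :: real^'n) $ i = (\<Sum>b\<in>Basis. h b *\<^sub>R b :: real^'n) \<bullet> axis i 1"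
      by (rule cart_eq_inner_axis)
    also have "\<dots> = h (axis i 1)"
      by (simp add: inner_sum_left inner_Basis if_distrib cong: if_cong)
    finally show ?thesis .
  qed
  moreover have "(\<Prod>b\<in>Basis. f (the_inv_into UNIV (\<lambda>i. axis i 1) b) (h b))
     = (\<Prod>i\<in>UNIV. f (the_inv_into UNIV (\<lambda>i. axis i 1) (axis i (1::real))) (h (axis i 1)))"
    by (rule prod.reindex_bij_betw[OF bij_betw_axis_Basis, symmetric])
  ultimately show ?thesis by (simp add: the_inv_into_f_f[OF inj_axis])
qed

interpretation lborel_product: product_sigma_finite "\<lambda>_::real^'n. lborel :: real measure" ..

lemma nn_integral_lborel_prod_vec:
  fixes f :: "'n::finite \<Rightarrow> real \<Rightarrow> ennreal"
  assumes [measurable]: "\<And>i. f i \<in> borel_measurable borel"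
  shows "(\<integral>\<^sup>+x. (\<Prod>i\<in>UNIV. f i (x $ i)) \<partial>lborel) = (\<Prod>i\<in>UNIV. \<integral>\<^sup>+t. f i t \<partial>lborel)"
proof -
  let ?j = "the_inv_into UNIV (\<lambda>i::'n. axis i (1::real))"
  have [measurable]: "(\<lambda>x::real^'n. \<Prod>i\<in>UNIV. f i (x $ i)) \<in> borel_measurable borel"
    unfolding cart_eq_inner_axis by measurable
  have "(\<integral>\<^sup>+x. (\<Prod>i\<in>UNIV. f i (x $ i)) \<partial>lborel)
      = (\<integral>\<^sup>+h. (\<Prod>b\<in>Basis. f (?j b) (h b)) \<partial>(\<Pi>\<^sub>M b\<in>(Basis :: (real^'n) set). lborel))"
  proof -
    have "(\<integral>\<^sup>+x. (\<Prod>i\<in>UNIV. f i (x $ i)) \<partial>lborel)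
       = (\<integral>\<^sup>+h. (\<Prod>i\<in>UNIV. f i ((\<Sum>b\<in>Basis. h b *\<^sub>R b) $ i)) \<partial>(\<Pi>\<^sub>M b\<in>(Basis :: (real^'n) set). lborel))"
      by (subst lborel_eq, subst nn_integral_distr) simp_all
    then show ?thesis by (simp only: lborel_prod_transfer)
  qed
  also have "\<dots> = (\<Prod>b\<in>Basis. \<integral>\<^sup>+t. f (?j b) t \<partial>lborel)"
    by (rule lborel_product.product_nn_integral_prod) auto
  also have "\<dots> = (\<Prod>i\<in>UNIV. \<integral>\<^sup>+t. f (?j (axis i 1)) t \<partial>lborel)"
    by (rule prod.reindex_bij_betw[OF bij_betw_axis_Basis, symmetric])
  also have "\<dots> = (\<Prod>i\<in>UNIV. \<integral>\<^sup>+t. f i t \<partial>lborel)"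
    by (simp add: the_inv_into_f_f[OF inj_axis])
  finally show ?thesis .
qed

lemma
  fixes f :: "'n::finite \<Rightarrow> real \<Rightarrow> complex"
  assumes int: "\<And>i. integrable lborel (f i)"
  shows integral_lborel_prod_vec: "(LINT x|lborel. (\<Prod>i\<in>UNIV. f i (x $ i))) = (\<Prod>i\<in>UNIV. LINT t|lborel. f i t)"
    and integrable_lborel_prod_vec: "integrable lborel (\<lambda>x::real^'n. \<Prod>i\<in>UNIV. f i (x $ i))"
proof -
  let ?j = "the_inv_into UNIV (\<lambda>i::'n. axis i (1::real))"
  have [measurable]: "f i \<in> borel_measurable borel" for i
    using borel_measurable_integrable[OF int[of i]] by simp
  have m[measurable]: "(\<lambda>x::real^'n. \<Prod>i\<in>UNIV. f i (x $ i)) \<in> borel_measurable borel"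
    unfolding cart_eq_inner_axis by measurable
  have "(LINT x|lborel. (\<Prod>i\<in>UNIV. f i (x $ i)))
      = (LINT h|(\<Pi>\<^sub>M b\<in>(Basis :: (real^'n) set). lborel). (\<Prod>b\<in>Basis. f (?j b) (h b)))"
  proof -
    have "(LINT x|lborel. (\<Prod>i\<in>UNIV. f i (x $ i)))
       = (LINT h|(\<Pi>\<^sub>M b\<in>(Basis :: (real^'n) set). lborel). (\<Prod>i\<in>UNIV. f i ((\<Sum>b\<in>Basis. h b *\<^sub>R b) $ i)))"
      by (subst lborel_eq, subst integral_distr) (simp_all add: m)
    then show ?thesis by (simp only: lborel_prod_transfer)
  qed
  also have "\<dots> = (\<Prod>b\<in>Basis. LINT t|lborel. f (?j b) t)"
    by (rule lborel_product.product_integral_prod) (auto intro: int)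
  also have "\<dots> = (\<Prod>i\<in>UNIV. LINT t|lborel. f (?j (axis i 1)) t)"
    by (rule prod.reindex_bij_betw[OF bij_betw_axis_Basis, symmetric])
  also have "\<dots> = (\<Prod>i\<in>UNIV. LINT t|lborel. f i t)"
    by (simp add: the_inv_into_f_f[OF inj_axis])
  finally show "(LINT x|lborel. (\<Prod>i\<in>UNIV. f i (x $ i))) = (\<Prod>i\<in>UNIV. LINT t|lborel. f i t)" .
  have "integrable (\<Pi>\<^sub>M b\<in>(Basis :: (real^'n) set). lborel) (\<lambda>h. \<Prod>b\<in>Basis. f (?j b) (h b))"
    by (rule lborel_product.product_integrable_prod) (auto intro: int)
  then show "integrable lborel (\<lambda>x::real^'n. \<Prod>i\<in>UNIV. f i (x $ i))"
    by (subst lborel_eq, subst integrable_distr_eq) (simp_all only: lborel_prod_transfer m, measurable)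
qed

text \<open>Since |x| dominates every coordinate, the power 2 n can be distributed as a square to
  each of the n coordinates; the majorant is a product of integrable functions of one
  variable.\<close>

lemma integrable_decay_vec:
  "integrable lborel (\<lambda>x::real^'n::finite. 1 / (1 + norm x) ^ (2 * CARD('n)))"
proof (rule integrableI_bounded)
  obtain W where W: "0 < W" "(\<integral>\<^sup>+u. ennreal (decay 2 u) \<partial>lborel) = ennreal W"
    using decay_integral[of 2] by auto
  have bound: "norm (1 / (1 + norm x) ^ (2 * CARD('n))) \<le> (\<Prod>i\<in>UNIV. decay 2 (x $ i))" for x :: "real^'n"
  proof -
    have "norm (1 / (1 + norm x) ^ (2 * CARD('n))) = (\<Prod>i\<in>(UNIV::'n set). 1 / (1 + norm x)^2)"
      by (simp add: power_mult power_divide)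
    also have "\<dots> \<le> (\<Prod>i\<in>UNIV. decay 2 (x $ i))"
    proof (rule prod_mono, safe)
      fix i
      have "1 / (1 + norm x)^2 \<le> 1 / (1 + \<bar>x $ i\<bar>)^2"
        using component_le_norm_cart[of x i] by (intro divide_left_mono power_mono) auto
      also have "\<dots> = decay 2 (x $ i)"
        by (simp add: decay_def powr_minus powr_numeral divide_inverse)
      finally show "1 / (1 + norm x)^2 \<le> decay 2 (x $ i)" .
    qed simp
    finally show ?thesis .
  qed
  have "(\<integral>\<^sup>+x. ennreal (norm (1 / (1 + norm x) ^ (2 * CARD('n)))) \<partial>(lborel :: (real^'n) measure))
     \<le> (\<integral>\<^sup>+x. (\<Prod>i\<in>UNIV. ennreal (decay 2 (x $ i))) \<partial>(lborel :: (real^'n) measure))"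
  proof (rule nn_integral_mono)
    fix x :: "real^'n"
    show "ennreal (norm (1 / (1 + norm x) ^ (2 * CARD('n)))) \<le> (\<Prod>i\<in>UNIV. ennreal (decay 2 (x $ i)))"
      unfolding prod_ennreal[OF less_imp_le[OF decay_pos]] by (rule ennreal_leI[OF bound])
  qed
  also have "\<dots> < \<infinity>"
    by (subst nn_integral_lborel_prod_vec) (use W(1) in \<open>simp_all add: W(2) ennreal_power\<close>)
  finally show "(\<integral>\<^sup>+x. ennreal (norm (1 / (1 + norm x) ^ (2 * CARD('n)))) \<partial>(lborel :: (real^'n) measure)) < \<infinity>" .
qed measurable

lemma
  fixes f :: "real^'n::finite \<Rightarrow> complex"
  assumes c: "c \<noteq> 0" and f: "f \<in> borel_measurable borel"
  shows integrable_lborel_affine: "integrable lborel (\<lambda>x. f (t + c *\<^sub>R x)) \<longleftrightarrow> integrable lborel f"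
    and integral_lborel_affine: "(LINT x|lborel. f x) = \<bar>c\<bar> ^ CARD('n) *\<^sub>R (LINT x|lborel. f (t + c *\<^sub>R x))"
proof -
  have eq: "lborel = density (distr lborel borel (\<lambda>x. t + c *\<^sub>R x)) (\<lambda>_. ennreal (\<bar>c\<bar> ^ CARD('n)))"
    using lborel_affine[OF c, of t] by simp
  note [measurable] = f
  have "integrable lborel f \<longleftrightarrow> integrable (density (distr lborel borel (\<lambda>x. t + c *\<^sub>R x)) (\<lambda>_. ennreal (\<bar>c\<bar> ^ CARD('n)))) f"
    by (subst eq) simp
  also have "\<dots> \<longleftrightarrow> integrable lborel (\<lambda>x. f (t + c *\<^sub>R x))"
  proof -
    have "integrable lborel (\<lambda>x. f (t + c *\<^sub>R x))" if "integrable lborel (\<lambda>x. (\<bar>c\<bar> ^ CARD('n)) *\<^sub>R f (t + c *\<^sub>R x))"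
      using integrable_scaleR_right[OF that, of "1 / \<bar>c\<bar> ^ CARD('n)"] c by simp
    then show ?thesis
      by (subst integrable_density) (auto simp: integrable_distr_eq)
  qed
  finally show "integrable lborel (\<lambda>x. f (t + c *\<^sub>R x)) \<longleftrightarrow> integrable lborel f" by simp
  have "(LINT x|lborel. f x) = (LINT x|density (distr lborel borel (\<lambda>x. t + c *\<^sub>R x)) (\<lambda>_. ennreal (\<bar>c\<bar> ^ CARD('n))). f x)"
    by (subst eq) simp
  also have "\<dots> = \<bar>c\<bar> ^ CARD('n) *\<^sub>R (LINT x|lborel. f (t + c *\<^sub>R x))"
    by (subst integral_density) (auto simp: integral_distr)
  finally show "(LINT x|lborel. f x) = \<bar>c\<bar> ^ CARD('n) *\<^sub>R (LINT x|lborel. f (t + c *\<^sub>R x))" .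
qed

section \<open>Gaussian regularisation and Fourier inversion\<close>

definition gauss :: "real^'n::finite \<Rightarrow> real"
  where "gauss x = (\<Prod>i\<in>UNIV. std_normal_density (x $ i))"

lemma gauss_measurable [measurable]: "gauss \<in> borel_measurable borel"
  unfolding gauss_def cart_eq_inner_axis by measurable

lemma gauss_eq:
  fixes x :: "real^'n::finite"
  shows "gauss x = exp (- ((norm x)^2 / 2)) / sqrt (2 * pi) ^ CARD('n)"
proof -
  have "gauss x = (\<Prod>i\<in>UNIV. exp (- ((x $ i)^2 / 2)) / sqrt (2 * pi))"
    by (simp add: gauss_def std_normal_density_def)
  also have "\<dots> = exp (\<Sum>i\<in>UNIV. - ((x $ i)^2 / 2)) / sqrt (2 * pi) ^ CARD('n)"
    by (simp add: prod_dividef exp_sum)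
  also have "(\<Sum>i\<in>UNIV. - ((x $ i)^2 / 2)) = - ((norm x)^2 / 2)"
    by (simp add: norm_vec_def L2_set_def sum_nonneg sum_negf sum_divide_distrib[symmetric])
  finally show ?thesis .
qed

lemma gauss_pos: "0 < gauss x"
  by (simp add: gauss_eq)

lemma char_gauss_1: 
  "(LINT t|lborel. of_real (std_normal_density t) * cis (t * y)) = of_real (exp (- (y^2) / 2))"
  and integrable_gauss_1: "integrable lborel (\<lambda>t. of_real (std_normal_density t) * cis (t * y))"
proof -
  have "char std_normal_distribution y = of_real (exp (- (y^2) / 2))"
    by (simp add: char_std_normal_distribution)
  moreover have "char std_normal_distribution y = (LINT t|lborel. std_normal_density t *\<^sub>R iexp (y * t))"
    unfolding char_def by (subst integral_density) (auto simp: normal_density_nonneg)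
  moreover have "std_normal_density t *\<^sub>R iexp (y * t) = of_real (std_normal_density t) * cis (t * y)" for t
    by (simp add: scaleR_conv_of_real cis_conv_exp mult_ac)
  ultimately show "(LINT t|lborel. of_real (std_normal_density t) * cis (t * y)) = of_real (exp (- (y^2) / 2))"
    by simp
  show "integrable lborel (\<lambda>t. of_real (std_normal_density t) * cis (t * y))"
    by (rule Bochner_Integration.integrable_bound[where f=std_normal_density])
       (auto simp: norm_mult cis_conv_exp)
qed

lemma cis_sum: "finite A \<Longrightarrow> cis (\<Sum>i\<in>A. f i) = (\<Prod>i\<in>A. cis (f i))"
  by (induction A rule: finite_induct) (auto simp: cis_mult[symmetric])

lemma char_gauss:
  fixes y :: "real^'n::finite"
  shows "(LINT x|lborel. of_real (gauss x) * cis (x \<bullet> y)) = of_real (sqrt (2 * pi) ^ CARD('n) * gauss y)" (is ?A)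
    and "integrable lborel (\<lambda>x. of_real (gauss x) * cis (x \<bullet> y))" (is ?B)
proof -
  have eq: "of_real (gauss x) * cis (x \<bullet> y) = (\<Prod>i\<in>UNIV. of_real (std_normal_density (x $ i)) * cis (x $ i * y $ i))" for x
    by (simp add: gauss_def inner_vec_def cis_sum prod.distrib)
  have "(LINT x|lborel. of_real (gauss x) * cis (x \<bullet> y)) = (\<Prod>i\<in>UNIV. of_real (exp (- ((y $ i)^2) / 2)))"
    unfolding eq by (subst integral_lborel_prod_vec[of "\<lambda>i t. of_real (std_normal_density t) * cis (t * y $ i)"])
      (auto simp: char_gauss_1 integrable_gauss_1)
  also have "\<dots> = of_real (\<Prod>i\<in>UNIV. sqrt (2 * pi) * std_normal_density (y $ i))"
    by (simp add: std_normal_density_def)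
  finally show ?A by (simp add: gauss_def prod.distrib)
  show ?B
    unfolding eq by (rule integrable_lborel_prod_vec[of "\<lambda>i t. of_real (std_normal_density t) * cis (t * y $ i)"])
      (rule integrable_gauss_1)
qed

lemma integrable_gauss: "integrable lborel (gauss :: real^'n::finite \<Rightarrow> real)"
proof -
  have "\<bar>gauss x\<bar> = gauss x" for x :: "real^'n"
    using gauss_pos[of x] by simp
  then show ?thesis
    using integrable_norm[OF char_gauss(2)[of "0::real^'n"]] by (simp add: norm_mult)
qed

lemma integral_gauss: "(LINT x|lborel. of_real (gauss (x::real^'n::finite))) = (1::complex)"
proof -
  have "(LINT x|lborel. of_real (gauss (x::real^'n))) = complex_of_real (sqrt (2 * pi) ^ CARD('n) * gauss (0::real^'n))"
    using char_gauss(1)[of "0::real^'n"] by simp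
  then show ?thesis by (simp add: gauss_eq)
qed

lemma norm_cis_mult [simp]: "norm (cis a * z) = norm z" "norm (z * cis a) = norm z"
  by (simp_all add: norm_mult)

lemma cis_measurable [measurable]: "cis \<in> borel_measurable borel"
  unfolding cis_conv_exp by measurable

text \<open>A Gaussian factor in \<xi> makes the exchange of the integrals legitimate, and its
  transform is again a Gaussian, which acts on \<open>\<phi>\<close> as an approximate identity. As
  the factor is flattened, both sides converge by dominated convergence. The constant s = (2
  \<pi>)^(n/2) arises twice, from \<open>gauss 0\<close> = 1/s and from the transform, whence (2
  \<pi>)^n.\<close>

lemma fourier_inversion:
  fixes \<phi> :: "real^'n::finite \<Rightarrow> complex"
  assumes cont: "continuous_on UNIV \<phi>" and bdd: "\<And>x. norm (\<phi> x) \<le> B"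
    and int: "integrable lborel \<phi>" and intF: "integrable lborel (fourier \<phi>)"
  shows "of_real ((2 * pi) ^ CARD('n)) * \<phi> x = (LINT \<xi>|lborel. fourier \<phi> \<xi> * cis (x \<bullet> \<xi>))"
proof -
  note [measurable] = borel_measurable_continuous_onI[OF cont]
  have [measurable]: "fourier \<phi> \<in> borel_measurable borel"
    using borel_measurable_integrable[OF intF] by simp
  define d where "d k = 1 / real (Suc k)" for k
  have d: "0 < d k" for k by (simp add: d_def)
  have "d = (\<lambda>k. inverse (real (Suc k)))" by (simp add: d_def fun_eq_iff divide_inverse)
  then have d0: "d \<longlonglongrightarrow> 0" by (simp only: LIMSEQ_inverse_real_of_nat)
  define s where "s = sqrt (2 * pi) ^ CARD('n)"
  have s: "0 < s" "s * s = (2 * pi) ^ CARD('n)"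
    unfolding s_def by (simp, subst power_mult_distrib[symmetric], simp)
  have g0: "gauss (0::real^'n) = 1 / s" by (simp add: gauss_eq s_def)
  have gle: "gauss (y::real^'n) \<le> 1 / s" for y
    using s by (simp add: gauss_eq s_def[symmetric] divide_right_mono)
  have gcont: "continuous_on UNIV (gauss :: real^'n \<Rightarrow> real)"
    unfolding gauss_eq by (intro continuous_intros) auto
  have eq: "(LINT \<xi>|lborel. fourier \<phi> \<xi> * cis (x \<bullet> \<xi>) * of_real (gauss (d k *\<^sub>R \<xi>)))
      = (LINT z|lborel. \<phi> (x + (- d k) *\<^sub>R z) * of_real (s * gauss z))" for k
  proof -
    have intg: "integrable lborel (\<lambda>\<xi>::real^'n. of_real (gauss (d k *\<^sub>R \<xi>)) :: complex)"
      using integrable_lborel_affine[of "d k" "\<lambda>\<xi>::real^'n. complex_of_real (gauss \<xi>)" 0] integrable_gauss d[of k]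
      by (auto simp: integrable_of_real)
    have pint: "integrable (lborel \<Otimes>\<^sub>M lborel) (\<lambda>(y, \<xi>). \<phi> y * (of_real (gauss (d k *\<^sub>R \<xi>)) * cis ((x - y) \<bullet> \<xi>)))"
    proof (rule lborel_pair.Fubini_integrable)
      show "integrable lborel (\<lambda>y. LINT \<xi>|lborel. norm (case (y, \<xi>) of (y, \<xi>) \<Rightarrow> \<phi> y * (of_real (gauss (d k *\<^sub>R \<xi>)) * cis ((x - y) \<bullet> \<xi>))))"
        using int by (simp add: norm_mult)
      show "AE y in lborel. integrable lborel (\<lambda>\<xi>. case (y, \<xi>) of (y, \<xi>) \<Rightarrow> \<phi> y * (of_real (gauss (d k *\<^sub>R \<xi>)) * cis ((x - y) \<bullet> \<xi>)))"
      proof (rule AE_I2, simp only: prod.case)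
        fix y
        show "integrable lborel (\<lambda>\<xi>. \<phi> y * (of_real (gauss (d k *\<^sub>R \<xi>)) * cis ((x - y) \<bullet> \<xi>)))"
          by (intro integrable_mult_right Bochner_Integration.integrable_bound[OF intg]) auto
      qed
    qed measurable
    have "(LINT \<xi>|lborel. fourier \<phi> \<xi> * cis (x \<bullet> \<xi>) * of_real (gauss (d k *\<^sub>R \<xi>)))
       = (LINT \<xi>|lborel. LINT y|lborel. \<phi> y * (of_real (gauss (d k *\<^sub>R \<xi>)) * cis ((x - y) \<bullet> \<xi>)))"
    proof (rule Bochner_Integration.integral_cong[OF refl])
      fix \<xi>
      have c: "cis ((x - y) \<bullet> \<xi>) = cis (- (y \<bullet> \<xi>)) * cis (x \<bullet> \<xi>)" for y
        by (simp add: cis_mult inner_diff_left)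
      have "fourier \<phi> \<xi> * cis (x \<bullet> \<xi>) * of_real (gauss (d k *\<^sub>R \<xi>))
        = (LINT y|lborel. cis (- (y \<bullet> \<xi>)) * \<phi> y) * (cis (x \<bullet> \<xi>) * of_real (gauss (d k *\<^sub>R \<xi>)))"
        by (simp only: fourier_def mult.assoc)
      also have "\<dots> = (LINT y|lborel. (cis (- (y \<bullet> \<xi>)) * \<phi> y) * (cis (x \<bullet> \<xi>) * of_real (gauss (d k *\<^sub>R \<xi>))))"
        by (rule integral_mult_left_zero[symmetric])
      also have "\<dots> = (LINT y|lborel. \<phi> y * (of_real (gauss (d k *\<^sub>R \<xi>)) * cis ((x - y) \<bullet> \<xi>)))"
        by (simp only: c mult_ac)
      finally show "fourier \<phi> \<xi> * cis (x \<bullet> \<xi>) * of_real (gauss (d k *\<^sub>R \<xi>))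
        = (LINT y|lborel. \<phi> y * (of_real (gauss (d k *\<^sub>R \<xi>)) * cis ((x - y) \<bullet> \<xi>)))" .
    qed
    also have "\<dots> = (LINT y|lborel. LINT \<xi>|lborel. \<phi> y * (of_real (gauss (d k *\<^sub>R \<xi>)) * cis ((x - y) \<bullet> \<xi>)))"
      by (rule lborel_pair.Fubini_integral[OF pint])
    also have "\<dots> = (LINT y|lborel. \<phi> y * of_real (s * gauss ((1 / d k) *\<^sub>R (x - y)) / d k ^ CARD('n)))"
    proof (rule Bochner_Integration.integral_cong[OF refl])
      fix y
      define u where "u = (1 / d k) *\<^sub>R (x - y)"
      have "of_real (s * gauss u) = (LINT z|lborel. of_real (gauss z) * cis (z \<bullet> u))"
        by (simp add: char_gauss(1) s_def)
      also have "\<dots> = d k ^ CARD('n) *\<^sub>R (LINT \<xi>|lborel. of_real (gauss (0 + d k *\<^sub>R \<xi>)) * cis ((0 + d k *\<^sub>R \<xi>) \<bullet> u))"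
        using d[of k] by (subst integral_lborel_affine[of "d k" _ 0]) auto
      also have "(\<lambda>\<xi>. of_real (gauss (0 + d k *\<^sub>R \<xi>)) * cis ((0 + d k *\<^sub>R \<xi>) \<bullet> u)) = (\<lambda>\<xi>. of_real (gauss (d k *\<^sub>R \<xi>)) * cis ((x - y) \<bullet> \<xi>))"
        using d[of k] by (simp add: u_def inner_commute)
      finally have "(LINT \<xi>|lborel. of_real (gauss (d k *\<^sub>R \<xi>)) * cis ((x - y) \<bullet> \<xi>)) = of_real (s * gauss u / d k ^ CARD('n))"
        using d[of k] by (simp add: scaleR_conv_of_real field_simps)
      then show "(LINT \<xi>|lborel. \<phi> y * (of_real (gauss (d k *\<^sub>R \<xi>)) * cis ((x - y) \<bullet> \<xi>)))
        = \<phi> y * of_real (s * gauss ((1 / d k) *\<^sub>R (x - y)) / d k ^ CARD('n))"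
        by (simp add: u_def)
    qed
    also have "\<dots> = d k ^ CARD('n) *\<^sub>R (LINT z|lborel. \<phi> (x + (- d k) *\<^sub>R z) *
         of_real (s * gauss ((1 / d k) *\<^sub>R (x - (x + (- d k) *\<^sub>R z))) / d k ^ CARD('n)))"
      using d[of k] by (subst integral_lborel_affine[of "- d k" _ x]) auto
    also have "\<dots> = (LINT z|lborel. d k ^ CARD('n) *\<^sub>R (\<phi> (x + (- d k) *\<^sub>R z) *
         of_real (s * gauss ((1 / d k) *\<^sub>R (x - (x + (- d k) *\<^sub>R z))) / d k ^ CARD('n))))"
      by simp
    also have "\<dots> = (LINT z|lborel. \<phi> (x + (- d k) *\<^sub>R z) * of_real (s * gauss z))"
    proof (rule Bochner_Integration.integral_cong[OF refl])
      fix z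
      have z: "(1 / d k) *\<^sub>R (x - (x + (- d k) *\<^sub>R z)) = z" using d[of k] by simp
      show "d k ^ CARD('n) *\<^sub>R (\<phi> (x + (- d k) *\<^sub>R z) *
         of_real (s * gauss ((1 / d k) *\<^sub>R (x - (x + (- d k) *\<^sub>R z))) / d k ^ CARD('n)))
         = \<phi> (x + (- d k) *\<^sub>R z) * of_real (s * gauss z)"
        unfolding z scaleR_conv_of_real[where 'a=complex] using d[of k] by simp
    qed
    finally show ?thesis .
  qed
  have lim1: "(\<lambda>k. LINT \<xi>|lborel. fourier \<phi> \<xi> * cis (x \<bullet> \<xi>) * of_real (gauss (d k *\<^sub>R \<xi>)))
      \<longlonglongrightarrow> (LINT \<xi>|lborel. fourier \<phi> \<xi> * cis (x \<bullet> \<xi>) * of_real (1 / s))"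
  proof (rule integral_dominated_convergence[where w="\<lambda>\<xi>. norm (fourier \<phi> \<xi>) * (1 / s)"])
    show "AE \<xi> in lborel. (\<lambda>k. fourier \<phi> \<xi> * cis (x \<bullet> \<xi>) * of_real (gauss (d k *\<^sub>R \<xi>))) \<longlonglongrightarrow> fourier \<phi> \<xi> * cis (x \<bullet> \<xi>) * of_real (1 / s)"
    proof (rule AE_I2)
      fix \<xi> :: "real^'n"
      have "(\<lambda>k. d k *\<^sub>R \<xi>) \<longlonglongrightarrow> 0 *\<^sub>R \<xi>" by (intro tendsto_scaleR d0 tendsto_const)
      then have a: "(\<lambda>k. d k *\<^sub>R \<xi>) \<longlonglongrightarrow> 0" by simp
      have "(\<lambda>k. gauss (d k *\<^sub>R \<xi>)) \<longlonglongrightarrow> gauss (0::real^'n)"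
        by (rule continuous_on_tendsto_compose[OF gcont a]) auto
      then show "(\<lambda>k. fourier \<phi> \<xi> * cis (x \<bullet> \<xi>) * of_real (gauss (d k *\<^sub>R \<xi>))) \<longlonglongrightarrow> fourier \<phi> \<xi> * cis (x \<bullet> \<xi>) * of_real (1 / s)"
        unfolding g0[symmetric] by (intro tendsto_intros)
    qed
    show "AE \<xi> in lborel. norm (fourier \<phi> \<xi> * cis (x \<bullet> \<xi>) * of_real (gauss (d k *\<^sub>R \<xi>))) \<le> norm (fourier \<phi> \<xi>) * (1 / s)" for k
    proof (rule AE_I2)
      fix \<xi> :: "real^'n"
      show "norm (fourier \<phi> \<xi> * cis (x \<bullet> \<xi>) * of_real (gauss (d k *\<^sub>R \<xi>))) \<le> norm (fourier \<phi> \<xi>) * (1 / s)"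
        using mult_left_mono[OF gle[of "d k *\<^sub>R \<xi>"] norm_ge_zero[of "fourier \<phi> \<xi>"]] gauss_pos[of "d k *\<^sub>R \<xi>"]
        by (simp add: norm_mult)
    qed
  qed (use intF in auto)
  have lim2: "(\<lambda>k. LINT z|lborel. \<phi> (x + (- d k) *\<^sub>R z) * of_real (s * gauss z))
      \<longlonglongrightarrow> (LINT z|lborel. \<phi> x * of_real (s * gauss (z::real^'n)))"
  proof (rule integral_dominated_convergence[where w="\<lambda>z::real^'n. B * (s * gauss z)"])
    show "AE z in lborel. (\<lambda>k. \<phi> (x + (- d k) *\<^sub>R z) * of_real (s * gauss z)) \<longlonglongrightarrow> \<phi> x * of_real (s * gauss z)"
    proof (rule AE_I2)
      fix z :: "real^'n"
      have "(\<lambda>k. x + (- d k) *\<^sub>R z) \<longlonglongrightarrow> x + (- 0) *\<^sub>R z" by (intro tendsto_intros d0)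
      then have a: "(\<lambda>k. x + (- d k) *\<^sub>R z) \<longlonglongrightarrow> x" by simp
      have "(\<lambda>k. \<phi> (x + (- d k) *\<^sub>R z)) \<longlonglongrightarrow> \<phi> x"
        by (rule continuous_on_tendsto_compose[OF cont a]) auto
      then show "(\<lambda>k. \<phi> (x + (- d k) *\<^sub>R z) * of_real (s * gauss z)) \<longlonglongrightarrow> \<phi> x * of_real (s * gauss z)"
        by (intro tendsto_intros)
    qed
    show "AE z in lborel. norm (\<phi> (x + (- d k) *\<^sub>R z) * of_real (s * gauss z)) \<le> B * (s * gauss z)" for k
    proof (rule AE_I2)
      fix z :: "real^'n"
      have "0 < s * gauss z" using s gauss_pos[of z] by simp
      then show "norm (\<phi> (x + (- d k) *\<^sub>R z) * of_real (s * gauss z)) \<le> B * (s * gauss z)"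
        using mult_right_mono[OF bdd[of "x + (- d k) *\<^sub>R z"], of "s * gauss z"] by (simp only: norm_mult norm_of_real abs_of_pos)
    qed
  qed (use integrable_gauss in auto)
  have "(LINT \<xi>|lborel. fourier \<phi> \<xi> * cis (x \<bullet> \<xi>) * of_real (1 / s)) = (LINT z|lborel. \<phi> x * of_real (s * gauss (z::real^'n)))"
    by (rule LIMSEQ_unique[OF lim1[unfolded eq] lim2])
  then have "(LINT \<xi>|lborel. fourier \<phi> \<xi> * cis (x \<bullet> \<xi>)) * of_real (1 / s) = \<phi> x * of_real s"
    using integral_gauss[where ?'n='n] by (simp add: mult.assoc)
  then have "(LINT \<xi>|lborel. fourier \<phi> \<xi> * cis (x \<bullet> \<xi>)) = \<phi> x * of_real (s * s)"
    using s(1) by (simp add: field_simps)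
  then show ?thesis unfolding s(2) by (simp only: mult.commute)
qed

section \<open>Calculus of Schwartz functions and their seminorms\<close>

lemma partials_append: "partials (js @ is) f = partials js (partials is f)"
  by (induction js) auto

lemma schwartz_differentiable: "\<phi> \<in> schwartz \<Longrightarrow> partials is \<phi> differentiable (at x)"
  by (auto simp: schwartz_def differentiable_on_def)

lemma schwartz_bound:
  assumes "\<phi> \<in> schwartz"
  obtains C where "0 \<le> C" "\<And>x. (1 + norm x) ^ N * norm (partials is \<phi> x) \<le> C"
proof -
  obtain C where "\<And>x. (1 + norm x) ^ N * norm (partials is \<phi> x) \<le> C"
    using assms unfolding schwartz_def by blast
  then show thesis by (intro that[of "max C 0"]) (auto intro: le_max_iff_disj[THEN iffD2])
qed

lemma schwartzI:
  assumes "\<And>is x. partials is \<phi> differentiable (at x)"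
    "\<And>is N. \<exists>C. \<forall>x. (1 + norm x) ^ N * norm (partials is \<phi> x) \<le> C"
  shows "\<phi> \<in> schwartz"
  using assms by (auto simp: schwartz_def differentiable_on_def intro: differentiable_at_withinI)

lemma schwartz_partial: "\<phi> \<in> schwartz \<Longrightarrow> partial i \<phi> \<in> schwartz"
proof -
  assume "\<phi> \<in> schwartz"
  moreover have "partials is (partial i \<phi>) = partials (is @ [i]) \<phi>" for "is"
    by (simp add: partials_append)
  ultimately show ?thesis by (simp add: schwartz_def)
qed

lemma partial_has_derivative:
  fixes f :: "real^'n::finite \<Rightarrow> complex"
  assumes "f differentiable (at (x + s *\<^sub>R axis i 1))"
  shows "((\<lambda>t. f (x + t *\<^sub>R axis i 1)) has_vector_derivative partial i f (x + s *\<^sub>R axis i 1)) (at s)"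
proof -
  have *: "((\<lambda>t. f (y + t *\<^sub>R axis i 1)) has_vector_derivative partial i f y) (at 0)" if "f differentiable (at y)" for y
  proof -
    have "(f \<circ> (\<lambda>t. y + t *\<^sub>R axis i 1)) differentiable (at 0)"
      using that by (intro differentiable_chain_at) (auto intro!: derivative_intros)
    then show ?thesis
      unfolding partial_def o_def by (simp add: vector_derivative_works)
  qed
  have "((\<lambda>t. f ((x + s *\<^sub>R axis i 1) + t *\<^sub>R axis i 1)) \<circ> (\<lambda>t. t - s) has_vector_derivative
      (1 *\<^sub>R partial i f (x + s *\<^sub>R axis i 1))) (at s)"
    by (rule vector_diff_chain_at) (use *[OF assms] in \<open>auto intro!: derivative_eq_intros\<close>)
  then show ?thesis by (simp add: o_def algebra_simps)
qed

lemma partial_has_derivative_0: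
  fixes f :: "real^'n::finite \<Rightarrow> complex"
  assumes "f differentiable (at x)"
  shows "((\<lambda>t. f (x + t *\<^sub>R axis i 1)) has_vector_derivative partial i f x) (at 0)"
  using partial_has_derivative[of f x 0 i] assms by simp

lemma partialI:
  "((\<lambda>t. f (x + t *\<^sub>R axis i 1)) has_vector_derivative D) (at 0) \<Longrightarrow> partial i f x = D"
  unfolding partial_def by (rule vector_derivative_at)

lemma partial_add:
  assumes "f differentiable (at x)" "g differentiable (at x)"
  shows "partial i (\<lambda>x. f x + g x) x = partial i f x + partial i g x"
  by (intro partialI has_vector_derivative_add partial_has_derivative_0 assms)

lemma partial_cmult:
  assumes "f differentiable (at x)"
  shows "partial i (\<lambda>x. c * f x) x = c * partial i f x"
  by (intro partialI has_vector_derivative_mult_right partial_has_derivative_0 assms)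

lemma partial_affine:
  assumes "f differentiable (at (a + c *\<^sub>R y))"
  shows "partial i (\<lambda>y. f (a + c *\<^sub>R y)) y = of_real c * partial i f (a + c *\<^sub>R y)"
proof (rule partialI)
  have "((\<lambda>t. f ((a + c *\<^sub>R y) + t *\<^sub>R axis i 1)) \<circ> (\<lambda>t. c * t) has_vector_derivative
      (c *\<^sub>R partial i f (a + c *\<^sub>R y))) (at 0)"
    by (rule vector_diff_chain_at) (use partial_has_derivative_0[OF assms] in \<open>auto intro!: derivative_eq_intros\<close>)
  then show "((\<lambda>t. f (a + c *\<^sub>R (y + t *\<^sub>R axis i 1))) has_vector_derivative of_real c * partial i f (a + c *\<^sub>R y)) (at 0)"
    by (simp add: o_def algebra_simps scaleR_conv_of_real[where 'a=complex])
qed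

lemma partials_add:
  assumes "f \<in> schwartz" "g \<in> schwartz"
  shows "partials is (\<lambda>x. f x + g x) = (\<lambda>x. partials is f x + partials is g x)"
proof (induction "is")
  case (Cons i "is")
  show ?case
    unfolding partials.simps(2) Cons.IH by (rule ext, rule partial_add) (simp_all add: assms schwartz_differentiable)
qed simp

lemma partials_cmult:
  assumes "f \<in> schwartz"
  shows "partials is (\<lambda>x. c * f x) = (\<lambda>x. c * partials is f x)"
proof (induction "is")
  case (Cons i "is")
  show ?case
    unfolding partials.simps(2) Cons.IH by (rule ext, rule partial_cmult) (simp add: assms schwartz_differentiable)
qed simp

lemma partials_affine:
  assumes "f \<in> schwartz"
  shows "partials is (\<lambda>y. f (a + c *\<^sub>R y)) = (\<lambda>y. of_real c ^ length is * partials is f (a + c *\<^sub>R y))"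
proof (induction "is")
  case (Cons i "is")
  show ?case
  proof
    fix y
    have d: "partials is f differentiable (at z)" for z using schwartz_differentiable[OF assms] .
    have d': "(\<lambda>y. partials is f (a + c *\<^sub>R y)) differentiable (at y)"
      using differentiable_chain_at[of "\<lambda>y. a + c *\<^sub>R y" y "partials is f"] d by (simp add: o_def)
    have "partials (i # is) (\<lambda>y. f (a + c *\<^sub>R y)) y = partial i (\<lambda>y. of_real c ^ length is * partials is f (a + c *\<^sub>R y)) y"
      by (simp add: Cons.IH)
    also have "\<dots> = of_real c ^ length is * (of_real c * partial i (partials is f) (a + c *\<^sub>R y))"
      by (subst partial_cmult[OF d'], subst partial_affine[OF d]) simp
    finally show "partials (i # is) (\<lambda>y. f (a + c *\<^sub>R y)) y = of_real c ^ length (i # is) * partials (i # is) f (a + c *\<^sub>R y)"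
      by simp
  qed
qed simp

lemma schwartz_add: "f \<in> schwartz \<Longrightarrow> g \<in> schwartz \<Longrightarrow> (\<lambda>x. f x + g x) \<in> schwartz"
proof (rule schwartzI)
  fix "is" N assume f: "f \<in> schwartz" and g: "g \<in> schwartz"
  obtain C D where "\<And>x. (1 + norm x) ^ N * norm (partials is f x) \<le> C" "\<And>x. (1 + norm x) ^ N * norm (partials is g x) \<le> D"
    using schwartz_bound[OF f] schwartz_bound[OF g] by metis
  moreover have "(1 + norm x) ^ N * norm (partials is f x + partials is g x)
      \<le> (1 + norm x) ^ N * norm (partials is f x) + (1 + norm x) ^ N * norm (partials is g x)" for x
    unfolding distrib_left[symmetric] by (intro mult_left_mono norm_triangle_ineq) auto
  ultimately have "(1 + norm x) ^ N * norm (partials is f x + partials is g x) \<le> C + D" for x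
    by (meson add_mono order_trans)
  then show "\<exists>C. \<forall>x. (1 + norm x) ^ N * norm (partials is (\<lambda>x. f x + g x) x) \<le> C"
    using f g by (auto simp: partials_add)
qed (auto simp: partials_add schwartz_differentiable)

lemma schwartz_cmult: "f \<in> schwartz \<Longrightarrow> (\<lambda>x. c * f x) \<in> schwartz"
proof (rule schwartzI)
  fix "is" N assume f: "f \<in> schwartz"
  obtain C where C: "\<And>x. (1 + norm x) ^ N * norm (partials is f x) \<le> C"
    using schwartz_bound[OF f] by metis
  have "(1 + norm x) ^ N * norm (c * partials is f x) \<le> norm c * C" for x
    using mult_left_mono[OF C[of x], of "norm c"] by (simp add: norm_mult mult_ac)
  then show "\<exists>C. \<forall>x. (1 + norm x) ^ N * norm (partials is (\<lambda>x. c * f x) x) \<le> C"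
    using f by (auto simp: partials_cmult)
qed (auto simp: partials_cmult schwartz_differentiable)

lemma schwartz_zero:
  fixes f :: "real^'n::finite \<Rightarrow> complex"
  shows "f \<in> schwartz \<Longrightarrow> (\<lambda>x::real^'n. 0) \<in> schwartz"
  using schwartz_cmult[of f 0] by simp

lemma weight_affine:
  assumes "c \<noteq> 0"
  shows "1 + norm x \<le> (1 + (1 + norm a) / \<bar>c\<bar>) * (1 + norm (a + c *\<^sub>R (x::'a::real_normed_vector)))"
proof -
  have "\<bar>c\<bar> * norm x \<le> norm (a + c *\<^sub>R x) + norm a"
    using norm_triangle_ineq4[of "a + c *\<^sub>R x" a] by simp
  then have "norm x \<le> (norm (a + c *\<^sub>R x) + norm a) / \<bar>c\<bar>"
    using assms by (simp add: field_simps)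
  also have "\<dots> \<le> (1 + norm a) * (1 + norm (a + c *\<^sub>R x)) / \<bar>c\<bar>"
    by (intro divide_right_mono) (auto simp: algebra_simps)
  finally have "norm x \<le> (1 + norm a) / \<bar>c\<bar> * (1 + norm (a + c *\<^sub>R x))" by simp
  then show ?thesis using norm_ge_zero[of "a + c *\<^sub>R x"] unfolding distrib_right mult_1 by linarith
qed

lemma schwartz_affine:
  assumes f: "f \<in> schwartz" and c: "c \<noteq> 0"
  shows "(\<lambda>y. f (a + c *\<^sub>R y)) \<in> schwartz"
proof (rule schwartzI)
  fix "is" N
  define k where "k = 1 + (1 + norm a) / \<bar>c\<bar>"
  have k: "0 \<le> k" by (simp add: k_def)
  obtain C where C: "\<And>x. (1 + norm x) ^ N * norm (partials is f x) \<le> C"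
    using schwartz_bound[OF f] by metis
  have "(1 + norm x) ^ N * norm (of_real c ^ length is * partials is f (a + c *\<^sub>R x)) \<le> \<bar>c\<bar> ^ length is * k ^ N * C" for x
  proof -
    have "(1 + norm x) ^ N \<le> (k * (1 + norm (a + c *\<^sub>R x))) ^ N"
      unfolding k_def using weight_affine[OF c, of x a] by (intro power_mono) auto
    then have "(1 + norm x) ^ N * norm (partials is f (a + c *\<^sub>R x)) \<le> k ^ N * ((1 + norm (a + c *\<^sub>R x)) ^ N * norm (partials is f (a + c *\<^sub>R x)))"
      by (auto simp: power_mult_distrib mult.assoc[symmetric] intro: mult_right_mono)
    also have "\<dots> \<le> k ^ N * C" using k by (intro mult_left_mono C) auto
    finally have "\<bar>c\<bar> ^ length is * ((1 + norm x) ^ N * norm (partials is f (a + c *\<^sub>R x))) \<le> \<bar>c\<bar> ^ length is * (k ^ N * C)"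
      by (intro mult_left_mono) auto
    then show ?thesis by (simp add: norm_mult norm_power mult_ac)
  qed
  then show "\<exists>C. \<forall>x. (1 + norm x) ^ N * norm (partials is (\<lambda>y. f (a + c *\<^sub>R y)) x) \<le> C"
    unfolding partials_affine[OF f] by blast
next
  fix "is" x
  have "(\<lambda>y. partials is f (a + c *\<^sub>R y)) differentiable (at x)"
    using differentiable_chain_at[of "\<lambda>y. a + c *\<^sub>R y" x "partials is f"] schwartz_differentiable[OF f] by (simp add: o_def)
  then show "partials is (\<lambda>y. f (a + c *\<^sub>R y)) differentiable (at x)"
    unfolding partials_affine[OF f] by (intro differentiable_mult) auto
qed

lemma schwartz_seminorm_le:
  assumes "\<And>is x. length is \<le> N \<Longrightarrow> (1 + norm x) ^ N * norm (partials is \<psi> x) \<le> B"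
  shows "schwartz_seminorm N \<psi> \<le> B"
  unfolding schwartz_seminorm_def
proof (rule cSUP_least)
  show "{is. length is \<le> N} \<times> UNIV \<noteq> {}" by (auto intro: exI[of _ "[]"])
qed (use assms in auto)

text \<open>A supremum of reals bounds its members only if they are bounded above. Each derivative
  has a bound of its own, and there are only finitely many lists of length at most N over a finite
  index type.\<close>

lemma le_schwartz_seminorm:
  fixes \<psi> :: "real^'n::finite \<Rightarrow> complex"
  assumes "\<psi> \<in> schwartz" "length is \<le> N"
  shows "(1 + norm x) ^ N * norm (partials is \<psi> x) \<le> schwartz_seminorm N \<psi>"
proof -
  define f where "f = (\<lambda>(is, x). (1 + norm x) ^ N * norm (partials is \<psi> x))"
  have "\<forall>is. \<exists>C. \<forall>x. (1 + norm x) ^ N * norm (partials is \<psi> x) \<le> C"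
    using schwartz_bound[OF assms(1)] by metis
  then obtain C where C: "\<And>is x. (1 + norm x) ^ N * norm (partials is \<psi> x) \<le> C is" by metis
  define I where "I = {is::'n list. length is \<le> N}"
  have I: "finite I" unfolding I_def using finite_lists_length_le[of "UNIV::'n set" N] by simp
  have "f y \<le> Max (C ` I)" if "y \<in> I \<times> UNIV" for y
  proof -
    have "f y \<le> C (fst y)" using C by (simp add: f_def case_prod_beta)
    also have "\<dots> \<le> Max (C ` I)" using that I by (intro Max_ge) auto
    finally show ?thesis .
  qed
  then have "bdd_above (f ` (I \<times> UNIV))" by (rule bdd_aboveI2)
  then have "f (is, x) \<le> (SUP y\<in>I \<times> UNIV. f y)"
    using assms(2) by (intro cSUP_upper) (auto simp: I_def)
  then show ?thesis by (simp add: schwartz_seminorm_def f_def I_def)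
qed

lemma schwartz_continuous: "\<phi> \<in> schwartz \<Longrightarrow> continuous_on UNIV \<phi>"
  using schwartz_differentiable[of \<phi> "[]"]
  by (intro differentiable_imp_continuous_on) (simp add: differentiable_on_def differentiable_at_withinI)

lemma schwartz_measurable: "\<phi> \<in> schwartz \<Longrightarrow> \<phi> \<in> borel_measurable borel"
  by (intro borel_measurable_continuous_onI schwartz_continuous)

lemma schwartz_bounded:
  assumes "\<phi> \<in> schwartz"
  obtains B where "0 \<le> B" "\<And>x. norm (\<phi> x) \<le> B"
  using schwartz_bound[OF assms, of 0 "[]"] by auto

lemma schwartz_decay:
  assumes "\<phi> \<in> schwartz"
  obtains C where "0 \<le> C" "\<And>x. norm (\<phi> x) \<le> C / (1 + norm x) ^ N"
proof -
  obtain C where C: "0 \<le> C" "\<And>x. (1 + norm x) ^ N * norm (partials [] \<phi> x) \<le> C"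
    using schwartz_bound[OF assms] by metis
  show thesis
  proof (rule that[OF C(1)])
    fix x :: "real^'a"
    have "0 < 1 + norm x" by (simp add: add_pos_nonneg)
    then have "0 < (1 + norm x) ^ N" by (rule zero_less_power)
    then show "norm (\<phi> x) \<le> C / (1 + norm x) ^ N"
      using C(2)[of x] by (simp add: pos_le_divide_eq mult.commute)
  qed
qed

lemma schwartz_integrable:
  fixes \<phi> :: "real^'n::finite \<Rightarrow> complex"
  assumes "\<phi> \<in> schwartz"
  shows "integrable lborel \<phi>"
proof -
  obtain C where C: "0 \<le> C" "\<And>x. norm (\<phi> x) \<le> C / (1 + norm x) ^ (2 * CARD('n))"
    using schwartz_decay[OF assms] by metis
  show ?thesis
  proof (rule Bochner_Integration.integrable_bound)
    show "integrable lborel (\<lambda>x::real^'n. C * (1 / (1 + norm x) ^ (2 * CARD('n))))"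
      by (intro integrable_mult_right integrable_decay_vec)
    show "\<phi> \<in> borel_measurable lborel" using schwartz_measurable[OF assms] by simp
    show "AE x in lborel. norm (\<phi> x) \<le> norm (C * (1 / (1 + norm x) ^ (2 * CARD('n))))"
      using C by (intro AE_I2) simp
  qed
qed

text \<open>The radius 2 is the common bound for the spectra of both generators of the
  resolution.\<close>

definition bandlimited :: "(real^'n::finite \<Rightarrow> complex) \<Rightarrow> bool"
  where "bandlimited \<phi> \<longleftrightarrow> \<phi> \<in> schwartz \<and> (\<forall>\<xi>. 2 < norm \<xi> \<longrightarrow> fourier \<phi> \<xi> = 0)"

lemma fourier_measurable:
  fixes \<phi> :: "real^'n::finite \<Rightarrow> complex"
  assumes [measurable]: "\<phi> \<in> borel_measurable borel"
  shows "fourier \<phi> \<in> borel_measurable borel"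
  unfolding fourier_def[abs_def] by (rule lborel.borel_measurable_lebesgue_integral) measurable

lemma norm_fourier_le: "norm (fourier \<phi> \<xi>) \<le> (LINT x|lborel. norm (\<phi> x))"
  unfolding fourier_def by (rule order_trans[OF integral_norm_bound]) simp

text \<open>A bounded function with bounded support; no smoothness or decay of the Fourier transform
  has to be established.\<close>

lemma bandlimited_fourier_integrable:
  fixes \<phi> :: "real^'n::finite \<Rightarrow> complex"
  assumes "bandlimited \<phi>"
  shows "integrable lborel (fourier \<phi>)"
proof (rule Bochner_Integration.integrable_bound)
  show "integrable lborel (\<lambda>\<xi>::real^'n. (LINT x|lborel. norm (\<phi> x)) * indicator (cball 0 2) \<xi>)"
  proof (intro integrable_mult_right integrable_real_indicator)
    show "emeasure lborel (cball (0::real^'n) 2) < \<infinity>" by (rule emeasure_bounded_finite[OF bounded_cball])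
  qed simp
  show "fourier \<phi> \<in> borel_measurable lborel"
    using assms fourier_measurable schwartz_measurable by (auto simp: bandlimited_def)
  show "AE \<xi> in lborel. norm (fourier \<phi> \<xi>) \<le> norm ((LINT x|lborel. norm (\<phi> x)) * indicator (cball 0 2) \<xi>)"
  proof (rule AE_I2)
    fix \<xi> :: "real^'n"
    show "norm (fourier \<phi> \<xi>) \<le> norm ((LINT x|lborel. norm (\<phi> x)) * indicator (cball 0 2) \<xi>)"
    proof (cases "norm \<xi> \<le> 2")
      case True
      then show ?thesis using norm_fourier_le[of \<phi> \<xi>] by simp
    next
      case False
      then show ?thesis using assms by (simp add: bandlimited_def)
    qed
  qed
qed

lemma bandlimited_inversion:
  fixes \<phi> :: "real^'n::finite \<Rightarrow> complex"
  assumes "bandlimited \<phi>"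
  shows "of_real ((2 * pi) ^ CARD('n)) * \<phi> x = (LINT \<xi>|lborel. fourier \<phi> \<xi> * cis (x \<bullet> \<xi>))"
proof -
  have \<phi>: "\<phi> \<in> schwartz" using assms by (simp add: bandlimited_def)
  obtain B where "\<And>x. norm (\<phi> x) \<le> B" using schwartz_bounded[OF \<phi>] by metis
  then show ?thesis
    by (intro fourier_inversion schwartz_continuous schwartz_integrable \<phi> bandlimited_fourier_integrable assms)
qed

text \<open>Provides a majorant of the difference quotients that does not depend on the step. The
  factor 2^N comes from 1 + |x| \<le> 2 (1 + |x + s e|) for a unit vector e and |s| \<le> 1.\<close>

lemma partial_difference_bound:
  fixes f :: "real^'n::finite \<Rightarrow> complex"
  assumes "f \<in> schwartz" and C: "\<And>x. norm (partial i f x) \<le> C / (1 + norm x) ^ N" and t: "\<bar>t\<bar> \<le> 1"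
  shows "norm (f (x + t *\<^sub>R axis i 1) - f x) \<le> \<bar>t\<bar> * (C * 2 ^ N / (1 + norm x) ^ N)"
proof -
  have C0: "0 \<le> C" using order_trans[OF norm_ge_zero C[of 0]] by simp
  have d: "((\<lambda>t. f (x + t *\<^sub>R axis i 1)) has_derivative (\<lambda>h. h *\<^sub>R partial i f (x + s *\<^sub>R axis i 1))) (at s within {-1..1})" for s
    using partial_has_derivative[of f x s i] schwartz_differentiable[OF assms(1), of "[]"]
    by (simp add: has_vector_derivative_def has_derivative_at_withinI)
  have "norm ((\<lambda>t. f (x + t *\<^sub>R axis i 1)) t - (\<lambda>t. f (x + t *\<^sub>R axis i 1)) 0) \<le> (C * 2 ^ N / (1 + norm x) ^ N) * norm (t - 0)"
  proof (rule differentiable_bound[OF _ d])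
    fix s :: real assume s: "s \<in> {-1..1}"
    define W where "W = norm (x + s *\<^sub>R axis i 1)"
    have "norm x \<le> W + norm (s *\<^sub>R axis i 1 :: real^'n)"
      using norm_triangle_ineq4[of "x + s *\<^sub>R axis i 1" "s *\<^sub>R axis i 1"] by (simp add: W_def)
    also have "norm (s *\<^sub>R axis i 1 :: real^'n) \<le> 1"
      using s norm_Basis[of "axis i 1 :: real^'n"] by (simp add: axis_in_Basis_iff abs_le_iff)
    finally have "1 + norm x \<le> 1 + (W + 1)" by simp
    also have "\<dots> \<le> 2 * (1 + W)" by (simp add: W_def)
    finally have "1 + norm x \<le> 2 * (1 + norm (x + s *\<^sub>R axis i 1))" by (simp only: W_def)
    then have w: "(1 + norm x) ^ N \<le> 2 ^ N * (1 + norm (x + s *\<^sub>R axis i 1)) ^ N"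
      unfolding power_mult_distrib[symmetric] by (intro power_mono) auto
    have pos: "0 < (1 + norm y) ^ N" for y :: "real^'n"
      by (intro zero_less_power add_pos_nonneg) auto
    have "norm (partial i f (x + s *\<^sub>R axis i 1)) \<le> C / (1 + norm (x + s *\<^sub>R axis i 1)) ^ N" by (rule C)
    also have "\<dots> \<le> C * 2 ^ N / (1 + norm x) ^ N"
      using mult_left_mono[OF w C0] pos[of x] pos[of "x + s *\<^sub>R axis i 1"]
      by (simp add: divide_le_eq le_divide_eq mult_ac)
    finally show "onorm (\<lambda>h. h *\<^sub>R partial i f (x + s *\<^sub>R axis i 1)) \<le> C * 2 ^ N / (1 + norm x) ^ N"
      by (intro order_trans[OF onorm_le[where b="norm (partial i f (x + s *\<^sub>R axis i 1))"]]) (auto simp: mult.commute)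
  qed (use t in auto)
  then show ?thesis by (simp add: mult.commute)
qed

text \<open>At a fixed \<xi> a translate of f has a transform proportional to that of f, so every
  difference quotient has transform 0 there, and dominated convergence passes to the derivative.
  This replaces an integration by parts.\<close>

lemma fourier_partial_eq_0:
  fixes f :: "real^'n::finite \<Rightarrow> complex"
  assumes f: "f \<in> schwartz" and 0: "fourier f \<xi> = 0"
  shows "fourier (partial i f) \<xi> = 0"
proof -
  note [measurable] = schwartz_measurable[OF f] schwartz_measurable[OF schwartz_partial[OF f]]
  let ?N = "2 * CARD('n)"
  obtain C where C: "\<And>x. norm (partial i f x) \<le> C / (1 + norm x) ^ ?N"
    using schwartz_decay[OF schwartz_partial[OF f]] by metis
  define t where "t k = inverse (real (Suc k))" for k
  have t: "0 < t k" "t k \<le> 1" for k by (auto simp: t_def inverse_le_1_iff)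
  have t0: "t \<longlonglongrightarrow> 0"
    using LIMSEQ_inverse_real_of_nat by (simp add: t_def[abs_def])
  define q where "q k x = (f (x + t k *\<^sub>R axis i 1) - f x) / of_real (t k)" for k x
  have q0: "(LINT x|lborel. cis (- (x \<bullet> \<xi>)) * q k x) = 0" for k
  proof -
    have i1: "integrable lborel (\<lambda>x. cis (- (x \<bullet> \<xi>)) * f x)"
      by (rule Bochner_Integration.integrable_bound[OF schwartz_integrable[OF f]]) auto
    have [measurable]: "(\<lambda>x. cis (- (x \<bullet> \<xi>)) * f x) \<in> borel_measurable borel" by measurable
    have sh: "(\<lambda>x. cis (- ((t k *\<^sub>R axis i 1 + 1 *\<^sub>R x) \<bullet> \<xi>)) * f (t k *\<^sub>R axis i 1 + 1 *\<^sub>R x))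
       = (\<lambda>x. cis (- (t k *\<^sub>R axis i 1 \<bullet> \<xi>)) * (cis (- (x \<bullet> \<xi>)) * f (x + t k *\<^sub>R axis i 1)))"
    proof
      fix x
      have "cis (- ((t k *\<^sub>R axis i 1 + 1 *\<^sub>R x) \<bullet> \<xi>)) = cis (- (t k *\<^sub>R axis i 1 \<bullet> \<xi>)) * cis (- (x \<bullet> \<xi>))"
        by (simp add: cis_mult inner_add_left)
      then show "cis (- ((t k *\<^sub>R axis i 1 + 1 *\<^sub>R x) \<bullet> \<xi>)) * f (t k *\<^sub>R axis i 1 + 1 *\<^sub>R x)
        = cis (- (t k *\<^sub>R axis i 1 \<bullet> \<xi>)) * (cis (- (x \<bullet> \<xi>)) * f (x + t k *\<^sub>R axis i 1))"
        by (simp only: mult.assoc scaleR_one add.commute)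
    qed
    have "(LINT x|lborel. cis (- (x \<bullet> \<xi>)) * f x)
       = \<bar>1\<bar> ^ CARD('n) *\<^sub>R (LINT x|lborel. cis (- (t k *\<^sub>R axis i 1 \<bullet> \<xi>)) * (cis (- (x \<bullet> \<xi>)) * f (x + t k *\<^sub>R axis i 1)))"
      unfolding sh[symmetric] by (rule integral_lborel_affine) auto
    then have "cis (- (t k *\<^sub>R axis i 1 \<bullet> \<xi>)) * (LINT x|lborel. cis (- (x \<bullet> \<xi>)) * f (x + t k *\<^sub>R axis i 1)) = 0"
      using 0 by (simp add: fourier_def)
    then have 1: "(LINT x|lborel. cis (- (x \<bullet> \<xi>)) * f (x + t k *\<^sub>R axis i 1)) = 0" by simp
    have i0: "integrable lborel (\<lambda>x. f (x + t k *\<^sub>R axis i 1))"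
    proof -
      have "integrable lborel (\<lambda>x. f (t k *\<^sub>R axis i 1 + 1 *\<^sub>R x)) \<longleftrightarrow> integrable lborel f"
        by (rule integrable_lborel_affine) simp_all
      moreover have "(\<lambda>x. f (t k *\<^sub>R axis i 1 + 1 *\<^sub>R x)) = (\<lambda>x. f (x + t k *\<^sub>R axis i 1))"
        by (simp add: fun_eq_iff add.commute)
      ultimately show ?thesis using schwartz_integrable[OF f] by simp
    qed
    have i2: "integrable lborel (\<lambda>x. cis (- (x \<bullet> \<xi>)) * f (x + t k *\<^sub>R axis i 1))"
    proof (rule Bochner_Integration.integrable_bound[OF i0])
      show "(\<lambda>x. cis (- (x \<bullet> \<xi>)) * f (x + t k *\<^sub>R axis i 1)) \<in> borel_measurable lborel" by measurable
    qed simp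
    have "(\<lambda>x. cis (- (x \<bullet> \<xi>)) * q k x) = (\<lambda>x. (cis (- (x \<bullet> \<xi>)) * f (x + t k *\<^sub>R axis i 1) - cis (- (x \<bullet> \<xi>)) * f x) / of_real (t k))"
      by (simp add: q_def fun_eq_iff right_diff_distrib diff_divide_distrib)
    then show ?thesis using i1 i2 1 0 by (simp add: fourier_def)
  qed
  have "(\<lambda>k. LINT x|lborel. cis (- (x \<bullet> \<xi>)) * q k x) \<longlonglongrightarrow> (LINT x|lborel. cis (- (x \<bullet> \<xi>)) * partial i f x)"
  proof (rule integral_dominated_convergence[where w="\<lambda>x::real^'n. (C * 2 ^ ?N) * (1 / (1 + norm x) ^ ?N)"])
    show "(\<lambda>x. cis (- (x \<bullet> \<xi>)) * q k x) \<in> borel_measurable lborel" for k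
      unfolding q_def by measurable
    show "integrable lborel (\<lambda>x::real^'n. (C * 2 ^ ?N) * (1 / (1 + norm x) ^ ?N))"
      by (intro integrable_mult_right integrable_decay_vec)
    show "AE x in lborel. (\<lambda>k. cis (- (x \<bullet> \<xi>)) * q k x) \<longlonglongrightarrow> cis (- (x \<bullet> \<xi>)) * partial i f x"
    proof (rule AE_I2, rule tendsto_mult[OF tendsto_const])
      fix x :: "real^'n"
      have "((\<lambda>s. f (x + s *\<^sub>R axis i 1)) has_derivative (\<lambda>h. h *\<^sub>R partial i f x)) (at 0)"
        using partial_has_derivative_0[of f x i] schwartz_differentiable[OF f, of "[]"]
        by (simp add: has_vector_derivative_def)
      then have "(\<lambda>h. norm (f (x + (0 + h) *\<^sub>R axis i 1) - f (x + 0 *\<^sub>R axis i 1) - h *\<^sub>R partial i f x) / norm h) \<midarrow>0\<rightarrow> 0"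
        unfolding has_derivative_at by blast
      moreover have "filterlim t (at 0) sequentially"
        using t0 t by (auto simp: filterlim_at less_imp_neq[symmetric] intro!: always_eventually)
      ultimately have z: "(\<lambda>k. norm (f (x + (0 + t k) *\<^sub>R axis i 1) - f (x + 0 *\<^sub>R axis i 1) - t k *\<^sub>R partial i f x) / norm (t k)) \<longlonglongrightarrow> 0"
        by (rule filterlim_compose)
      have eqf: "(\<lambda>k. norm (f (x + (0 + t k) *\<^sub>R axis i 1) - f (x + 0 *\<^sub>R axis i 1) - t k *\<^sub>R partial i f x) / norm (t k))
         = (\<lambda>k. norm (q k x - partial i f x))"
      proof
        fix k
        have "q k x - partial i f x = (f (x + t k *\<^sub>R axis i 1) - f x - t k *\<^sub>R partial i f x) / of_real (t k)"
          using t[of k] by (simp add: q_def scaleR_conv_of_real[where 'a=complex] diff_divide_distrib)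
        then show "norm (f (x + (0 + t k) *\<^sub>R axis i 1) - f (x + 0 *\<^sub>R axis i 1) - t k *\<^sub>R partial i f x) / norm (t k) = norm (q k x - partial i f x)"
          by (simp add: norm_divide)
      qed
      show "(\<lambda>k. q k x) \<longlonglongrightarrow> partial i f x"
        by (rule LIM_zero_cancel[OF tendsto_norm_zero_cancel[OF z[unfolded eqf]]])
    qed
    show "AE x in lborel. norm (cis (- (x \<bullet> \<xi>)) * q k x) \<le> (C * 2 ^ ?N) * (1 / (1 + norm x) ^ ?N)" for k
    proof (rule AE_I2)
      fix x :: "real^'n"
      have "norm (f (x + t k *\<^sub>R axis i 1) - f x) \<le> \<bar>t k\<bar> * (C * 2 ^ ?N / (1 + norm x) ^ ?N)"
        using t[of k] by (intro partial_difference_bound[OF f C]) auto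
      then show "norm (cis (- (x \<bullet> \<xi>)) * q k x) \<le> (C * 2 ^ ?N) * (1 / (1 + norm x) ^ ?N)"
        using t[of k] by (simp add: q_def norm_divide divide_le_eq mult_ac)
    qed
  qed measurable
  then have "(LINT x|lborel. cis (- (x \<bullet> \<xi>)) * partial i f x) = 0"
    unfolding q0 by (simp add: LIMSEQ_const_iff)
  then show ?thesis by (simp add: fourier_def)
qed

lemma bandlimited_partials:
  assumes "bandlimited \<phi>"
  shows "bandlimited (partials is \<phi>)"
  using assms by (induction "is") (auto simp: bandlimited_def schwartz_partial fourier_partial_eq_0)

section \<open>Sampling of band-limited distributions\<close>

text \<open>A summable majorant of the kernel at the points s - m. Its tails measure the speed of
  convergence of the sampling series.\<close>

definition weight :: "real \<Rightarrow> int \<Rightarrow> real"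
  where "weight s m = 1 / (1 + \<bar>s - real_of_int m\<bar>) ^ 2"

lemma weight_pos: "0 < weight s m"
  by (simp add: weight_def add_pos_nonneg)

lemma weight_summable: "weight s summable_on UNIV"
proof -
  have le: "norm (weight s (int_decode n)) \<le> 4 * (1 + \<bar>s\<bar>)^2 * inverse (real (Suc n) ^ 2)" for n
  proof -
    define m where "m = real_of_int (int_decode n)"
    have "real (Suc n) \<le> 2 * (1 + \<bar>m\<bar>)"
      using abs_int_decode[of n] by (simp add: m_def)
    also have "1 + \<bar>m\<bar> \<le> (1 + \<bar>s\<bar>) * (1 + \<bar>s - m\<bar>)"
    proof -
      have "\<bar>m\<bar> \<le> \<bar>s\<bar> + \<bar>s - m\<bar>" by simp
      moreover have "0 \<le> \<bar>s\<bar> * \<bar>s - m\<bar>" by simp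
      ultimately show ?thesis unfolding distrib_left distrib_right mult_1 mult_1_right by linarith
    qed
    finally have "real (Suc n) \<le> 2 * ((1 + \<bar>s\<bar>) * (1 + \<bar>s - m\<bar>))" by simp
    then have "real (Suc n) ^ 2 \<le> (2 * ((1 + \<bar>s\<bar>) * (1 + \<bar>s - m\<bar>))) ^ 2"
      by (intro power_mono) auto
    then have "real (Suc n) ^ 2 \<le> 4 * (1 + \<bar>s\<bar>)^2 * (1 + \<bar>s - m\<bar>)^2"
      by (simp add: power_mult_distrib)
    moreover have "0 < (1 + \<bar>s - m\<bar>)^2" by (intro zero_less_power) (simp add: add_pos_nonneg)
    moreover have "0 < real (Suc n) ^ 2" by simp
    moreover have "1 / W \<le> A * inverse R" if "R \<le> A * W" "0 < W" "0 < R" for A R W :: real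
      using that by (simp add: field_simps)
    ultimately have "1 / (1 + \<bar>s - m\<bar>)^2 \<le> 4 * (1 + \<bar>s\<bar>)^2 * inverse (real (Suc n) ^ 2)"
      by blast
    then show ?thesis
      unfolding weight_def m_def[symmetric] by simp
  qed
  have sm: "summable (\<lambda>n. 4 * (1 + \<bar>s\<bar>)^2 * inverse (real (Suc n) ^ 2))"
    by (intro summable_mult summable_Suc_iff[THEN iffD2, of "\<lambda>n. inverse (real n ^ 2)"] inverse_power_summable) simp
  have "summable (\<lambda>n. norm (weight s (int_decode n)))"
    by (rule summable_comparison_test'[OF sm, of 0]) (use le in simp)
  then have "(\<lambda>n. weight s (int_decode n)) summable_on UNIV"
    by (rule norm_summable_imp_summable_on)
  then show ?thesis
    using summable_on_reindex_bij_betw[OF bij_int_decode, of "weight s"] by simp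
qed

lemma filterlim_int_interval: "filterlim (\<lambda>n. {- int n..int n}) (finite_subsets_at_top UNIV) sequentially"
  unfolding filterlim_finite_subsets_at_top
proof safe
  fix X :: "int set" assume "finite X"
  then obtain N where N: "\<And>x. x \<in> X \<Longrightarrow> \<bar>x\<bar> \<le> N"
    by (metis Max_ge abs_ge_zero finite_imageI image_eqI)
  show "\<forall>\<^sub>F n in sequentially. finite {- int n..int n} \<and> X \<subseteq> {- int n..int n} \<and> {- int n..int n} \<subseteq> UNIV"
  proof (rule eventually_sequentiallyI[of "nat N"])
    fix n assume "nat N \<le> n"
    then have "N \<le> int n" by linarith
    then show "finite {- int n..int n} \<and> X \<subseteq> {- int n..int n} \<and> {- int n..int n} \<subseteq> UNIV"
      using N by (force simp: abs_le_iff)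
  qed
qed

lemma weight_sums: "(\<lambda>n. \<Sum>m\<in>{- int n..int n}. weight s m) \<longlonglongrightarrow> infsum (weight s) UNIV"
  using has_sum_infsum[OF weight_summable[of s]] filterlim_int_interval
  unfolding has_sum_def by (rule filterlim_compose)

lemma weight_sum_le: "(\<Sum>m\<in>{- int n..int n}. weight s m) \<le> infsum (weight s) UNIV"
  by (rule finite_sum_le_infsum[OF weight_summable]) (auto intro: less_imp_le[OF weight_pos])

lemma abs_sinc_decay:
  assumes "0 < c" "c \<le> 1"
  shows "\<bar>sinc (c * u)\<bar> \<le> (2 / c) * (1 / (1 + \<bar>u\<bar>))"
proof (cases "1 \<le> \<bar>u\<bar>")
  case True
  then have u: "c * u \<noteq> 0" "0 < \<bar>u\<bar>" using assms by auto
  have "\<bar>sinc (c * u)\<bar> \<le> 1 / \<bar>c * u\<bar>" by (rule abs_sinc_le[OF u(1)])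
  also have "\<dots> = (1 / c) * (1 / \<bar>u\<bar>)" using assms by (simp add: abs_mult)
  also have "1 / \<bar>u\<bar> \<le> 2 / (1 + \<bar>u\<bar>)" using True by (simp add: divide_simps)
  finally show ?thesis using assms by (simp add: mult_left_mono divide_right_mono)
next
  case False
  have "\<bar>sinc (c * u)\<bar> \<le> 1" by (rule abs_sinc_le_1)
  also have "1 \<le> (2 / c) * (1 / (1 + \<bar>u\<bar>))"
  proof -
    have "c * (1 + \<bar>u\<bar>) \<le> 1 * 2" using assms False by (intro mult_mono) auto
    moreover have "0 < c * (1 + \<bar>u\<bar>)" using assms by (simp add: add_pos_nonneg)
    ultimately show ?thesis by (simp add: le_divide_eq)
  qed
  finally show ?thesis .
qed

text \<open>Each bound discards the other group of factors by |sinc| \<le> 1. The first is the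
  quantitative one and does not see N and \<epsilon>, which will be chosen in terms of a
  distribution; the second serves for convergence.\<close>

lemma sampling_kernel_bound:
  assumes "0 < \<delta>" "\<delta> \<le> 1" "0 < \<epsilon>" "\<epsilon> \<le> 1"
  shows "\<bar>sampling_kernel M \<delta> N \<epsilon> u\<bar> \<le> ((2 / \<delta>) * (1 / (1 + \<bar>u\<bar>))) ^ M"
    "\<bar>sampling_kernel M \<delta> N \<epsilon> u\<bar> \<le> ((2 / \<epsilon>) * (1 / (1 + \<bar>u\<bar>))) ^ N"
proof -
  have eq: "\<bar>sampling_kernel M \<delta> N \<epsilon> u\<bar> = \<bar>sinc (pi * u)\<bar> * \<bar>sinc (\<delta> * u)\<bar> ^ M * \<bar>sinc (\<epsilon> * u)\<bar> ^ N"
    by (simp add: sampling_kernel_def abs_mult power_abs)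
  have "\<bar>sinc (pi * u)\<bar> * \<bar>sinc (\<delta> * u)\<bar> ^ M * \<bar>sinc (\<epsilon> * u)\<bar> ^ N \<le> 1 * ((2 / \<delta>) * (1 / (1 + \<bar>u\<bar>))) ^ M * 1"
    using assms by (intro mult_mono power_mono power_le_one abs_sinc_le_1 abs_sinc_decay) (auto intro!: mult_nonneg_nonneg)
  then show "\<bar>sampling_kernel M \<delta> N \<epsilon> u\<bar> \<le> ((2 / \<delta>) * (1 / (1 + \<bar>u\<bar>))) ^ M" unfolding eq by simp
  have "\<bar>sinc (pi * u)\<bar> * \<bar>sinc (\<delta> * u)\<bar> ^ M * \<bar>sinc (\<epsilon> * u)\<bar> ^ N \<le> 1 * 1 * ((2 / \<epsilon>) * (1 / (1 + \<bar>u\<bar>))) ^ N"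
    using assms by (intro mult_mono power_mono power_le_one abs_sinc_le_1 abs_sinc_decay) (auto intro!: mult_nonneg_nonneg)
  then show "\<bar>sampling_kernel M \<delta> N \<epsilon> u\<bar> \<le> ((2 / \<epsilon>) * (1 / (1 + \<bar>u\<bar>))) ^ N" unfolding eq by simp
qed

text \<open>By Fourier inversion \<open>\<phi>\<close> is a superposition of exponentials whose
  frequency in direction i is at most 2 in modulus, and each of them has its sampling series. The
  partial sums are bounded uniformly in the frequency, because N \<ge> 2 makes the kernel summable
  over the lattice, so the limit may be taken under the integral.\<close>

lemma sampling_bandlimited:
  fixes \<phi> :: "real^'n::finite \<Rightarrow> complex"
  assumes \<phi>: "bandlimited \<phi>"
    and \<delta>: "0 < \<delta>" "\<delta> \<le> 1" "0 < \<epsilon>" "\<epsilon> \<le> 1" "real M * \<delta> + real N * \<epsilon> \<le> 1" "1 \<le> M" "2 \<le> N"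
  shows "(\<lambda>n. \<Sum>m\<in>{- int n..int n}. of_real (sampling_kernel M \<delta> N \<epsilon> (s - real_of_int m)) * \<phi> (b + real_of_int m *\<^sub>R axis i 1))
     \<longlonglongrightarrow> \<phi> (b + s *\<^sub>R axis i 1)"
proof -
  define K where "K m = sampling_kernel M \<delta> N \<epsilon> (s - real_of_int m)" for m
  define c where "c = complex_of_real ((2 * pi) ^ CARD('n))"
  have c: "c \<noteq> 0" by (simp add: c_def)
  define S where "S n \<xi> = (\<Sum>m\<in>{- int n..int n}. of_real (K m) * cis (\<xi> * real_of_int m))" for n \<xi>
  have K: "\<bar>K m\<bar> \<le> (2 / \<epsilon>) ^ N * weight s m" for m
  proof -
    have "\<bar>K m\<bar> \<le> (2 / \<epsilon>) ^ N * (1 / (1 + \<bar>s - real_of_int m\<bar>)) ^ N"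
      unfolding K_def power_mult_distrib[symmetric] by (rule sampling_kernel_bound(2)[OF \<delta>(1-4)])
    also have "\<dots> \<le> (2 / \<epsilon>) ^ N * (1 / (1 + \<bar>s - real_of_int m\<bar>)) ^ 2"
      using \<delta> by (intro mult_left_mono power_decreasing) auto
    finally show ?thesis by (simp add: weight_def power_divide)
  qed
  have S: "norm (S n \<xi>) \<le> (2 / \<epsilon>) ^ N * infsum (weight s) UNIV" for n \<xi>
  proof -
    have "norm (S n \<xi>) \<le> (\<Sum>m\<in>{- int n..int n}. (2 / \<epsilon>) ^ N * weight s m)"
      unfolding S_def using K by (intro sum_norm_le) simp
    also have "\<dots> \<le> (2 / \<epsilon>) ^ N * infsum (weight s) UNIV"
      unfolding sum_distrib_left[symmetric] using \<delta> by (intro mult_left_mono weight_sum_le) auto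
    finally show ?thesis .
  qed
  have iF: "integrable lborel (fourier \<phi>)" by (rule bandlimited_fourier_integrable[OF \<phi>])
  then have [measurable]: "fourier \<phi> \<in> borel_measurable borel" using borel_measurable_integrable by force
  have Scont: "continuous_on UNIV (S n)" for n
    unfolding S_def cis_conv_exp by (intro continuous_intros)
  have [measurable]: "S n \<in> borel_measurable borel" for n
    by (rule borel_measurable_continuous_onI[OF Scont])
  have int: "integrable lborel (\<lambda>\<xi>. fourier \<phi> \<xi> * cis (x \<bullet> \<xi>))" for x
    by (rule Bochner_Integration.integrable_bound[OF iF]) auto
  have ci: "axis i 1 \<bullet> \<xi> = \<xi> $ i" for \<xi> :: "real^'n"
    by (simp add: inner_axis inner_commute)
  have nth: "(\<lambda>\<xi>::real^'n. \<xi> $ i) \<in> borel_measurable borel"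
    unfolding cart_eq_inner_axis by measurable
  have 1: "c * (\<Sum>m\<in>{- int n..int n}. of_real (K m) * \<phi> (b + real_of_int m *\<^sub>R axis i 1))
     = (LINT \<xi>|lborel. fourier \<phi> \<xi> * cis (b \<bullet> \<xi>) * S n (\<xi> $ i))" for n
  proof -
    have "c * (\<Sum>m\<in>{- int n..int n}. of_real (K m) * \<phi> (b + real_of_int m *\<^sub>R axis i 1))
      = (\<Sum>m\<in>{- int n..int n}. of_real (K m) * (LINT \<xi>|lborel. fourier \<phi> \<xi> * cis ((b + real_of_int m *\<^sub>R axis i 1) \<bullet> \<xi>)))"
      unfolding bandlimited_inversion[OF \<phi>, symmetric] c_def[symmetric] sum_distrib_left by (intro sum.cong) simp_all
    also have "\<dots> = (\<Sum>m\<in>{- int n..int n}. (LINT \<xi>|lborel. of_real (K m) * (fourier \<phi> \<xi> * cis ((b + real_of_int m *\<^sub>R axis i 1) \<bullet> \<xi>))))"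
      by simp
    also have "\<dots> = (LINT \<xi>|lborel. (\<Sum>m\<in>{- int n..int n}. of_real (K m) * (fourier \<phi> \<xi> * cis ((b + real_of_int m *\<^sub>R axis i 1) \<bullet> \<xi>))))"
      by (intro Bochner_Integration.integral_sum[symmetric] integrable_mult_right int)
    also have "\<dots> = (LINT \<xi>|lborel. fourier \<phi> \<xi> * cis (b \<bullet> \<xi>) * S n (\<xi> $ i))"
    proof (rule Bochner_Integration.integral_cong[OF refl])
      fix \<xi> :: "real^'n"
      have "cis ((b + real_of_int m *\<^sub>R axis i 1) \<bullet> \<xi>) = cis (b \<bullet> \<xi>) * cis (\<xi> $ i * real_of_int m)" for m
        by (simp add: cis_mult inner_add_left ci mult.commute)
      then show "(\<Sum>m\<in>{- int n..int n}. of_real (K m) * (fourier \<phi> \<xi> * cis ((b + real_of_int m *\<^sub>R axis i 1) \<bullet> \<xi>)))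
        = fourier \<phi> \<xi> * cis (b \<bullet> \<xi>) * S n (\<xi> $ i)"
        unfolding S_def sum_distrib_left by (intro sum.cong) (simp_all add: mult_ac)
    qed
    finally show ?thesis .
  qed
  have "(\<lambda>n. LINT \<xi>|lborel. fourier \<phi> \<xi> * cis (b \<bullet> \<xi>) * S n (\<xi> $ i))
     \<longlonglongrightarrow> (LINT \<xi>|lborel. fourier \<phi> \<xi> * cis (b \<bullet> \<xi>) * cis (\<xi> $ i * s))"
  proof (rule integral_dominated_convergence[where w="\<lambda>\<xi>. norm (fourier \<phi> \<xi>) * ((2 / \<epsilon>) ^ N * infsum (weight s) UNIV)"])
    show "(\<lambda>\<xi>. fourier \<phi> \<xi> * cis (b \<bullet> \<xi>) * cis (\<xi> $ i * s)) \<in> borel_measurable lborel"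
      unfolding cart_eq_inner_axis by measurable
    show "(\<lambda>\<xi>. fourier \<phi> \<xi> * cis (b \<bullet> \<xi>) * S n (\<xi> $ i)) \<in> borel_measurable lborel" for n
      unfolding cart_eq_inner_axis by measurable
    show "integrable lborel (\<lambda>\<xi>. norm (fourier \<phi> \<xi>) * ((2 / \<epsilon>) ^ N * infsum (weight s) UNIV))"
      using iF by (intro integrable_mult_left integrable_norm)
    show "AE \<xi> in lborel. norm (fourier \<phi> \<xi> * cis (b \<bullet> \<xi>) * S n (\<xi> $ i)) \<le> norm (fourier \<phi> \<xi>) * ((2 / \<epsilon>) ^ N * infsum (weight s) UNIV)" for n
      using S by (intro AE_I2) (simp add: norm_mult mult_left_mono)
    show "AE \<xi> in lborel. (\<lambda>n. fourier \<phi> \<xi> * cis (b \<bullet> \<xi>) * S n (\<xi> $ i)) \<longlonglongrightarrow> fourier \<phi> \<xi> * cis (b \<bullet> \<xi>) * cis (\<xi> $ i * s)"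
    proof (rule AE_I2)
      fix \<xi> :: "real^'n"
      show "(\<lambda>n. fourier \<phi> \<xi> * cis (b \<bullet> \<xi>) * S n (\<xi> $ i)) \<longlonglongrightarrow> fourier \<phi> \<xi> * cis (b \<bullet> \<xi>) * cis (\<xi> $ i * s)"
      proof (cases "norm \<xi> \<le> 2")
        case True
        then have "\<bar>\<xi> $ i\<bar> \<le> 2" using component_le_norm_cart[of \<xi> i] by linarith
        then show ?thesis unfolding S_def K_def
          by (intro tendsto_mult tendsto_const sampling_exponential \<delta>)
      next
        case False
        then show ?thesis using \<phi> by (simp add: bandlimited_def)
      qed
    qed
  qed
  also have "(LINT \<xi>|lborel. fourier \<phi> \<xi> * cis (b \<bullet> \<xi>) * cis (\<xi> $ i * s)) = (LINT \<xi>|lborel. fourier \<phi> \<xi> * cis ((b + s *\<^sub>R axis i 1) \<bullet> \<xi>))"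
    by (simp add: mult.assoc cis_mult inner_add_left ci mult.commute[of s])
  also have "\<dots> = c * \<phi> (b + s *\<^sub>R axis i 1)"
    unfolding c_def by (rule bandlimited_inversion[OF \<phi>, symmetric])
  finally have "(\<lambda>n. c * (\<Sum>m\<in>{- int n..int n}. of_real (K m) * \<phi> (b + real_of_int m *\<^sub>R axis i 1))) \<longlonglongrightarrow> c * \<phi> (b + s *\<^sub>R axis i 1)"
    unfolding 1 .
  from tendsto_mult[OF tendsto_const[of "1 / c"] this] show ?thesis
    using c by (simp add: K_def)
qed

section \<open>Sampling formula for convolutions with tempered distributions\<close>

lemma tempered_add: "T \<in> tempered_distributions \<Longrightarrow> \<phi> \<in> schwartz \<Longrightarrow> \<psi> \<in> schwartz \<Longrightarrow> T (\<lambda>x. \<phi> x + \<psi> x) = T \<phi> + T \<psi>"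
  by (auto simp: tempered_distributions_def)

lemma tempered_cmult: "T \<in> tempered_distributions \<Longrightarrow> \<phi> \<in> schwartz \<Longrightarrow> T (\<lambda>x. c * \<phi> x) = c * T \<phi>"
  by (auto simp: tempered_distributions_def)

lemma schwartz_sum:
  fixes f :: "'a \<Rightarrow> real^'n::finite \<Rightarrow> complex"
  assumes z: "(\<lambda>x::real^'n. 0) \<in> schwartz" and "finite A" "\<And>m. m \<in> A \<Longrightarrow> f m \<in> schwartz"
  shows "(\<lambda>x. \<Sum>m\<in>A. k m * f m x) \<in> schwartz"
    "partials is (\<lambda>x. \<Sum>m\<in>A. k m * f m x) = (\<lambda>x. \<Sum>m\<in>A. k m * partials is (f m) x)"
    "T \<in> tempered_distributions \<Longrightarrow> T (\<lambda>x. \<Sum>m\<in>A. k m * f m x) = (\<Sum>m\<in>A. k m * T (f m))"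
proof -
  have p0: "partials is (\<lambda>x::real^'n. 0::complex) = (\<lambda>x. 0)"
    using partials_cmult[OF z, of "is" 0] by simp
  have T0: "T (\<lambda>x. 0) = 0" if "T \<in> tempered_distributions"
    using tempered_cmult[OF that z, of 0] by simp
  have "(\<lambda>x. \<Sum>m\<in>A. k m * f m x) \<in> schwartz \<and>
    partials is (\<lambda>x. \<Sum>m\<in>A. k m * f m x) = (\<lambda>x. \<Sum>m\<in>A. k m * partials is (f m) x) \<and>
    (T \<in> tempered_distributions \<longrightarrow> T (\<lambda>x. \<Sum>m\<in>A. k m * f m x) = (\<Sum>m\<in>A. k m * T (f m)))"
    using assms(2,3)
  proof (induction A rule: finite_induct)
    case empty
    then show ?case using z p0 T0 by simp
  next
    case (insert m A)
    have s: "(\<lambda>x. k m * f m x) \<in> schwartz" "(\<lambda>x. \<Sum>m\<in>A. k m * f m x) \<in> schwartz" "f m \<in> schwartz"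
      using insert by (auto intro: schwartz_cmult)
    have IH: "partials is (\<lambda>x. \<Sum>m\<in>A. k m * f m x) = (\<lambda>x. \<Sum>m\<in>A. k m * partials is (f m) x)"
      "T \<in> tempered_distributions \<longrightarrow> T (\<lambda>x. \<Sum>m\<in>A. k m * f m x) = (\<Sum>m\<in>A. k m * T (f m))"
      using insert by auto
    have eq: "(\<lambda>x. \<Sum>m\<in>insert m A. k m * f m x) = (\<lambda>x. k m * f m x + (\<Sum>m\<in>A. k m * f m x))"
      using insert by simp
    show ?case
      unfolding eq
    proof (intro conjI impI)
      show "(\<lambda>x. k m * f m x + (\<Sum>m\<in>A. k m * f m x)) \<in> schwartz"
        by (rule schwartz_add[OF s(1,2)])
      show "partials is (\<lambda>x. k m * f m x + (\<Sum>m\<in>A. k m * f m x)) = (\<lambda>x. \<Sum>m\<in>insert m A. k m * partials is (f m) x)"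
        unfolding partials_add[OF s(1,2)] partials_cmult[OF s(3)] IH(1) using insert by simp
      assume T: "T \<in> tempered_distributions"
      then show "T (\<lambda>x. k m * f m x + (\<Sum>m\<in>A. k m * f m x)) = (\<Sum>m\<in>insert m A. k m * T (f m))"
        using tempered_add[OF T s(1,2)] tempered_cmult[OF T s(3)] IH(2) insert by simp
    qed
  qed
  then show "(\<lambda>x. \<Sum>m\<in>A. k m * f m x) \<in> schwartz"
    "partials is (\<lambda>x. \<Sum>m\<in>A. k m * f m x) = (\<lambda>x. \<Sum>m\<in>A. k m * partials is (f m) x)"
    "T \<in> tempered_distributions \<Longrightarrow> T (\<lambda>x. \<Sum>m\<in>A. k m * f m x) = (\<Sum>m\<in>A. k m * T (f m))"
    by auto
qed

lemma conv_eq: "conv \<phi> T x = T (\<lambda>y. \<phi> (x + (-1) *\<^sub>R y))"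
  by (simp add: conv_def)

lemma weight_shift:
  fixes b :: "real^'n::finite"
  shows "1 + norm (b + m *\<^sub>R axis i 1) \<le> (1 + norm b + \<bar>s\<bar>) * (1 + \<bar>s - m\<bar>)"
proof -
  have "norm (axis i 1 :: real^'n) = 1"
    using norm_Basis[of "axis i 1 :: real^'n"] by (simp add: axis_in_Basis_iff)
  then have "norm (b + m *\<^sub>R axis i 1) \<le> norm b + \<bar>m\<bar>"
    using norm_triangle_ineq[of b "m *\<^sub>R axis i 1"] by simp
  moreover have "\<bar>m\<bar> \<le> \<bar>s\<bar> + \<bar>s - m\<bar>" by simp
  moreover have "0 \<le> (norm b + \<bar>s\<bar>) * \<bar>s - m\<bar>" by simp
  ultimately show ?thesis unfolding distrib_left distrib_right mult_1 mult_1_right by linarith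
qed

text \<open>Peetre's inequality: a polynomial weight at z is moved to y - z at the cost of the
  weight at y.\<close>

lemma weight_split:
  fixes y z :: "'a::real_normed_vector"
  shows "1 + norm z \<le> (1 + norm y) * (1 + norm (y + (-1) *\<^sub>R z))"
proof -
  have "norm z \<le> norm y + norm (y + (-1) *\<^sub>R z)"
    using norm_triangle_ineq4[of y "y + (-1) *\<^sub>R z"] by simp
  moreover have "0 \<le> norm y * norm (y + (-1) *\<^sub>R z)" by simp
  ultimately show ?thesis unfolding distrib_left distrib_right mult_1 mult_1_right by linarith
qed

text \<open>The order of decay of the kernel that is needed depends on the order of the distribution, but
  the bound on the kernel does not.\<close>

lemma conv_sampling:
  fixes \<phi> :: "real^'n::finite \<Rightarrow> complex"
  assumes T: "T \<in> tempered_distributions" and \<phi>: "bandlimited \<phi>" and M: "1 \<le> M"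
  obtains K where "K \<in> borel_measurable borel" "\<And>u. \<bar>K u\<bar> \<le> (4 * real M * (1 / (1 + \<bar>u\<bar>))) ^ M"
    "\<And>b s i. (\<lambda>n. \<Sum>m\<in>{- int n..int n}. of_real (K (s - real_of_int m)) * conv \<phi> T (b + real_of_int m *\<^sub>R axis i 1))
       \<longlonglongrightarrow> conv \<phi> T (b + s *\<^sub>R axis i 1)"
proof -
  obtain CT NT where CT: "\<And>\<psi>. \<psi> \<in> schwartz \<Longrightarrow> norm (T \<psi>) \<le> CT * schwartz_seminorm NT \<psi>"
    using T unfolding tempered_distributions_def by blast
  \<comment> \<open>Shifting a test function by the lattice point m raises its seminorm of order NT
    by the NT-th power of the shift. The kernel has to compensate this growth, and two further
    orders remain for summability.\<close>
  define N where "N = NT + 2"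
  \<comment> \<open>Each group of factors receives half of the available type 1. Hence 2/\<delta> =
    4 M, the constant in the bound of K.\<close>
  define \<delta> \<epsilon> where "\<delta> = 1 / (2 * real M)" and "\<epsilon> = 1 / (2 * real N)"
  have \<delta>: "0 < \<delta>" "\<delta> \<le> 1" "0 < \<epsilon>" "\<epsilon> \<le> 1" "real M * \<delta> + real N * \<epsilon> \<le> 1" "2 \<le> N"
  proof -
    have "real M * \<delta> = 1 / 2" "real N * \<epsilon> = 1 / 2"
      using M by (simp_all add: \<delta>_def \<epsilon>_def N_def)
    then show "real M * \<delta> + real N * \<epsilon> \<le> 1" by simp
  qed (use M in \<open>simp_all add: \<delta>_def \<epsilon>_def N_def divide_le_eq\<close>)
  define K where "K = sampling_kernel M \<delta> N \<epsilon>"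
  have \<phi>S: "\<phi> \<in> schwartz" using \<phi> by (simp add: bandlimited_def)
  show thesis
  proof (rule that[of K])
    show "K \<in> borel_measurable borel"
      unfolding K_def sampling_kernel_def[abs_def] sinc_def by measurable
    show "\<bar>K u\<bar> \<le> (4 * real M * (1 / (1 + \<bar>u\<bar>))) ^ M" for u
      using sampling_kernel_bound(1)[OF \<delta>(1-4), of M N u] by (simp add: K_def \<delta>_def)
    fix b :: "real^'n" and s i
    define p where "p m = b + m *\<^sub>R axis i 1" for m :: real
    define f where "f m z = \<phi> (p m + (-1) *\<^sub>R z)" for m z
    have f: "f m \<in> schwartz" for m
      unfolding f_def by (rule schwartz_affine[OF \<phi>S]) simp
    define S where "S n = (\<Sum>m\<in>{- int n..int n}. weight s m)" for n
    define k where "k m = - complex_of_real (K (s - real_of_int m))" for m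
    \<comment> \<open>The error of the n-th partial sum, expressed as a test function: by linearity
      its value under T is the error of the sampling formula for the convolution.\<close>
    define \<psi> where "\<psi> n z = f s z + (\<Sum>m\<in>{- int n..int n}. k m * f (real_of_int m) z)" for n z
    have z: "(\<lambda>x::real^'n. 0) \<in> schwartz" by (rule schwartz_zero[OF \<phi>S])
    note sum = schwartz_sum[OF z finite_atLeastAtMost_int f]
    have \<psi>: "\<psi> n \<in> schwartz" for n
      unfolding \<psi>_def[abs_def] by (intro schwartz_add f sum(1))
    have T\<psi>: "T (\<psi> n) = conv \<phi> T (p s) + (\<Sum>m\<in>{- int n..int n}. k m * conv \<phi> T (p (real_of_int m)))" for n
    proof -
      have c: "conv \<phi> T (p m) = T (f m)" for m
        by (simp add: conv_eq f_def[abs_def])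
      show ?thesis unfolding \<psi>_def[abs_def] c tempered_add[OF T f sum(1)] sum(3)[OF T] ..
    qed
    define D where "D = (2 / \<epsilon>) ^ N * (1 + norm b + \<bar>s\<bar>) ^ NT * schwartz_seminorm NT \<phi>"
    have sem0: "0 \<le> schwartz_seminorm NT \<phi>"
      using le_schwartz_seminorm[OF \<phi>S, of "[]" NT 0] by (auto intro: order_trans[rotated])
    have D0: "0 \<le> D" using sem0 \<delta> by (simp add: D_def)
    \<comment> \<open>Every derivative of \<open>\<phi>\<close> is band-limited too, so the
      pointwise sampling formula applies to it. The error is the limit of differences of partial
      sums, and these are bounded by a tail of \<open>weight\<close>, uniformly in z after
      multiplication by the polynomial weight. The series thus converges in the seminorm that
      controls T.\<close>
    have bound: "schwartz_seminorm NT (\<psi> n) \<le> D * (infsum (weight s) UNIV - S n)" for n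
    proof (rule schwartz_seminorm_le)
      fix "is" :: "'n list" and z :: "real^'n" assume len: "length is \<le> NT"
      define g where "g = partials is \<phi>"
      define a where "a m = complex_of_real (K (s - real_of_int m)) * g (p (real_of_int m) + (-1) *\<^sub>R z)" for m
      define A where "A n = (\<Sum>m\<in>{- int n..int n}. a m)" for n
      have pf: "partials is (f m) z = (-1) ^ length is * g (p m + (-1) *\<^sub>R z)" for m
        unfolding f_def partials_affine[OF \<phi>S] g_def by simp
      have "partials is (\<psi> n) z = partials is (f s) z + (\<Sum>m\<in>{- int n..int n}. k m * partials is (f (real_of_int m)) z)"
        unfolding \<psi>_def[abs_def] partials_add[OF f sum(1)] sum(2) ..
      also have "\<dots> = (-1) ^ length is * (g (p s + (-1) *\<^sub>R z) - A n)"
        by (simp add: pf k_def A_def a_def sum_distrib_left right_diff_distrib sum_negf mult_ac)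
      finally have np: "norm (partials is (\<psi> n) z) = norm (g (p s + (-1) *\<^sub>R z) - A n)"
        by (simp add: norm_mult norm_power)
      have lim: "A \<longlonglongrightarrow> g (p s + (-1) *\<^sub>R z)"
      proof -
        have "bandlimited g" unfolding g_def by (rule bandlimited_partials[OF \<phi>])
        from sampling_bandlimited[OF this \<delta>(1-5) M \<delta>(6), of s "b + (-1) *\<^sub>R z" i]
        show ?thesis by (simp add: A_def[abs_def] a_def K_def p_def algebra_simps)
      qed
      have am: "(1 + norm z) ^ NT * norm (a m) \<le> D * weight s m" for m
      proof -
        define u where "u = \<bar>s - real_of_int m\<bar>"
        define y where "y = p (real_of_int m)"
        have u: "0 < 1 + u" by (simp add: u_def add_pos_nonneg)
        have "1 + norm z \<le> (1 + norm y) * (1 + norm (y + (-1) *\<^sub>R z))" by (rule weight_split)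
        also have "\<dots> \<le> (1 + norm b + \<bar>s\<bar>) * (1 + u) * (1 + norm (y + (-1) *\<^sub>R z))"
          unfolding y_def p_def u_def by (intro mult_right_mono weight_shift) auto
        finally have "(1 + norm z) ^ NT \<le> ((1 + norm b + \<bar>s\<bar>) * (1 + u) * (1 + norm (y + (-1) *\<^sub>R z))) ^ NT"
          by (intro power_mono) auto
        then have 1: "(1 + norm z) ^ NT \<le> (1 + norm b + \<bar>s\<bar>) ^ NT * (1 + u) ^ NT * (1 + norm (y + (-1) *\<^sub>R z)) ^ NT"
          by (simp only: power_mult_distrib)
        have 2: "\<bar>K (s - real_of_int m)\<bar> \<le> (2 / \<epsilon>) ^ N * (1 / (1 + u)) ^ N"
          unfolding K_def u_def power_mult_distrib[symmetric] by (rule sampling_kernel_bound(2)[OF \<delta>(1-4)])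
        have 3: "(1 + norm (y + (-1) *\<^sub>R z)) ^ NT * norm (g (y + (-1) *\<^sub>R z)) \<le> schwartz_seminorm NT \<phi>"
          unfolding g_def by (rule le_schwartz_seminorm[OF \<phi>S len])
        have "(1 + norm z) ^ NT * norm (a m) = (1 + norm z) ^ NT * (\<bar>K (s - real_of_int m)\<bar> * norm (g (y + (-1) *\<^sub>R z)))"
          by (simp add: a_def norm_mult y_def)
        also have "\<dots> \<le> ((1 + norm b + \<bar>s\<bar>) ^ NT * (1 + u) ^ NT * (1 + norm (y + (-1) *\<^sub>R z)) ^ NT) *
            (((2 / \<epsilon>) ^ N * (1 / (1 + u)) ^ N) * norm (g (y + (-1) *\<^sub>R z)))"
          using \<delta> u by (intro mult_mono 1 2) auto
        also have "\<dots> = ((2 / \<epsilon>) ^ N * (1 + norm b + \<bar>s\<bar>) ^ NT * ((1 + u) ^ NT * (1 / (1 + u)) ^ N)) *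
            ((1 + norm (y + (-1) *\<^sub>R z)) ^ NT * norm (g (y + (-1) *\<^sub>R z)))"
          by (simp only: mult_ac)
        also have "\<dots> \<le> ((2 / \<epsilon>) ^ N * (1 + norm b + \<bar>s\<bar>) ^ NT * ((1 + u) ^ NT * (1 / (1 + u)) ^ N)) * schwartz_seminorm NT \<phi>"
          using \<delta> u by (intro mult_left_mono 3) auto
        also have "(1 + u) ^ NT * (1 / (1 + u)) ^ N = weight s m"
          using u by (simp add: N_def power_add weight_def u_def[symmetric] power_one_over power2_eq_square)
        finally show ?thesis by (simp add: D_def mult_ac)
      qed
      have diff: "(1 + norm z) ^ NT * norm (A n' - A n) \<le> D * (infsum (weight s) UNIV - S n)" if "n \<le> n'" for n'
      proof -
        have sub: "{- int n..int n} \<subseteq> {- int n'..int n'}" using that by auto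
        have "A n' - A n = (\<Sum>m\<in>{- int n'..int n'} - {- int n..int n}. a m)"
          unfolding A_def by (rule sum_diff[symmetric]) (use sub in auto)
        then have "(1 + norm z) ^ NT * norm (A n' - A n) \<le> (1 + norm z) ^ NT * (\<Sum>m\<in>{- int n'..int n'} - {- int n..int n}. norm (a m))"
          by (intro mult_left_mono) (auto intro: norm_sum)
        also have "\<dots> \<le> (\<Sum>m\<in>{- int n'..int n'} - {- int n..int n}. D * weight s m)"
          unfolding sum_distrib_left by (intro sum_mono am)
        also have "\<dots> = D * (S n' - S n)"
          unfolding S_def sum_distrib_left[symmetric] by (subst sum_diff[OF _ sub]) auto
        also have "\<dots> \<le> D * (infsum (weight s) UNIV - S n)"
          using weight_sum_le[of s n'] by (intro mult_left_mono D0) (simp add: S_def)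
        finally show ?thesis .
      qed
      have "(\<lambda>n'. (1 + norm z) ^ NT * norm (A n' - A n)) \<longlonglongrightarrow> (1 + norm z) ^ NT * norm (g (p s + (-1) *\<^sub>R z) - A n)"
        by (intro tendsto_intros lim)
      then have "(1 + norm z) ^ NT * norm (g (p s + (-1) *\<^sub>R z) - A n) \<le> D * (infsum (weight s) UNIV - S n)"
        by (rule LIMSEQ_le_const2) (use diff in blast)
      then show "(1 + norm z) ^ NT * norm (partials is (\<psi> n) z) \<le> D * (infsum (weight s) UNIV - S n)"
        by (simp only: np)
    qed
    have "(\<lambda>n. \<bar>CT\<bar> * (D * (infsum (weight s) UNIV - S n))) \<longlonglongrightarrow> \<bar>CT\<bar> * (D * (infsum (weight s) UNIV - infsum (weight s) UNIV))"
      using weight_sums[of s] unfolding S_def by (intro tendsto_intros)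
    then have lim0: "(\<lambda>n. \<bar>CT\<bar> * (D * (infsum (weight s) UNIV - S n))) \<longlonglongrightarrow> 0" by simp
    have "norm (T (\<psi> n)) \<le> \<bar>CT\<bar> * (D * (infsum (weight s) UNIV - S n))" for n
    proof -
      have "0 \<le> schwartz_seminorm NT (\<psi> n)"
        using le_schwartz_seminorm[OF \<psi>, of "[]" NT 0 n] by (auto intro: order_trans[rotated])
      then have "CT * schwartz_seminorm NT (\<psi> n) \<le> \<bar>CT\<bar> * schwartz_seminorm NT (\<psi> n)"
        by (intro mult_right_mono) auto
      also have "\<dots> \<le> \<bar>CT\<bar> * (D * (infsum (weight s) UNIV - S n))"
        by (intro mult_left_mono bound) auto
      finally show ?thesis using CT[OF \<psi>[of n]] by linarith
    qed
    then have "(\<lambda>n. T (\<psi> n)) \<longlonglongrightarrow> 0"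
      by (intro Lim_null_comparison[OF always_eventually lim0]) auto
    then have "(\<lambda>n. conv \<phi> T (p s) - T (\<psi> n)) \<longlonglongrightarrow> conv \<phi> T (p s) - 0"
      by (intro tendsto_intros)
    then show "(\<lambda>n. \<Sum>m\<in>{- int n..int n}. of_real (K (s - real_of_int m)) * conv \<phi> T (b + real_of_int m *\<^sub>R axis i 1))
       \<longlonglongrightarrow> conv \<phi> T (b + s *\<^sub>R axis i 1)"
      by (simp add: T\<psi> k_def sum_negf p_def)
  qed
qed

lemma slice_plus_axis: "slice i x y + t *\<^sub>R axis i 1 = slice i x (y + t)"
  by (simp add: slice_axis algebra_simps)

text \<open>The sampling series serves here as well. With all coordinates frozen at integers the
  function is constant, and releasing one coordinate represents it as a pointwise limit of finite
  sums of functions in which that coordinate is still frozen.\<close>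

lemma conv_measurable:
  fixes \<phi> :: "real^'n::finite \<Rightarrow> complex"
  assumes T: "T \<in> tempered_distributions" and \<phi>: "bandlimited \<phi>"
  shows "conv \<phi> T \<in> borel_measurable borel"
proof -
  obtain K where [measurable]: "K \<in> borel_measurable borel"
    and lim: "\<And>b s i. (\<lambda>n. \<Sum>m\<in>{- int n..int n}. of_real (K (s - real_of_int m)) * conv \<phi> T (b + real_of_int m *\<^sub>R axis i 1))
       \<longlonglongrightarrow> conv \<phi> T (b + s *\<^sub>R axis i 1)"
    by (rule conv_sampling[OF T \<phi> order_refl[of 1]]) blast
  \<comment> \<open>Coordinates in A are free, the others are frozen at the integers given by v. The
    induction must run over all v at once, because releasing a coordinate calls on every integer
    value of it.\<close>
  define frz where "frz A v x = (\<chi> j. if j \<in> A then x $ j else real_of_int (v j))" for A :: "'n set" and v and x :: "real^'n"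
  have "\<forall>v. (\<lambda>x. conv \<phi> T (frz A v x)) \<in> borel_measurable borel" if "finite A" for A
    using that
  proof (induction A rule: finite_induct)
    case empty
    then show ?case by (simp add: frz_def)
  next
    case (insert i A)
    show ?case
    proof
      fix v :: "'n \<Rightarrow> int"
      have l: "(\<lambda>n. \<Sum>m\<in>{- int n..int n}. of_real (K (x $ i - real_of_int m)) * conv \<phi> T (frz A (v(i := m)) x))
          \<longlonglongrightarrow> conv \<phi> T (frz (insert i A) v x)" for x
      proof -
        have "slice i (frz (insert i A) v x) 0 + (x $ i) *\<^sub>R axis i 1 = frz (insert i A) v x"
          "slice i (frz (insert i A) v x) 0 + real_of_int m *\<^sub>R axis i 1 = frz A (v(i := m)) x" for m
          using insert.hyps by (auto simp: slice_plus_axis vec_eq_iff frz_def)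
        then show ?thesis using lim[of "x $ i" "slice i (frz (insert i A) v x) 0" i] by simp
      qed
      show "(\<lambda>x. conv \<phi> T (frz (insert i A) v x)) \<in> borel_measurable borel"
      proof (rule borel_measurable_LIMSEQ_metric[OF _ l])
        fix n
        have [measurable]: "(\<lambda>x. conv \<phi> T (frz A w x)) \<in> borel_measurable borel" for w
          using insert.IH by blast
        show "(\<lambda>x. \<Sum>m\<in>{- int n..int n}. of_real (K (x $ i - real_of_int m)) * conv \<phi> T (frz A (v(i := m)) x)) \<in> borel_measurable borel"
          unfolding cart_eq_inner_axis[of _ i] by measurable
      qed
    qed
  qed
  from this[OF finite, of UNIV] have "(\<lambda>x. conv \<phi> T (frz UNIV (\<lambda>_. 0) x)) \<in> borel_measurable borel"
    by blast
  then show ?thesis by (simp add: frz_def)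
qed

text \<open>The integer translates of [0,1) tile the line: every u has exactly one m, its floor,
  with u - m in [0,1).\<close>

lemma nn_integral_unfold_int:
  fixes F :: "real \<Rightarrow> ennreal"
  assumes [measurable]: "F \<in> borel_measurable borel"
  shows "(\<integral>\<^sup>+y. indicator {0..<1} y * (\<integral>\<^sup>+m. F (y + real_of_int m) \<partial>count_space UNIV) \<partial>lborel) = (\<integral>\<^sup>+u. F u \<partial>lborel)"
proof -
  have "(\<integral>\<^sup>+y. indicator {0..<1} y * (\<integral>\<^sup>+m. F (y + real_of_int m) \<partial>count_space UNIV) \<partial>lborel)
     = (\<integral>\<^sup>+y. (\<integral>\<^sup>+m. indicator {0..<1} y * F (y + real_of_int m) \<partial>count_space UNIV) \<partial>lborel)"
    by (simp add: nn_integral_cmult)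
  also have "\<dots> = (\<integral>\<^sup>+m. (\<integral>\<^sup>+y. indicator {0..<1} y * F (y + real_of_int m) \<partial>lborel) \<partial>count_space UNIV)"
    by (intro nn_integral_count_space_nn_integral) auto
  also have "\<dots> = (\<integral>\<^sup>+m. (\<integral>\<^sup>+u. indicator {0..<1} (u - real_of_int m) * F u \<partial>lborel) \<partial>count_space UNIV)"
  proof (rule nn_integral_cong)
    fix m :: int
    show "(\<integral>\<^sup>+y. indicator {0..<1} y * F (y + real_of_int m) \<partial>lborel) = (\<integral>\<^sup>+u. indicator {0..<1} (u - real_of_int m) * F u \<partial>lborel)"
      using nn_integral_real_affine[of "\<lambda>u. indicator {0..<1} (u - real_of_int m) * F u" 1 "real_of_int m"]
      by (simp add: add.commute)
  qed
  also have "\<dots> = (\<integral>\<^sup>+u. (\<integral>\<^sup>+m. indicator {0..<1} (u - real_of_int m) * F u \<partial>count_space UNIV) \<partial>lborel)"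
    by (intro nn_integral_count_space_nn_integral[symmetric]) auto
  also have "\<dots> = (\<integral>\<^sup>+u. F u \<partial>lborel)"
  proof (rule nn_integral_cong)
    fix u :: real
    have "(\<integral>\<^sup>+m. indicator {0..<1} (u - real_of_int m) * F u \<partial>count_space UNIV) = (\<integral>\<^sup>+m. F u * indicator {\<lfloor>u\<rfloor>} m \<partial>count_space UNIV)"
    proof (rule nn_integral_cong)
      fix m :: int
      have "u - real_of_int m \<in> {0..<1} \<longleftrightarrow> m = \<lfloor>u\<rfloor>"
        using floor_eq_iff[of u m] by (auto, linarith)
      then show "indicator {0..<1} (u - real_of_int m) * F u = F u * indicator {\<lfloor>u\<rfloor>} m"
        by (simp add: indicator_def)
    qed
    then show "(\<integral>\<^sup>+m. indicator {0..<1} (u - real_of_int m) * F u \<partial>count_space UNIV) = F u" by simp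
  qed
  finally show ?thesis .
qed

text \<open>For \<open>t \<le> 1\<close> the \<open>t\<close>-th power of the modulus of the sampling series is at most the series of the
  \<open>t\<close>-th powers; averaging over all translates of the lattice turns the series into an integral.\<close>

lemma conv_power_le:
  fixes \<phi> :: "real^'n::finite \<Rightarrow> complex"
  assumes T: "T \<in> tempered_distributions" and \<phi>: "bandlimited \<phi>"
    and t: "0 < t" "t \<le> 1" and M: "1 \<le> M" "L \<le> real M * t"
  shows "epow (ennreal (norm (conv \<phi> T x))) t
    \<le> ennreal ((4 * real M) powr (real M * t)) * slice_conv L i (\<lambda>x. epow (ennreal (norm (conv \<phi> T x))) t) x"
proof -
  obtain K where K: "K \<in> borel_measurable borel" "\<And>u. \<bar>K u\<bar> \<le> (4 * real M * (1 / (1 + \<bar>u\<bar>))) ^ M"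
    and lim: "\<And>b s i. (\<lambda>n. \<Sum>m\<in>{- int n..int n}. of_real (K (s - real_of_int m)) * conv \<phi> T (b + real_of_int m *\<^sub>R axis i 1))
       \<longlonglongrightarrow> conv \<phi> T (b + s *\<^sub>R axis i 1)"
    by (rule conv_sampling[OF T \<phi> M(1)]) blast
  note [measurable] = K(1) conv_measurable[OF T \<phi>]
  define k where "k = (4 * real M) powr (real M * t)"
  define H where "H x = epow (ennreal (norm (conv \<phi> T x))) t" for x
  have [measurable]: "H \<in> borel_measurable borel" unfolding H_def by measurable
  define F where "F u = ennreal k * (ennreal (decay L (x $ i - u)) * H (slice i x u))" for u
  have [measurable]: "F \<in> borel_measurable borel" unfolding F_def by measurable
  \<comment> \<open>Taking the t-th power reduces the order of decay from M to M t, and M was chosen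
    so large that L is still reached.\<close>
  have Kt: "\<bar>K u\<bar> powr t \<le> k * decay L u" for u
  proof -
    have u: "0 < 1 + \<bar>u\<bar>" by (simp add: add_pos_nonneg)
    have "\<bar>K u\<bar> powr t \<le> ((4 * real M * (1 / (1 + \<bar>u\<bar>))) ^ M) powr t"
      using K(2) t by (intro powr_mono2) auto
    also have "\<dots> = (4 * real M * (1 / (1 + \<bar>u\<bar>))) powr (real M * t)"
      using M u by (simp add: powr_realpow[symmetric] powr_powr)
    also have "\<dots> = k * (1 + \<bar>u\<bar>) powr (- (real M * t))"
      using u M by (simp add: k_def powr_mult powr_divide powr_minus_divide)
    also have "\<dots> \<le> k * decay L u"
      unfolding decay_def using M by (intro mult_left_mono powr_mono) (auto simp: k_def)
    finally show ?thesis .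
  qed
  \<comment> \<open>The number y is the offset of the lattice: on the line through x in direction i
    the function is sampled at the points y + m.\<close>
  have pt: "H x \<le> (\<integral>\<^sup>+m. F (y + real_of_int m) \<partial>count_space UNIV)" for y
  proof -
    define a where "a m = complex_of_real (K (x $ i - y - real_of_int m)) * conv \<phi> T (slice i x (y + real_of_int m))" for m
    define S where "S n = (\<Sum>m\<in>{- int n..int n}. a m)" for n
    have "S \<longlonglongrightarrow> conv \<phi> T x"
      using lim[of "x $ i - y" "slice i x y" i] by (simp add: S_def[abs_def] a_def slice_plus_axis)
    then have "(\<lambda>n. norm (S n) powr t) \<longlonglongrightarrow> norm (conv \<phi> T x) powr t"
      using t by (intro tendsto_powr' tendsto_norm tendsto_const) auto
    then have l: "(\<lambda>n. ennreal (norm (S n) powr t)) \<longlonglongrightarrow> H x"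
      unfolding H_def epow_ennreal[OF norm_ge_zero] by (rule tendsto_ennrealI)
    have "ennreal (norm (S n) powr t) \<le> (\<integral>\<^sup>+m. F (y + real_of_int m) \<partial>count_space UNIV)" for n
    proof -
      have "ennreal (norm (S n) powr t) = epow (ennreal (norm (S n))) t" by (simp add: epow_ennreal)
      also have "\<dots> \<le> epow (\<Sum>m\<in>{- int n..int n}. ennreal (norm (a m))) t"
        using t by (intro epow_mono) (auto simp: S_def sum_ennreal intro!: ennreal_leI norm_sum)
      also have "\<dots> \<le> (\<Sum>m\<in>{- int n..int n}. epow (ennreal (norm (a m))) t)"
        by (rule epow_sum_le) (use t in auto)
      also have "\<dots> \<le> (\<Sum>m\<in>{- int n..int n}. F (y + real_of_int m))"
      proof (rule sum_mono)
        fix m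
        have "epow (ennreal (norm (a m))) t = ennreal (\<bar>K (x $ i - y - real_of_int m)\<bar> powr t) * H (slice i x (y + real_of_int m))"
          by (simp add: a_def norm_mult H_def ennreal_mult epow_mult epow_ennreal)
        also have "\<dots> \<le> ennreal (k * decay L (x $ i - y - real_of_int m)) * H (slice i x (y + real_of_int m))"
          by (intro mult_right_mono ennreal_leI Kt) auto
        also have "\<dots> = F (y + real_of_int m)"
          by (simp add: F_def k_def ennreal_mult less_imp_le[OF decay_pos] mult.assoc diff_diff_eq)
        finally show "epow (ennreal (norm (a m))) t \<le> F (y + real_of_int m)" .
      qed
      also have "\<dots> = (\<integral>\<^sup>+m. F (y + real_of_int m) * indicator {- int n..int n} m \<partial>count_space UNIV)"
        by (simp add: nn_integral_count_space_indicator[symmetric] nn_integral_count_space_finite)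
      also have "\<dots> \<le> (\<integral>\<^sup>+m. F (y + real_of_int m) \<partial>count_space UNIV)"
        by (intro nn_integral_mono) (auto simp: indicator_def)
      finally show ?thesis .
    qed
    then show ?thesis by (intro LIMSEQ_le_const2[OF l]) auto
  qed
  have "H x = (\<integral>\<^sup>+y. indicator {0..<1} (y::real) * H x \<partial>lborel)"
    by (simp add: nn_integral_multc)
  also have "\<dots> \<le> (\<integral>\<^sup>+y. indicator {0..<1} y * (\<integral>\<^sup>+m. F (y + real_of_int m) \<partial>count_space UNIV) \<partial>lborel)"
    by (intro nn_integral_mono mult_left_mono pt) auto
  also have "\<dots> = (\<integral>\<^sup>+u. F u \<partial>lborel)"
    by (rule nn_integral_unfold_int) measurable
  also have "\<dots> = ennreal k * slice_conv L i H x"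
    unfolding F_def slice_conv_def by (intro nn_integral_cmult) measurable
  finally show ?thesis by (simp add: H_def[abs_def] k_def)
qed

section \<open>Sufficiency\<close>

text \<open>For a distribution given by a function f and for c > 0, the factor a = c^n, with n the
  dimension, yields the function f(x/c), and a = 1 yields the dilate with unchanged integral. Both
  normalisations occur, so a is kept as a parameter.\<close>

definition dilate :: "complex \<Rightarrow> real \<Rightarrow> ((real^'n \<Rightarrow> complex) \<Rightarrow> complex) \<Rightarrow> ((real^'n::finite \<Rightarrow> complex) \<Rightarrow> complex)"
  where "dilate a c T = restrict (\<lambda>\<psi>. T (\<lambda>y. a * \<psi> (c *\<^sub>R y))) schwartz"

lemma schwartz_scale:
  "\<psi> \<in> schwartz \<Longrightarrow> c \<noteq> 0 \<Longrightarrow> (\<lambda>y. a * \<psi> (c *\<^sub>R y)) \<in> schwartz"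
  using schwartz_cmult[OF schwartz_affine[of \<psi> c 0]] by simp

lemma dilate_tempered:
  fixes T :: "(real^'n::finite \<Rightarrow> complex) \<Rightarrow> complex"
  assumes T: "T \<in> tempered_distributions" and c: "c \<noteq> 0"
  shows "dilate a c T \<in> tempered_distributions"
proof -
  obtain CT N where CT: "\<And>\<psi>. \<psi> \<in> schwartz \<Longrightarrow> norm (T \<psi>) \<le> CT * schwartz_seminorm N \<psi>"
    using T unfolding tempered_distributions_def by blast
  define k where "k = 1 + (1 + norm (0::real^'n)) / \<bar>c\<bar>"
  define B where "B = norm a * max 1 \<bar>c\<bar> ^ N * k ^ N"
  have k: "0 \<le> k" by (simp add: k_def)
  have B: "0 \<le> B" using k by (simp add: B_def)
  have sem: "schwartz_seminorm N (\<lambda>y. a * \<psi> (c *\<^sub>R y)) \<le> B * schwartz_seminorm N \<psi>" if \<psi>: "\<psi> \<in> schwartz" for \<psi> :: "real^'n \<Rightarrow> complex"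
  proof (rule schwartz_seminorm_le)
    fix "is" :: "'n list" and x :: "real^'n" assume len: "length is \<le> N"
    have \<psi>c: "(\<lambda>y. \<psi> (0 + c *\<^sub>R y)) \<in> schwartz" by (rule schwartz_affine[OF \<psi> c])
    have p: "partials is (\<lambda>y. a * \<psi> (c *\<^sub>R y)) x = a * (of_real c ^ length is * partials is \<psi> (c *\<^sub>R x))"
      using partials_cmult[OF \<psi>c, of "is" a] partials_affine[OF \<psi>, of "is" 0 c] by simp
    have "(1 + norm x) ^ N \<le> (k * (1 + norm (c *\<^sub>R x))) ^ N"
      using weight_affine[OF c, of x 0] by (intro power_mono) (auto simp: k_def)
    then have 1: "(1 + norm x) ^ N \<le> k ^ N * (1 + norm (c *\<^sub>R x)) ^ N" by (simp only: power_mult_distrib)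
    have 2: "\<bar>c\<bar> ^ length is \<le> max 1 \<bar>c\<bar> ^ N"
    proof -
      have "\<bar>c\<bar> ^ length is \<le> max 1 \<bar>c\<bar> ^ length is" by (intro power_mono) auto
      also have "\<dots> \<le> max 1 \<bar>c\<bar> ^ N" using len by (intro power_increasing) auto
      finally show ?thesis .
    qed
    have "(1 + norm x) ^ N * norm (partials is (\<lambda>y. a * \<psi> (c *\<^sub>R y)) x)
      = (1 + norm x) ^ N * (norm a * \<bar>c\<bar> ^ length is * norm (partials is \<psi> (c *\<^sub>R x)))"
      by (simp add: p norm_mult norm_power)
    also have "\<dots> \<le> (k ^ N * (1 + norm (c *\<^sub>R x)) ^ N) * (norm a * max 1 \<bar>c\<bar> ^ N * norm (partials is \<psi> (c *\<^sub>R x)))"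
      using k by (intro mult_mono 1 2) auto
    also have "\<dots> = B * ((1 + norm (c *\<^sub>R x)) ^ N * norm (partials is \<psi> (c *\<^sub>R x)))"
      by (simp only: B_def mult_ac)
    also have "\<dots> \<le> B * schwartz_seminorm N \<psi>"
      by (intro mult_left_mono B le_schwartz_seminorm \<psi> len)
    finally show "(1 + norm x) ^ N * norm (partials is (\<lambda>y. a * \<psi> (c *\<^sub>R y)) x) \<le> B * schwartz_seminorm N \<psi>" .
  qed
  have "norm (T (\<lambda>y. a * \<psi> (c *\<^sub>R y))) \<le> (\<bar>CT\<bar> * B) * schwartz_seminorm N \<psi>" if \<psi>: "\<psi> \<in> schwartz" for \<psi> :: "real^'n \<Rightarrow> complex"
  proof -
    let ?\<eta> = "\<lambda>y. a * \<psi> (c *\<^sub>R y)"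
    have \<eta>: "?\<eta> \<in> schwartz" by (rule schwartz_scale[OF \<psi> c])
    have "0 \<le> schwartz_seminorm N ?\<eta>"
      using le_schwartz_seminorm[OF \<eta>, of "[]" N 0] by (auto intro: order_trans[rotated])
    then have "CT * schwartz_seminorm N ?\<eta> \<le> \<bar>CT\<bar> * schwartz_seminorm N ?\<eta>" by (intro mult_right_mono) auto
    also have "\<dots> \<le> \<bar>CT\<bar> * (B * schwartz_seminorm N \<psi>)" by (intro mult_left_mono sem \<psi>) auto
    finally show ?thesis using CT[OF \<eta>] by (simp add: mult.assoc)
  qed
  moreover have "T (\<lambda>y. a * (\<psi> (c *\<^sub>R y) + \<eta> (c *\<^sub>R y))) = T (\<lambda>y. a * \<psi> (c *\<^sub>R y)) + T (\<lambda>y. a * \<eta> (c *\<^sub>R y))"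
    if "\<psi> \<in> schwartz" "\<eta> \<in> schwartz" for \<psi> \<eta> :: "real^'n \<Rightarrow> complex"
    unfolding distrib_left by (rule tempered_add[OF T schwartz_scale[OF that(1) c] schwartz_scale[OF that(2) c]])
  moreover have "T (\<lambda>y. a * (b * \<psi> (c *\<^sub>R y))) = b * T (\<lambda>y. a * \<psi> (c *\<^sub>R y))" if "\<psi> \<in> schwartz" for \<psi> :: "real^'n \<Rightarrow> complex" and b
    unfolding mult.left_commute[of a b] by (rule tempered_cmult[OF T schwartz_scale[OF that c]])
  ultimately show ?thesis
    unfolding tempered_distributions_def dilate_def
    by (auto simp: schwartz_add schwartz_cmult intro!: exI[of _ "\<bar>CT\<bar> * B"] exI[of _ N])
qed

text \<open>Moves the dilation from the kernel to the distribution. Every block of positive index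
  becomes a dilate of a convolution with the fixed \<open>\<phi>\<close>, so that one inequality at
  unit frequency serves all k.\<close>

lemma conv_resolution:
  fixes \<phi> :: "real^'n::finite \<Rightarrow> complex"
  assumes \<phi>: "\<phi> \<in> schwartz" and k: "k \<noteq> 0"
  shows "conv (resolution \<Phi> \<phi> k) T x = conv \<phi> (dilate (2 ^ (k * CARD('n))) (2 ^ k) T) (2 ^ k *\<^sub>R x)"
proof -
  have "(\<lambda>y. \<phi> (2 ^ k *\<^sub>R x - y)) \<in> schwartz"
    using schwartz_affine[OF \<phi>, of "-1" "2 ^ k *\<^sub>R x"] by simp
  then show ?thesis
    using k by (simp add: conv_def dilate_def resolution_def scaleR_diff_right)
qed

text \<open>An upper limit for the power t: up to it the quotient e / t is at least 1. For e =
  \<infinity> the quotient is \<infinity> for every t, and the value 1 is only a convenient positive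
  number.\<close>

definition nat_exponent :: "ennreal \<Rightarrow> real"
  where "nat_exponent e = (if e = \<infinity> then 1 else enn2real e)"

lemma nat_exponent_pos: "0 < e \<Longrightarrow> 0 < nat_exponent e"
  by (simp add: nat_exponent_def enn2real_pos)

lemma one_le_divide_exponent:
  assumes "0 < e" "0 < t" "t \<le> nat_exponent e"
  shows "1 \<le> e / ennreal t"
  using assms(1)
proof (cases rule: exponent_cases)
  case 1
  then show ?thesis using assms by (simp add: infinity_ennreal_def ennreal_top_divide)
next
  case (2 r)
  then have "1 \<le> r / t" using assms by (simp add: nat_exponent_def)
  then show ?thesis using 2 assms by (simp add: divide_ennreal)
qed

lemma recip_divide:
  assumes "0 < e" "0 < t"
  shows "recip (e / ennreal t) = t * recip e"
  using assms(1)
proof (cases rule: exponent_cases)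
  case 1
  then show ?thesis using assms by (simp add: infinity_ennreal_def ennreal_top_divide)
next
  case (2 r)
  then show ?thesis using assms by (simp add: divide_ennreal recip_ennreal)
qed

lemma uniform_pos:
  fixes f :: "'a::finite \<Rightarrow> real"
  assumes "\<And>i. 0 < f i"
  obtains c where "0 < c" "\<And>i. c \<le> f i"
proof (rule that[of "Min (range f)"])
  show "0 < Min (range f)" using assms by (subst Min_gr_iff) auto
qed auto

text \<open>The constant C precedes the quantifiers over \<open>\<phi>\<close> and T. This
  uniformity is essential, because the k-th block is a convolution with a distribution that changes
  with k.\<close>

lemma bandlimited_herz_embedding:
  fixes p q r \<theta> :: "ennreal^'n::{finite,linorder}" and \<alpha>1 \<alpha>2 :: "real^'n::{finite,linorder}"
  assumes pq: "\<And>i. 0 < q $ i" "\<And>i. q $ i \<le> p $ i" and r: "\<And>i. 0 < r $ i" and \<theta>: "\<And>i. 0 < \<theta> $ i"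
    and \<alpha>: "\<And>i. - recip (p $ i) < \<alpha>1 $ i" "\<And>i. \<alpha>1 $ i \<le> \<alpha>2 $ i"
    and \<theta>r: "\<And>i. \<alpha>1 $ i = \<alpha>2 $ i \<Longrightarrow> \<theta> $ i = r $ i"
  shows "\<exists>C>0. \<forall>\<phi> T. T \<in> tempered_distributions \<longrightarrow> bandlimited \<phi> \<longrightarrow>
     herz_mixed_norm p \<alpha>1 r (conv \<phi> T) \<le> ennreal C * herz_mixed_norm q \<alpha>2 \<theta> (conv \<phi> T)"
proof -
  have p: "0 < p $ i" for i using pq(1)[of i] pq(2)[of i] by (rule less_le_trans)
  obtain t1 where t1: "0 < t1" "\<And>i. t1 \<le> nat_exponent (q $ i)"
    using uniform_pos[of "\<lambda>i. nat_exponent (q $ i)"] nat_exponent_pos[OF pq(1)] by metis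
  obtain t3 where t3: "0 < t3" "\<And>i. t3 \<le> nat_exponent (r $ i)"
    using uniform_pos[of "\<lambda>i. nat_exponent (r $ i)"] nat_exponent_pos[OF r] by metis
  obtain t4 where t4: "0 < t4" "\<And>i. t4 \<le> nat_exponent (\<theta> $ i)"
    using uniform_pos[of "\<lambda>i. nat_exponent (\<theta> $ i)"] nat_exponent_pos[OF \<theta>] by metis
  \<comment> \<open>This bound forces t w \<le> |w| / (1 + |w|) < 1 for w = \<open>\<alpha>2\<close>
    + 1/q, the upper restriction on the weight in the smoothing lemma.\<close>
  obtain t5 where t5: "0 < t5" "\<And>i. t5 \<le> 1 / (1 + \<bar>\<alpha>2 $ i + recip (q $ i)\<bar>)"
    using uniform_pos[of "\<lambda>i. 1 / (1 + \<bar>\<alpha>2 $ i + recip (q $ i)\<bar>)"] by (metis abs_ge_zero add_pos_nonneg zero_less_divide_1_iff zero_less_one)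
  define t where "t = min 1 (min t1 (min t3 (min t4 t5)))"
  have t: "0 < t" "t \<le> 1" "t \<le> t1" "t \<le> t3" "t \<le> t4" "t \<le> t5"
    using t1 t3 t4 t5 by (auto simp: t_def)
  define P Q R \<Theta> where "P = (\<chi> i. p $ i / ennreal t)" and "Q = (\<chi> i. q $ i / ennreal t)"
    and "R = (\<chi> i. r $ i / ennreal t)" and "\<Theta> = (\<chi> i. \<theta> $ i / ennreal t)"
  define a1 a2 where "a1 = (\<chi> i. t * \<alpha>1 $ i)" and "a2 = (\<chi> i. t * \<alpha>2 $ i)"
  \<comment> \<open>The sum of the moduli dominates every summand, so one order of decay suits all
    variables.\<close>
  define L where "L = (\<Sum>i\<in>UNIV. \<bar>(a1 $ i + recip (P $ i)) + (1 - recip (Q $ i) - a2 $ i)\<bar>) + 2"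
  have L: "(a1 $ i + recip (P $ i)) + (1 - recip (Q $ i) - a2 $ i) + 2 \<le> L" for i
  proof -
    have "(a1 $ i + recip (P $ i)) + (1 - recip (Q $ i) - a2 $ i) \<le> \<bar>(a1 $ i + recip (P $ i)) + (1 - recip (Q $ i) - a2 $ i)\<bar>" by simp
    also have "\<dots> \<le> (\<Sum>i\<in>UNIV. \<bar>(a1 $ i + recip (P $ i)) + (1 - recip (Q $ i) - a2 $ i)\<bar>)"
      by (rule member_le_sum) auto
    finally show ?thesis by (simp add: L_def)
  qed
  \<comment> \<open>The t-th power of a kernel of order M decays with order M t, which has to be at
    least L. The successor keeps M positive.\<close>
  define M where "M = Suc (nat \<lceil>L / t\<rceil>)"
  have M: "1 \<le> M" "L \<le> real M * t"
  proof -
    have "L / t \<le> real M" unfolding M_def by linarith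
    then show "L \<le> real M * t" using t by (simp add: divide_le_eq)
  qed (simp add: M_def)
  define k where "k = (4 * real M) powr (real M * t)"
  have k: "0 < k" using M by (simp add: k_def)
  have recips: "recip (P $ i) = t * recip (p $ i)" "recip (Q $ i) = t * recip (q $ i)" for i
    using t p pq by (simp_all add: P_def Q_def recip_divide)
  have QP: "1 \<le> Q $ i" "Q $ i \<le> P $ i" for i
    using one_le_divide_exponent[OF pq(1)[of i] t(1) order_trans[OF t(3) t1(2)]] pq(2)[of i]
    by (auto simp: P_def Q_def intro: divide_right_mono_ennreal)
  have R1: "1 \<le> R $ i" for i
    using one_le_divide_exponent[OF r[of i] t(1) order_trans[OF t(4) t3(2)]] by (simp add: R_def)
  have \<Theta>1: "1 \<le> \<Theta> $ i" for i
    using one_le_divide_exponent[OF \<theta>[of i] t(1) order_trans[OF t(5) t4(2)]] by (simp add: \<Theta>_def)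
  have \<Theta>R: "\<Theta> $ i = R $ i" if "a1 $ i = a2 $ i" for i
    using that t \<theta>r[of i] by (simp add: a1_def a2_def \<Theta>_def R_def)
  have a: "0 < a1 $ i + recip (P $ i)" "a1 $ i \<le> a2 $ i" "a2 $ i + recip (Q $ i) < 1" for i
  proof -
    have "0 < t * (\<alpha>1 $ i + recip (p $ i))"
      using t(1) \<alpha>(1)[of i] by (intro mult_pos_pos) linarith+
    then show "0 < a1 $ i + recip (P $ i)" by (simp add: recips a1_def distrib_left)
    show "a1 $ i \<le> a2 $ i" using t(1) \<alpha>(2)[of i] by (simp add: a1_def a2_def)
    define w where "w = \<alpha>2 $ i + recip (q $ i)"
    have "t * w \<le> t * \<bar>w\<bar>" using t(1) by (intro mult_left_mono) auto
    also have "\<dots> \<le> (1 / (1 + \<bar>w\<bar>)) * \<bar>w\<bar>"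
      using order_trans[OF t(6) t5(2)[of i]] by (intro mult_right_mono) (simp_all add: w_def)
    also have "\<dots> < 1" by (simp add: divide_less_eq add_pos_nonneg)
    finally show "a2 $ i + recip (Q $ i) < 1" by (simp add: recips a2_def w_def distrib_left)
  qed
  define ixs where "ixs = sorted_list_of_set (UNIV :: 'n set)"
  show ?thesis
  proof (rule herz_partial_norm_smoothing[OF QP R1 \<Theta>1 \<Theta>R a L k])
    fix C :: real
    assume C: "0 < C" "\<And>ixs h x. distinct ixs \<Longrightarrow> h \<in> borel_measurable borel \<Longrightarrow>
      (\<And>i x. i \<in> set ixs \<Longrightarrow> h x \<le> ennreal k * slice_conv L i h x) \<Longrightarrow>
      herz_partial_norm P a1 R ixs h x \<le> ennreal (C ^ length ixs) * herz_partial_norm Q a2 \<Theta> ixs h x"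
    \<comment> \<open>Smoothing costs one factor C per variable; the exponent 1/t undoes the passage
      to t-th powers.\<close>
    define D where "D = (C ^ length ixs) powr (1 / t)"
    show ?thesis
  proof (intro exI[of _ D] conjI allI impI)
    show "0 < D" using C by (simp add: D_def)
    fix \<phi> :: "real^'n::{finite,linorder} \<Rightarrow> complex" and T :: "(real^'n::{finite,linorder} \<Rightarrow> complex) \<Rightarrow> complex"
    assume T: "T \<in> tempered_distributions" and \<phi>: "bandlimited \<phi>"
    define g where "g x = ennreal (norm (conv \<phi> T x))" for x
    have g[measurable]: "g \<in> borel_measurable borel"
      using conv_measurable[OF T \<phi>] unfolding g_def by measurable
    have "herz_partial_norm P a1 R ixs (\<lambda>x. epow (g x) t) 0 \<le> ennreal (C ^ length ixs) * herz_partial_norm Q a2 \<Theta> ixs (\<lambda>x. epow (g x) t) 0"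
    proof (rule C(2))
      show "distinct ixs" by (simp add: ixs_def)
      show "epow (g x) t \<le> ennreal k * slice_conv L i (\<lambda>x. epow (g x) t) x" for i x
        unfolding g_def k_def by (rule conv_power_le[OF T \<phi> t(1,2) M])
    qed measurable
    then have "epow (herz_partial_norm p \<alpha>1 r ixs g 0) t \<le> ennreal (C ^ length ixs) * epow (herz_partial_norm q \<alpha>2 \<theta> ixs g 0) t"
      using herz_partial_norm_epow[of p r g t \<alpha>1 "ixs" 0] herz_partial_norm_epow[of q \<theta> g t \<alpha>2 "ixs" 0] p pq(1) r \<theta> g t(1)
      by (simp add: P_def Q_def R_def \<Theta>_def a1_def a2_def)
    then have "herz_partial_norm p \<alpha>1 r ixs g 0 \<le> epow (ennreal (C ^ length ixs) * epow (herz_partial_norm q \<alpha>2 \<theta> ixs g 0) t) (1 / t)"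
      using t(1) by (simp add: epow_le_iff_left)
    also have "\<dots> = ennreal D * herz_partial_norm q \<alpha>2 \<theta> ixs g 0"
      using t(1) C by (simp add: epow_mult epow_ennreal D_def)
    finally show "herz_mixed_norm p \<alpha>1 r (conv \<phi> T) \<le> ennreal D * herz_mixed_norm q \<alpha>2 \<theta> (conv \<phi> T)"
      by (simp add: herz_mixed_norm_def g_def[abs_def] ixs_def)
  qed
  qed
qed

lemma herz_mixed_norm_scale:
  fixes p q :: "ennreal^'n::{finite,linorder}" and \<alpha> :: "real^'n::{finite,linorder}"
  assumes "\<And>i. 0 < p $ i" "\<And>i. 0 < q $ i" and [measurable]: "f \<in> borel_measurable borel"
  shows "herz_mixed_norm p \<alpha> q (\<lambda>x. f (2 ^ k *\<^sub>R x))
    = ennreal (2 powr (- real k * (\<Sum>i\<in>UNIV. recip (p $ i) + \<alpha> $ i))) * herz_mixed_norm p \<alpha> q f"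
proof -
  have "(\<Sum>i\<leftarrow>sorted_list_of_set (UNIV::'n set). recip (p $ i) + \<alpha> $ i) = (\<Sum>i\<in>UNIV. recip (p $ i) + \<alpha> $ i)"
    by (simp add: sum_list_distinct_conv_sum_set)
  then show ?thesis
    using herz_partial_norm_scale[of p q "\<lambda>x. ennreal (norm (f x))" \<alpha> "sorted_list_of_set UNIV" "int k" 0] assms
    by (simp add: herz_mixed_norm_def)
qed

lemma admissible_bandlimited:
  assumes "admissible \<Phi> \<phi>"
  shows "bandlimited \<Phi>" "bandlimited \<phi>"
proof -
  have "fourier g \<xi> = 0" if "supp (fourier g) \<subseteq> S" "\<xi> \<notin> S" for g :: "real^'a \<Rightarrow> complex" and S \<xi>
    using that closure_subset[of "{\<xi>. fourier g \<xi> \<noteq> 0}"] by (auto simp: supp_def)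
  then show "bandlimited \<Phi>" "bandlimited \<phi>"
    using assms unfolding admissible_def bandlimited_def by (fastforce simp: not_le)+
qed

text \<open>Dilation by 2^k contributes 2^(-k \<sigma>) to a mixed Herz norm, \<sigma> being the sum
  of 1/p and \<alpha> over all coordinates. The assumed inequality therefore says that the powers of
  2 compare for each k separately. Different k do not interact, so the same \<beta> stands on both
  sides. The block k = 0 needs no dilation.\<close>

theorem besov_embedding_sufficient:
  fixes \<Phi> \<phi> :: "real^'n::{finite,linorder} \<Rightarrow> complex"
    and p q r \<theta> :: "ennreal^'n::{finite,linorder}" and \<alpha>1 \<alpha>2 :: "real^'n::{finite,linorder}"
  assumes adm: "admissible \<Phi> \<phi>"
    and pq: "\<And>i. 0 < q $ i" "\<And>i. q $ i \<le> p $ i" and r: "\<And>i. 0 < r $ i" and \<theta>: "\<And>i. 0 < \<theta> $ i"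
    and \<beta>: "0 < \<beta>"
    and \<alpha>: "\<And>i. - recip (p $ i) < \<alpha>1 $ i" "\<And>i. \<alpha>1 $ i \<le> \<alpha>2 $ i"
    and \<theta>r: "\<And>i. \<alpha>1 $ i = \<alpha>2 $ i \<Longrightarrow> \<theta> $ i = r $ i"
    and s: "s1 - (\<Sum>i\<in>UNIV. recip (p $ i) + \<alpha>1 $ i) \<le> s2 - (\<Sum>i\<in>UNIV. recip (q $ i) + \<alpha>2 $ i)"
  shows "besov_embedding \<Phi> \<phi> q \<alpha>2 \<theta> s2 p \<alpha>1 r s1 \<beta>"
proof -
  have p: "0 < p $ i" for i using pq(1)[of i] pq(2)[of i] by (rule less_le_trans)
  define \<sigma>p where "\<sigma>p = (\<Sum>i\<in>UNIV. recip (p $ i) + \<alpha>1 $ i)"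
  define \<sigma>q where "\<sigma>q = (\<Sum>i\<in>UNIV. recip (q $ i) + \<alpha>2 $ i)"
  note bl = admissible_bandlimited[OF adm]
  obtain C where C: "0 < C" "\<And>\<phi> T. T \<in> tempered_distributions \<Longrightarrow> bandlimited \<phi> \<Longrightarrow>
     herz_mixed_norm p \<alpha>1 r (conv \<phi> T) \<le> ennreal C * herz_mixed_norm q \<alpha>2 \<theta> (conv \<phi> T)"
    using bandlimited_herz_embedding[OF pq r \<theta> \<alpha> \<theta>r] by metis
  have term_le: "ennreal (2 powr (real k * s1)) * herz_mixed_norm p \<alpha>1 r (conv (resolution \<Phi> \<phi> k) T)
      \<le> ennreal C * (ennreal (2 powr (real k * s2)) * herz_mixed_norm q \<alpha>2 \<theta> (conv (resolution \<Phi> \<phi> k) T))"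
    if T: "T \<in> tempered_distributions" for T k
  proof (cases "k = 0")
    case True
    then show ?thesis using C(2)[OF T bl(1)] by (simp add: resolution_def)
  next
    case False
    define S where "S = dilate (2 ^ (k * CARD('n))) (2 ^ k) T"
    have S: "S \<in> tempered_distributions" unfolding S_def by (rule dilate_tempered[OF T]) simp
    define G where "G = conv \<phi> S"
    have G: "G \<in> borel_measurable borel" unfolding G_def by (rule conv_measurable[OF S bl(2)])
    have eq: "conv (resolution \<Phi> \<phi> k) T = (\<lambda>x. G (2 ^ k *\<^sub>R x))"
      using conv_resolution[of \<phi> k \<Phi> T] False bl(2) by (simp add: fun_eq_iff G_def S_def bandlimited_def)
    have "ennreal (2 powr (real k * s1)) * herz_mixed_norm p \<alpha>1 r (conv (resolution \<Phi> \<phi> k) T)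
       = ennreal (2 powr (real k * s1)) * (ennreal (2 powr (- real k * \<sigma>p)) * herz_mixed_norm p \<alpha>1 r G)"
      unfolding eq \<sigma>p_def by (subst herz_mixed_norm_scale[OF p r G]) simp
    also have "\<dots> = ennreal (2 powr (real k * (s1 - \<sigma>p))) * herz_mixed_norm p \<alpha>1 r G"
      by (simp add: mult.assoc[symmetric] ennreal_mult[symmetric] powr_add[symmetric] right_diff_distrib)
    also have "\<dots> \<le> ennreal (2 powr (real k * (s2 - \<sigma>q))) * (ennreal C * herz_mixed_norm q \<alpha>2 \<theta> G)"
      using s C(2)[OF S bl(2)] unfolding G_def \<sigma>p_def \<sigma>q_def
      by (intro mult_mono ennreal_leI powr_mono mult_left_mono) auto
    also have "\<dots> = ennreal C * (ennreal (2 powr (real k * (s2 - \<sigma>q))) * herz_mixed_norm q \<alpha>2 \<theta> G)"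
      by (simp only: mult.left_commute)
    also have "ennreal (2 powr (real k * (s2 - \<sigma>q))) * herz_mixed_norm q \<alpha>2 \<theta> G
       = ennreal (2 powr (real k * s2)) * (ennreal (2 powr (- real k * \<sigma>q)) * herz_mixed_norm q \<alpha>2 \<theta> G)"
      by (simp add: mult.assoc[symmetric] ennreal_mult[symmetric] powr_add[symmetric] right_diff_distrib)
    also have "ennreal (2 powr (- real k * \<sigma>q)) * herz_mixed_norm q \<alpha>2 \<theta> G = herz_mixed_norm q \<alpha>2 \<theta> (conv (resolution \<Phi> \<phi> k) T)"
      unfolding eq \<sigma>q_def by (subst herz_mixed_norm_scale[OF pq(1) \<theta> G]) simp
    finally show ?thesis .
  qed
  have le: "besov_norm \<Phi> \<phi> p \<alpha>1 r s1 \<beta> T \<le> ennreal C * besov_norm \<Phi> \<phi> q \<alpha>2 \<theta> s2 \<beta> T"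
    if T: "T \<in> tempered_distributions" for T
  proof -
    have "besov_norm \<Phi> \<phi> p \<alpha>1 r s1 \<beta> T \<le> eLp (count_space UNIV) \<beta>
       (\<lambda>k::nat. ennreal C * (ennreal (2 powr (real k * s2)) * herz_mixed_norm q \<alpha>2 \<theta> (conv (resolution \<Phi> \<phi> k) T)))"
      unfolding besov_norm_def lq_norm_eq by (intro eLp_mono term_le T) auto
    also have "\<dots> \<le> ennreal C * besov_norm \<Phi> \<phi> q \<alpha>2 \<theta> s2 \<beta> T"
      unfolding besov_norm_def lq_norm_eq using C(1) \<beta> by (intro eLp_cmult_le) auto
    finally show ?thesis .
  qed
  show ?thesis
    unfolding besov_embedding_def embedded_def
  proof (intro conjI exI[of _ C] ballI subsetI)
    fix T assume "T \<in> besov_space \<Phi> \<phi> q \<alpha>2 \<theta> s2 \<beta>"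
    then have T: "T \<in> tempered_distributions" "besov_norm \<Phi> \<phi> q \<alpha>2 \<theta> s2 \<beta> T < \<infinity>"
      by (auto simp: besov_space_def)
    have "ennreal C * besov_norm \<Phi> \<phi> q \<alpha>2 \<theta> s2 \<beta> T < \<infinity>"
      using T(2) by (simp add: ennreal_mult_less_top)
    then show "T \<in> besov_space \<Phi> \<phi> p \<alpha>1 r s1 \<beta>"
      using le[OF T(1)] T(1) by (auto simp: besov_space_def intro: le_less_trans)
  next
    fix T assume "T \<in> besov_space \<Phi> \<phi> q \<alpha>2 \<theta> s2 \<beta>"
    then show "besov_norm \<Phi> \<phi> p \<alpha>1 r s1 \<beta> T \<le> ennreal C * besov_norm \<Phi> \<phi> q \<alpha>2 \<theta> s2 \<beta> T"
      by (intro le) (simp add: besov_space_def)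
  qed
qed

section \<open>Necessity\<close>

lemma eLp_zero [simp]: "eLp N p (\<lambda>x. 0) = 0"
  using esssup_I[of "\<lambda>x. 0::ennreal" N 0] by (auto simp: eLp_def)

lemma eLp_eq_0D:
  assumes "0 < p" and [measurable]: "f \<in> borel_measurable N" and 0: "eLp N p f = 0"
  shows "AE x in N. f x = 0"
  using assms(1)
proof (cases rule: exponent_cases)
  case 1
  then show ?thesis using eLp_infinity_le_iff[OF assms(2), of 0] 0 by simp
next
  case (2 r)
  then have "(\<integral>\<^sup>+x. epow (f x) r \<partial>N) = 0" using 0 by (simp add: eLp_def)
  then show ?thesis by (subst (asm) nn_integral_0_iff_AE) auto
qed

lemma herz_partial_norm_zero [simp]: "herz_partial_norm p \<alpha> q is (\<lambda>x. 0) x = 0"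
proof (induction "is" arbitrary: x)
  case (Cons i "is")
  have "slice_norm p \<alpha> q i (\<lambda>x. 0) = (\<lambda>x. 0)"
    by (simp add: slice_norm_def[abs_def] herz_norm_eLp)
  then show ?case by (simp add: herz_partial_norm_Cons Cons.IH)
qed simp

lemma herz_mixed_norm_zero [simp]: "herz_mixed_norm p \<alpha> q (\<lambda>x. 0) = 0"
  by (simp add: herz_mixed_norm_def)

lemma herz_mixed_norm_cmult:
  fixes p q :: "ennreal^'n::{finite,linorder}" and f :: "real^'n::{finite,linorder} \<Rightarrow> complex"
  assumes "\<And>i. 0 < p $ i" "\<And>i. 0 < q $ i" and f[measurable]: "f \<in> borel_measurable borel" and c: "c \<noteq> 0"
  shows "herz_mixed_norm p \<alpha> q (\<lambda>x. c * f x) = ennreal (norm c) * herz_mixed_norm p \<alpha> q f"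
  unfolding herz_mixed_norm_def norm_mult ennreal_mult[OF norm_ge_zero norm_ge_zero]
  by (rule herz_partial_norm_cmult) (use assms in auto)

text \<open>A single annulus in each variable suffices for a lower bound, since one term bounds a
  sequence norm from below. The set B shrinks in the induction: a variable whose norm has been taken
  imposes no condition any more.\<close>

lemma herz_partial_norm_pos:
  fixes p q :: "ennreal^'n::finite"
  assumes p: "\<And>i. 0 < p $ i" and q: "\<And>i. 0 < q $ i" and c: "0 < c"
    and h: "\<And>x::real^'n. (\<And>j. j \<in> B \<Longrightarrow> x $ j \<in> annulus k) \<Longrightarrow> c \<le> h x"
  shows "\<exists>c'>0. \<forall>x::real^'n. (\<forall>j\<in>B - set is. x $ j \<in> annulus k) \<longrightarrow> c' \<le> herz_partial_norm p \<alpha> q is h x"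
  using c h
proof (induction "is" arbitrary: h c B)
  case Nil
  then show ?case by auto
next
  case (Cons i "is")
  define e where "e = ennreal (2 powr (real_of_int k * \<alpha> $ i)) * eLp lborel (p $ i) (\<lambda>t. c * indicator (annulus k) t * indicator (annulus k) t)"
  have e: "0 < e"
  proof -
    have "eLp lborel (p $ i) (\<lambda>t. c * indicator (annulus k) t * indicator (annulus k) t) \<noteq> 0"
    proof
      assume "eLp lborel (p $ i) (\<lambda>t. c * indicator (annulus k) t * indicator (annulus k) t) = 0"
      then have "AE t in lborel. c * indicator (annulus k) t * indicator (annulus k) t = 0"
        by (rule eLp_eq_0D[OF p, rotated]) measurable
      then have "AE t in lborel. t \<notin> annulus k"
        by eventually_elim (use Cons.prems(1) in \<open>auto simp: indicator_def split: if_splits\<close>)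
      then have "emeasure lborel (annulus k) = 0"
        by (subst (asm) AE_iff_measurable[OF _ refl]) auto
      then show False by (simp add: emeasure_annulus)
    qed
    then show ?thesis by (simp add: e_def zero_less_iff_neq_zero ennreal_zero_less_mult_iff)
  qed
  have sl: "e \<le> slice_norm p \<alpha> q i h x" if x: "\<And>j. j \<in> B - {i} \<Longrightarrow> x $ j \<in> annulus k" for x :: "real^'n"
  proof -
    have "e \<le> herz_norm (p $ i) (\<alpha> $ i) (q $ i) (\<lambda>t. c * indicator (annulus k) t)"
      unfolding herz_norm_eLp e_def
      using eLp_count_ge[OF q, of "\<lambda>k'. ennreal (2 powr (real_of_int k' * \<alpha> $ i)) * eLp lborel (p $ i) (\<lambda>t. c * indicator (annulus k) t * indicator (annulus k') t)" k i] .
    also have "\<dots> \<le> slice_norm p \<alpha> q i h x"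
      unfolding slice_norm_def
    proof (rule herz_norm_mono)
      fix t
      show "c * indicator (annulus k) t \<le> h (slice i x t)"
      proof (cases "t \<in> annulus k")
        case True
        then have "c \<le> h (slice i x t)" using x by (intro Cons.prems(2)) auto
        then show ?thesis using True by simp
      qed simp
    qed measurable
    finally show ?thesis .
  qed
  have "\<exists>c'>0. \<forall>x::real^'n. (\<forall>j\<in>(B - {i}) - set is. x $ j \<in> annulus k) \<longrightarrow>
      c' \<le> herz_partial_norm p \<alpha> q is (slice_norm p \<alpha> q i h) x"
    by (rule Cons.IH[OF e], rule sl) blast
  moreover have "(B - {i}) - set is = B - set (i # is)" by auto
  ultimately show ?case by (simp only: herz_partial_norm_Cons)
qed

lemma recip_antimono: "0 < q \<Longrightarrow> q \<le> p \<Longrightarrow> recip p \<le> recip q"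
proof -
  assume q: "0 < q" and qp: "q \<le> p"
  have "0 < p" using q qp by (rule less_le_trans)
  then show ?thesis
  proof (cases rule: exponent_cases)
    case 1
    then show ?thesis by (simp add: recip_nonneg)
  next
    case p: (2 s)
    from q show ?thesis
    proof (cases rule: exponent_cases)
      case 1
      then show ?thesis using p qp by (simp add: infinity_ennreal_def top_unique)
    next
      case (2 r)
      then show ?thesis using p qp by (simp add: divide_left_mono)
    qed
  qed
qed

text \<open>On annulus k the weighted norm is at most a constant times 2^(k u) with u = \<alpha> +
  1/p. For k \<le> 0 this decays since u > 0; for k > 0 the kernel contributes 2^(-L k), and L \<ge>
  2 u leaves the same rate u.\<close>

lemma herz_norm_decay_finite:
  assumes p: "0 < p" and q: "0 < q" and a: "0 < \<alpha> + recip p" and L: "2 * (\<alpha> + recip p) \<le> L"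
  shows "herz_norm p \<alpha> q (\<lambda>t. ennreal (decay L t)) < \<infinity>"
proof -
  define u where "u = \<alpha> + recip p"
  have L0: "0 \<le> L" using a L by simp
  have k: "ennreal (2 powr (real_of_int k * \<alpha>)) * eLp lborel p (\<lambda>t. ennreal (decay L t) * indicator (annulus k) t)
     \<le> ennreal (2 powr L * 2 powr (- u * \<bar>real_of_int k\<bar>))" for k
  proof -
    define w where "w = 2 powr L * 2 powr (- L * real_of_int (max 0 k))"
    have "decay L t \<le> w" if t: "t \<in> annulus k" for t
    proof (cases "k \<le> 0")
      case True
      then show ?thesis using decay_le_1[OF L0, of t] ge_one_powr_ge_zero[of 2 L] L0 by (simp add: w_def)
    next
      case False
      have "2 powi (k - 1) \<le> 1 + \<bar>t\<bar>" using t by (simp add: annulus_def)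
      then have "decay L t \<le> (2 powi (k - 1)) powr (- L)"
        unfolding decay_def using L0 by (intro powr_mono2') auto
      also have "\<dots> = 2 powr L * 2 powr (- L * real_of_int k)"
        unfolding two_powi_eq_powr powr_powr powr_add[symmetric] by (simp add: algebra_simps)
      finally show ?thesis using False by (simp add: w_def)
    qed
    then have "eLp lborel p (\<lambda>t. ennreal (decay L t) * indicator (annulus k) t) \<le> eLp lborel p (\<lambda>t. ennreal w * indicator (annulus k) t)"
      by (intro eLp_mono) (auto simp: indicator_def intro!: ennreal_leI)
    also have "\<dots> \<le> ennreal w * ennreal ((2 powi k) powr recip p)"
      by (rule eLp_indicator_le) (auto simp: emeasure_annulus p)
    finally have "ennreal (2 powr (real_of_int k * \<alpha>)) * eLp lborel p (\<lambda>t. ennreal (decay L t) * indicator (annulus k) t)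
      \<le> ennreal (2 powr (real_of_int k * \<alpha>)) * (ennreal w * ennreal ((2 powi k) powr recip p))"
      by (rule mult_left_mono) simp
    also have "\<dots> = ennreal (2 powr (real_of_int k * \<alpha>) * (w * (2 powi k) powr recip p))"
      by (simp add: ennreal_mult w_def)
    also have "2 powr (real_of_int k * \<alpha>) * (w * (2 powi k) powr recip p) = 2 powr L * 2 powr (real_of_int k * u - L * real_of_int (max 0 k))"
    proof -
      have e: "real_of_int k * \<alpha> + (- L * real_of_int (max 0 k) + real_of_int k * recip p) = real_of_int k * u - L * real_of_int (max 0 k)"
        by (simp add: u_def algebra_simps)
      have "2 powr (real_of_int k * \<alpha>) * (w * (2 powi k) powr recip p)
        = 2 powr L * (2 powr (real_of_int k * \<alpha>) * (2 powr (- L * real_of_int (max 0 k)) * 2 powr (real_of_int k * recip p)))"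
        by (simp only: w_def two_powi_eq_powr powr_powr mult_ac)
      then show ?thesis by (simp only: powr_add[symmetric] e)
    qed
    also have "ennreal (2 powr L * 2 powr (real_of_int k * u - L * real_of_int (max 0 k))) \<le> ennreal (2 powr L * 2 powr (- u * \<bar>real_of_int k\<bar>))"
    proof (intro ennreal_leI mult_left_mono powr_mono)
      show "real_of_int k * u - L * real_of_int (max 0 k) \<le> - u * \<bar>real_of_int k\<bar>"
      proof (cases "k \<le> 0")
        case True
        then show ?thesis by simp
      next
        case False
        have "2 * u * real_of_int k \<le> L * real_of_int k"
          using L False unfolding u_def by (intro mult_right_mono) auto
        then show ?thesis using False by (simp add: algebra_simps)
      qed
    qed simp_all
    finally show ?thesis .
  qed
  from q show ?thesis
  proof (cases rule: exponent_cases)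
    case 1
    have "herz_norm p \<alpha> q (\<lambda>t. ennreal (decay L t)) \<le> ennreal (2 powr L)"
      unfolding 1 herz_norm_eLp
    proof (subst eLp_infinity_le_iff, simp, rule AE_I2)
      fix k :: int
      have "- u * \<bar>real_of_int k\<bar> \<le> 0" using a by (intro mult_nonpos_nonneg) (auto simp: u_def)
      then have "2 powr (- u * \<bar>real_of_int k\<bar>) \<le> 2 powr 0" by (intro powr_mono) auto
      then have "2 powr L * 2 powr (- u * \<bar>real_of_int k\<bar>) \<le> 2 powr L"
        by (simp add: mult_left_le)
      then show "ennreal (2 powr (real_of_int k * \<alpha>)) * eLp lborel p (\<lambda>t. ennreal (decay L t) * indicator (annulus k) t) \<le> ennreal (2 powr L)"
        using k[of k] by (auto intro: order_trans ennreal_leI)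
    qed
    then show ?thesis by (simp add: less_top top_unique le_less_trans)
  next
    case (2 r)
    have "0 < u * r" using a 2 by (simp add: u_def)
    then obtain E where E: "0 < E" "(\<integral>\<^sup>+k. ennreal (2 powr (- (u * r) * \<bar>real_of_int k\<bar>)) \<partial>count_space UNIV) \<le> ennreal E"
      by (rule summable_int_geometric)
    have "herz_norm p \<alpha> q (\<lambda>t. ennreal (decay L t)) \<le> eLp (count_space UNIV) q (\<lambda>k. ennreal (2 powr L * 2 powr (- u * \<bar>real_of_int k\<bar>)))"
      unfolding herz_norm_eLp by (intro eLp_mono k) auto
    also have "\<dots> = epow (\<integral>\<^sup>+k. ennreal ((2 powr L) powr r) * ennreal (2 powr (- (u * r) * \<bar>real_of_int k\<bar>)) \<partial>count_space UNIV) (1 / r)"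
    proof -
      have "epow (ennreal (2 powr L * 2 powr (- u * \<bar>real_of_int k\<bar>))) r = ennreal ((2 powr L) powr r) * ennreal (2 powr (- (u * r) * \<bar>real_of_int k\<bar>))" for k
      proof -
        have "(2 powr L * 2 powr (- u * \<bar>real_of_int k\<bar>)) powr r = (2 powr L) powr r * 2 powr (- (u * r) * \<bar>real_of_int k\<bar>)"
          by (simp add: powr_mult powr_powr mult_ac)
        moreover have "epow (ennreal (2 powr L * 2 powr (- u * \<bar>real_of_int k\<bar>))) r = ennreal ((2 powr L * 2 powr (- u * \<bar>real_of_int k\<bar>)) powr r)"
          by (rule epow_ennreal) simp
        moreover have "ennreal ((2 powr L) powr r * 2 powr (- (u * r) * \<bar>real_of_int k\<bar>)) = ennreal ((2 powr L) powr r) * ennreal (2 powr (- (u * r) * \<bar>real_of_int k\<bar>))"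
          by (rule ennreal_mult) simp_all
        ultimately show ?thesis by (simp only:)
      qed
      then show ?thesis using 2 by (simp only: eLp_def if_False)
    qed
    also have "\<dots> \<le> epow (ennreal ((2 powr L) powr r) * ennreal E) (1 / r)"
      using 2 E by (intro epow_mono) (auto simp: nn_integral_cmult intro!: mult_left_mono)
    also have "\<dots> < \<infinity>"
      using E by (simp add: ennreal_mult[symmetric] epow_ennreal)
    finally show ?thesis .
  qed
qed

lemma herz_partial_norm_decay_finite:
  fixes p q :: "ennreal^'n::finite"
  assumes p: "\<And>i. 0 < p $ i" and q: "\<And>i. 0 < q $ i" and H: "\<And>i. herz_norm (p $ i) (\<alpha> $ i) (q $ i) (\<lambda>t. ennreal (decay L t)) < \<infinity>"
    and "distinct is"
  shows "herz_partial_norm p \<alpha> q is (\<lambda>x::real^'n. \<Prod>i\<in>set is. ennreal (decay L (x $ i))) x < \<infinity>"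
  using assms(4)
proof (induction "is" arbitrary: x)
  case (Cons i "is")
  \<comment> \<open>The summand 1 keeps c away from 0, as is required for drawing it out of the
    remaining norms.\<close>
  define c where "c = herz_norm (p $ i) (\<alpha> $ i) (q $ i) (\<lambda>t. ennreal (decay L t)) + 1"
  have c: "c \<noteq> 0" "c \<noteq> \<infinity>" using H[of i] by (auto simp: c_def)
  define f where "f x = (\<Prod>i\<in>set is. ennreal (decay L (x $ i)))" for x :: "real^'n"
  have f[measurable]: "f \<in> borel_measurable borel"
    unfolding f_def cart_eq_inner_axis by measurable
  have fx: "f x \<noteq> 0" "f x \<noteq> \<infinity>" for x
    by (simp_all add: f_def prod_ennreal less_imp_le[OF decay_pos] prod_pos decay_pos ennreal_eq_0_iff not_le)
  have F[measurable]: "(\<lambda>x::real^'n. \<Prod>j\<in>set (i # is). ennreal (decay L (x $ j))) \<in> borel_measurable borel"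
    unfolding cart_eq_inner_axis by measurable
  have s: "slice_norm p \<alpha> q i (\<lambda>x::real^'n. \<Prod>j\<in>set (i # is). ennreal (decay L (x $ j))) x \<le> c * f x" for x
  proof -
    have "(\<Prod>j\<in>set (i # is). ennreal (decay L (slice i x t $ j))) = f x * ennreal (decay L t)" for t
    proof -
      have "(\<Prod>j\<in>set is. ennreal (decay L (slice i x t $ j))) = f x"
        unfolding f_def using Cons.prems by (intro prod.cong) auto
      then show ?thesis using Cons.prems by (simp add: mult.commute)
    qed
    then have "slice_norm p \<alpha> q i (\<lambda>x::real^'n. \<Prod>j\<in>set (i # is). ennreal (decay L (x $ j))) x
       = herz_norm (p $ i) (\<alpha> $ i) (q $ i) (\<lambda>t. f x * ennreal (decay L t))"
      unfolding slice_norm_def by simp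
    also have "\<dots> = f x * herz_norm (p $ i) (\<alpha> $ i) (q $ i) (\<lambda>t. ennreal (decay L t))"
      by (intro herz_norm_cmult p q fx) measurable
    also have "\<dots> \<le> f x * c" unfolding c_def by (intro mult_left_mono) auto
    finally show ?thesis by (simp add: mult.commute)
  qed
  have "herz_partial_norm p \<alpha> q (i # is) (\<lambda>x::real^'n. \<Prod>j\<in>set (i # is). ennreal (decay L (x $ j))) x
     \<le> herz_partial_norm p \<alpha> q is (\<lambda>x. c * f x) x"
    unfolding herz_partial_norm_Cons by (rule herz_partial_norm_mono[OF slice_norm_measurable[OF F] s])
  also have "\<dots> = c * herz_partial_norm p \<alpha> q is f x"
    by (rule herz_partial_norm_cmult[OF p q f c])
  also have "\<dots> < \<infinity>"
    using Cons.IH[of x] Cons.prems c by (simp add: f_def[abs_def] ennreal_mult_less_top less_top)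
  finally show ?case .
qed simp

text \<open>Decay of order l n in n dimensions is distributed as order l in each coordinate. The
  product majorant lets the norms be taken factor by factor. Since all \<alpha> + 1/p are positive,
  the sum in the definition of l dominates each of them.\<close>

lemma herz_mixed_norm_rapid_decay_finite:
  fixes p q :: "ennreal^'n::{finite,linorder}" and \<alpha> :: "real^'n::{finite,linorder}"
    and f :: "real^'n::{finite,linorder} \<Rightarrow> complex"
  assumes p: "\<And>i. 0 < p $ i" and q: "\<And>i. 0 < q $ i" and a: "\<And>i. 0 < \<alpha> $ i + recip (p $ i)"
    and f[measurable]: "f \<in> borel_measurable borel"
    and dec: "\<And>N. \<exists>C. \<forall>x. norm (f x) \<le> C / (1 + norm x) ^ N"
  shows "herz_mixed_norm p \<alpha> q f < \<infinity>"
proof -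
  define l where "l = nat \<lceil>\<Sum>i\<in>UNIV. 2 * (\<alpha> $ i + recip (p $ i))\<rceil>"
  have l: "2 * (\<alpha> $ i + recip (p $ i)) \<le> real l" for i
  proof -
    have "2 * (\<alpha> $ i + recip (p $ i)) \<le> (\<Sum>i\<in>UNIV. 2 * (\<alpha> $ i + recip (p $ i)))"
    proof (rule member_le_sum)
      fix j
      show "0 \<le> 2 * (\<alpha> $ j + recip (p $ j))" using a[of j] by simp
    qed simp_all
    also have "\<dots> \<le> real l" unfolding l_def by linarith
    finally show ?thesis .
  qed
  obtain C where C: "\<And>x. norm (f x) \<le> C / (1 + norm x) ^ (l * CARD('n))" using dec by blast
  define D where "D = max C 1"
  have le: "ennreal (norm (f x)) \<le> ennreal D * (\<Prod>i\<in>UNIV. ennreal (decay (real l) (x $ i)))" for x :: "real^'n::{finite,linorder}"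
  proof -
    have "norm (f x) \<le> D / (1 + norm x) ^ (l * CARD('n))"
      by (rule order_trans[OF C]) (auto intro!: divide_right_mono simp: D_def)
    also have "\<dots> = D * (\<Prod>i\<in>(UNIV::'n set). 1 / (1 + norm x) ^ l)"
      by (simp add: power_mult power_one_over)
    also have "\<dots> \<le> D * (\<Prod>i\<in>UNIV. decay (real l) (x $ i))"
    proof (intro mult_left_mono prod_mono conjI)
      fix i
      have "1 / (1 + norm x) ^ l \<le> 1 / (1 + \<bar>x $ i\<bar>) ^ l"
        using component_le_norm_cart[of x i] by (intro divide_left_mono power_mono) (auto intro!: mult_pos_pos zero_less_power add_pos_nonneg)
      also have "\<dots> = decay (real l) (x $ i)"
        by (simp add: decay_def powr_minus powr_realpow add_pos_nonneg divide_inverse)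
      finally show "1 / (1 + norm x) ^ l \<le> decay (real l) (x $ i)" .
    qed (auto simp: D_def)
    finally show ?thesis
      by (simp add: prod_ennreal less_imp_le[OF decay_pos] ennreal_mult[symmetric] D_def prod_nonneg ennreal_leI)
  qed
  define g where "g x = (\<Prod>i\<in>UNIV. ennreal (decay (real l) (x $ i)))" for x :: "real^'n::{finite,linorder}"
  have g: "g \<in> borel_measurable borel"
    unfolding g_def cart_eq_inner_axis by measurable
  have "herz_mixed_norm p \<alpha> q f \<le> herz_partial_norm p \<alpha> q (sorted_list_of_set UNIV) (\<lambda>x. ennreal D * g x) 0"
    unfolding herz_mixed_norm_def using le by (intro herz_partial_norm_mono) (auto simp: g_def)
  also have "\<dots> = ennreal D * herz_partial_norm p \<alpha> q (sorted_list_of_set UNIV) g 0"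
    by (rule herz_partial_norm_cmult[OF p q g]) (auto simp: D_def ennreal_eq_0_iff)
  also have "\<dots> < \<infinity>"
    using herz_partial_norm_decay_finite[OF p q herz_norm_decay_finite[OF p q a l], of "sorted_list_of_set UNIV" 0]
    by (simp add: g_def[abs_def] ennreal_mult_less_top)
  finally show ?thesis .
qed

text \<open>Reflection and conjugation turn the transform into its conjugate. The convolution with
  \<open>\<phi>\<close> then has the value \<integral> |\<phi>|^2 at 0, which makes the central
  block visibly non-zero.\<close>

definition test_fun :: "(real^'n \<Rightarrow> complex) \<Rightarrow> real^'n::finite \<Rightarrow> complex"
  where "test_fun \<phi> y = cnj (\<phi> (- y))"

definition test_dist :: "(real^'n \<Rightarrow> complex) \<Rightarrow> (real^'n::finite \<Rightarrow> complex) \<Rightarrow> complex"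
  where "test_dist \<phi> = restrict (\<lambda>\<psi>. LINT y|lborel. test_fun \<phi> y * \<psi> y) schwartz"

text \<open>For c > 0 this is the convolution of \<open>\<psi>\<close> with the dilate of
  \<open>test_fun \<phi>\<close> by c that preserves the integral; placing c at the variable of
  integration avoids the Jacobian.\<close>

definition block :: "(real^'n \<Rightarrow> complex) \<Rightarrow> (real^'n \<Rightarrow> complex) \<Rightarrow> real \<Rightarrow> real^'n::finite \<Rightarrow> complex"
  where "block \<phi> \<psi> c x = (LINT y|lborel. test_fun \<phi> y * \<psi> (x - c *\<^sub>R y))"

lemma test_fun_schwartz_decay:
  fixes \<phi> :: "real^'n::finite \<Rightarrow> complex"
  assumes "\<phi> \<in> schwartz"
  obtains C where "0 \<le> C" "\<And>y. norm (test_fun \<phi> y) \<le> C / (1 + norm y) ^ N"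
proof -
  obtain C where "0 \<le> C" "\<And>x. norm (\<phi> x) \<le> C / (1 + norm x) ^ N"
    by (rule schwartz_decay[OF assms]) blast
  then show thesis using that by (metis complex_mod_cnj norm_minus_cancel test_fun_def)
qed

lemma test_fun_measurable:
  fixes \<phi> :: "real^'n::finite \<Rightarrow> complex"
  assumes "\<phi> \<in> schwartz"
  shows "test_fun \<phi> \<in> borel_measurable borel"
proof -
  have "continuous_on UNIV (\<lambda>y. cnj (\<phi> (- y)))"
    by (intro continuous_intros continuous_on_compose2[OF schwartz_continuous[OF assms]]) auto
  then show ?thesis unfolding test_fun_def[abs_def] by (rule borel_measurable_continuous_onI)
qed

lemma test_fun_integrable:
  fixes \<phi> :: "real^'n::finite \<Rightarrow> complex"
  assumes "\<phi> \<in> schwartz"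
  shows "integrable lborel (test_fun \<phi>)"
proof -
  have "integrable lborel (\<lambda>x. \<phi> (0 + (-1) *\<^sub>R x))"
    using integrable_lborel_affine[of "-1" \<phi> 0] schwartz_integrable[OF assms] schwartz_measurable[OF assms] by simp
  then show ?thesis
    by (rule Bochner_Integration.integrable_bound)
       (use test_fun_measurable[OF assms] in \<open>auto simp: test_fun_def\<close>)
qed

lemma integrable_test_fun_mult:
  fixes \<phi> :: "real^'n::finite \<Rightarrow> complex"
  assumes \<phi>: "\<phi> \<in> schwartz" and \<psi>: "\<psi> \<in> borel_measurable borel" "\<And>x. norm (\<psi> x) \<le> B"
  shows "integrable lborel (\<lambda>y. test_fun \<phi> y * \<psi> y)"
proof (rule Bochner_Integration.integrable_bound)
  show "integrable lborel (\<lambda>y. B * norm (test_fun \<phi> y))"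
    by (intro integrable_mult_right integrable_norm test_fun_integrable \<phi>)
  show "(\<lambda>y. test_fun \<phi> y * \<psi> y) \<in> borel_measurable lborel"
    using test_fun_measurable[OF \<phi>] \<psi>(1) by simp
  have "0 \<le> B" using order_trans[OF norm_ge_zero \<psi>(2)] .
  then show "AE y in lborel. norm (test_fun \<phi> y * \<psi> y) \<le> norm (B * norm (test_fun \<phi> y))"
    using mult_left_mono[OF \<psi>(2) norm_ge_zero] by (intro AE_I2) (simp add: norm_mult abs_mult mult.commute[of B])
qed

lemma test_dist_tempered:
  fixes \<phi> :: "real^'n::finite \<Rightarrow> complex"
  assumes \<phi>: "\<phi> \<in> schwartz"
  shows "test_dist \<phi> \<in> tempered_distributions"
proof -
  have int: "integrable lborel (\<lambda>y. test_fun \<phi> y * \<psi> y)" if "\<psi> \<in> schwartz" for \<psi>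
    by (rule schwartz_bounded[OF that], rule integrable_test_fun_mult[OF \<phi> schwartz_measurable[OF that]])
  have bound: "norm (LINT y|lborel. test_fun \<phi> y * \<psi> y) \<le> (LINT y|lborel. norm (test_fun \<phi> y)) * schwartz_seminorm 0 \<psi>"
    if \<psi>: "\<psi> \<in> schwartz" for \<psi>
  proof -
    have "norm (LINT y|lborel. test_fun \<phi> y * \<psi> y) \<le> (LINT y|lborel. norm (test_fun \<phi> y * \<psi> y))"
      by (rule integral_norm_bound)
    also have "\<dots> \<le> (LINT y|lborel. norm (test_fun \<phi> y) * schwartz_seminorm 0 \<psi>)"
    proof (rule integral_mono)
      show "norm (test_fun \<phi> y * \<psi> y) \<le> norm (test_fun \<phi> y) * schwartz_seminorm 0 \<psi>" for y
        using le_schwartz_seminorm[OF \<psi>, of "[]" 0 y] by (simp add: norm_mult mult_left_mono)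
    qed (use int[OF \<psi>] test_fun_integrable[OF \<phi>] in \<open>auto intro: integrable_norm\<close>)
    finally show ?thesis by simp
  qed
  have add: "(LINT y|lborel. test_fun \<phi> y * (\<psi> y + \<eta> y)) = (LINT y|lborel. test_fun \<phi> y * \<psi> y) + (LINT y|lborel. test_fun \<phi> y * \<eta> y)"
    if "\<psi> \<in> schwartz" "\<eta> \<in> schwartz" for \<psi> \<eta>
    unfolding distrib_left by (rule Bochner_Integration.integral_add[OF int int]) (fact that)+
  have mult: "(LINT y|lborel. test_fun \<phi> y * (c * \<psi> y)) = c * (LINT y|lborel. test_fun \<phi> y * \<psi> y)" for \<psi> c
    unfolding mult.left_commute[of _ c] by (rule integral_mult_right_zero)
  show ?thesis
    unfolding tempered_distributions_def test_dist_def
  proof (intro CollectI conjI ballI allI exI)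
    show "norm (restrict (\<lambda>\<psi>. LINT y|lborel. test_fun \<phi> y * \<psi> y) schwartz \<psi>) \<le> (LINT y|lborel. norm (test_fun \<phi> y)) * schwartz_seminorm 0 \<psi>"
      if "\<psi> \<in> schwartz" for \<psi>
      using bound[OF that] that by simp
  qed (simp_all add: schwartz_add schwartz_cmult add mult)
qed

lemma conv_test_dist:
  fixes \<phi> :: "real^'n::finite \<Rightarrow> complex"
  assumes \<psi>: "\<psi> \<in> schwartz" and c: "c \<noteq> 0"
  shows "conv \<psi> (dilate 1 c (test_dist \<phi>)) x = block \<phi> \<psi> c x"
proof -
  have 1: "(\<lambda>y. \<psi> (x - y)) \<in> schwartz"
    using schwartz_affine[OF \<psi>, of "-1" x] by simp
  have 2: "(\<lambda>y. \<psi> (x - c *\<^sub>R y)) \<in> schwartz"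
    using schwartz_affine[OF \<psi>, of "-c" x] c by simp
  show ?thesis using 1 2 by (simp add: conv_def dilate_def test_dist_def block_def)
qed

lemma fourier_test_fun:
  fixes \<phi> :: "real^'n::finite \<Rightarrow> complex"
  assumes \<phi>: "\<phi> \<in> schwartz"
  shows "fourier (test_fun \<phi>) \<eta> = cnj (fourier \<phi> \<eta>)"
proof -
  have m: "(\<lambda>y. cis (- (y \<bullet> \<eta>)) * \<phi> y) \<in> borel_measurable borel"
    using schwartz_measurable[OF \<phi>] by measurable
  have "fourier \<phi> \<eta> = \<bar>-1\<bar> ^ CARD('n) *\<^sub>R (LINT y|lborel. cis (- ((0 + (-1) *\<^sub>R y) \<bullet> \<eta>)) * \<phi> (0 + (-1) *\<^sub>R y))"
    unfolding fourier_def by (rule integral_lborel_affine[OF _ m]) simp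
  then have "cnj (fourier \<phi> \<eta>) = cnj (LINT y|lborel. cis (y \<bullet> \<eta>) * \<phi> (- y))"
    by simp
  also have "\<dots> = (LINT y|lborel. cnj (cis (y \<bullet> \<eta>) * \<phi> (- y)))"
    by (rule Bochner_Integration.integral_cnj[symmetric])
  finally show ?thesis by (simp add: fourier_def test_fun_def cis_cnj)
qed

text \<open>By Fourier inversion this convolution has the transform \<open>\<psi>\<^sup>(\<xi>) F(c \<xi>)\<close>, where \<open>F\<close> is the conjugate of
  the transform of \<open>\<phi>\<close>.\<close>

lemma block_eq_0:
  fixes \<phi> \<psi> :: "real^'n::finite \<Rightarrow> complex"
  assumes \<phi>: "\<phi> \<in> schwartz" and \<psi>: "bandlimited \<psi>"
    and 0: "\<And>\<xi>. fourier \<psi> \<xi> = 0 \<or> fourier \<phi> (c *\<^sub>R \<xi>) = 0"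
  shows "block \<phi> \<psi> c x = 0"
proof -
  define k where "k = complex_of_real ((2 * pi) ^ CARD('n))"
  note [measurable] = test_fun_measurable[OF \<phi>]
  have iF: "integrable lborel (fourier \<psi>)" by (rule bandlimited_fourier_integrable[OF \<psi>])
  have [measurable]: "fourier \<psi> \<in> borel_measurable borel"
    using borel_measurable_integrable[OF iF] by simp
  have pint: "integrable (lborel \<Otimes>\<^sub>M lborel) (\<lambda>(y, \<xi>). test_fun \<phi> y * (fourier \<psi> \<xi> * cis ((x - c *\<^sub>R y) \<bullet> \<xi>)))"
  proof (rule lborel_pair.Fubini_integrable)
    show "integrable lborel (\<lambda>y. LINT \<xi>|lborel. norm (case (y, \<xi>) of (y, \<xi>) \<Rightarrow> test_fun \<phi> y * (fourier \<psi> \<xi> * cis ((x - c *\<^sub>R y) \<bullet> \<xi>))))"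
      using test_fun_integrable[OF \<phi>] by (simp add: norm_mult)
    show "AE y in lborel. integrable lborel (\<lambda>\<xi>. case (y, \<xi>) of (y, \<xi>) \<Rightarrow> test_fun \<phi> y * (fourier \<psi> \<xi> * cis ((x - c *\<^sub>R y) \<bullet> \<xi>)))"
    proof (rule AE_I2, simp only: prod.case)
      fix y
      have "integrable lborel (\<lambda>\<xi>. fourier \<psi> \<xi> * cis ((x - c *\<^sub>R y) \<bullet> \<xi>))"
      proof (rule Bochner_Integration.integrable_bound[OF iF])
        show "(\<lambda>\<xi>. fourier \<psi> \<xi> * cis ((x - c *\<^sub>R y) \<bullet> \<xi>)) \<in> borel_measurable lborel" by measurable
      qed simp
      then show "integrable lborel (\<lambda>\<xi>. test_fun \<phi> y * (fourier \<psi> \<xi> * cis ((x - c *\<^sub>R y) \<bullet> \<xi>)))"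
        by (rule integrable_mult_right)
    qed
  qed measurable
  have "k * block \<phi> \<psi> c x = (LINT y|lborel. k * (test_fun \<phi> y * \<psi> (x - c *\<^sub>R y)))"
    unfolding block_def by simp
  also have "\<dots> = (LINT y|lborel. LINT \<xi>|lborel. test_fun \<phi> y * (fourier \<psi> \<xi> * cis ((x - c *\<^sub>R y) \<bullet> \<xi>)))"
  proof (rule Bochner_Integration.integral_cong[OF refl])
    fix y
    have "k * (test_fun \<phi> y * \<psi> (x - c *\<^sub>R y)) = test_fun \<phi> y * (k * \<psi> (x - c *\<^sub>R y))" by (rule mult.left_commute)
    also have "k * \<psi> (x - c *\<^sub>R y) = (LINT \<xi>|lborel. fourier \<psi> \<xi> * cis ((x - c *\<^sub>R y) \<bullet> \<xi>))"
      unfolding k_def by (rule bandlimited_inversion[OF \<psi>])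
    finally show "k * (test_fun \<phi> y * \<psi> (x - c *\<^sub>R y)) = (LINT \<xi>|lborel. test_fun \<phi> y * (fourier \<psi> \<xi> * cis ((x - c *\<^sub>R y) \<bullet> \<xi>)))"
      by simp
  qed
  also have "\<dots> = (LINT \<xi>|lborel. LINT y|lborel. test_fun \<phi> y * (fourier \<psi> \<xi> * cis ((x - c *\<^sub>R y) \<bullet> \<xi>)))"
    by (rule lborel_pair.Fubini_integral[OF pint, symmetric])
  also have "\<dots> = (LINT \<xi>|(lborel::(real^'n) measure). (0::complex))"
  proof (rule Bochner_Integration.integral_cong[OF refl])
    fix \<xi> :: "real^'n"
    have c: "cis ((x - c *\<^sub>R y) \<bullet> \<xi>) = cis (x \<bullet> \<xi>) * cis (- (y \<bullet> c *\<^sub>R \<xi>))" for y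
      by (simp add: cis_mult inner_diff_left)
    have "(LINT y|lborel. test_fun \<phi> y * (fourier \<psi> \<xi> * cis ((x - c *\<^sub>R y) \<bullet> \<xi>)))
      = (LINT y|lborel. (fourier \<psi> \<xi> * cis (x \<bullet> \<xi>)) * (cis (- (y \<bullet> c *\<^sub>R \<xi>)) * test_fun \<phi> y))"
      by (simp only: c mult_ac)
    also have "\<dots> = (fourier \<psi> \<xi> * cis (x \<bullet> \<xi>)) * (LINT y|lborel. cis (- (y \<bullet> c *\<^sub>R \<xi>)) * test_fun \<phi> y)"
      by (rule integral_mult_right_zero)
    also have "\<dots> = (fourier \<psi> \<xi> * cis (x \<bullet> \<xi>)) * cnj (fourier \<phi> (c *\<^sub>R \<xi>))"
      using fourier_test_fun[OF \<phi>, of "c *\<^sub>R \<xi>"] by (simp only: fourier_def)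
    also have "\<dots> = 0" using 0[of \<xi>] by auto
    finally show "(LINT y|lborel. test_fun \<phi> y * (fourier \<psi> \<xi> * cis ((x - c *\<^sub>R y) \<bullet> \<xi>))) = 0" .
  qed
  finally show ?thesis by (simp add: k_def)
qed

lemma block_measurable:
  fixes \<phi> \<psi> :: "real^'n::finite \<Rightarrow> complex"
  assumes "\<phi> \<in> schwartz" "\<psi> \<in> schwartz"
  shows "block \<phi> \<psi> c \<in> borel_measurable borel"
proof -
  note [measurable] = test_fun_measurable[OF assms(1)] schwartz_measurable[OF assms(2)]
  show ?thesis
    unfolding block_def[abs_def] by (rule lborel.borel_measurable_lebesgue_integral) measurable
qed

text \<open>Of the decay of order N + 2 n of the test function, N orders are spent in Peetre's
  inequality to move the weight from x - y to x, and 2 n orders keep the integral finite.\<close>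

lemma block_decay:
  fixes \<phi> \<psi> :: "real^'n::finite \<Rightarrow> complex"
  assumes \<phi>: "\<phi> \<in> schwartz" and \<psi>: "\<psi> \<in> schwartz"
  shows "\<exists>C. \<forall>x. norm (block \<phi> \<psi> 1 x) \<le> C / (1 + norm x) ^ N"
proof -
  let ?n = "2 * CARD('n)"
  obtain C where C: "0 \<le> C" "\<And>x. norm (\<psi> x) \<le> C / (1 + norm x) ^ N"
    by (rule schwartz_decay[OF \<psi>]) blast
  obtain D where D: "0 \<le> D" "\<And>y. norm (test_fun \<phi> y) \<le> D / (1 + norm y) ^ (N + ?n)"
    by (rule test_fun_schwartz_decay[OF \<phi>]) blast
  have pos: "0 < (1 + norm x) ^ m" for x :: "real^'n" and m
    by (intro zero_less_power add_pos_nonneg) auto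
  have le: "norm (test_fun \<phi> y * \<psi> (x - 1 *\<^sub>R y)) \<le> (C * D / (1 + norm x) ^ N) * (1 / (1 + norm y) ^ ?n)" for x y
  proof -
    have "1 + norm x \<le> (1 + norm y) * (1 + norm (x - y))"
      using weight_split[of x "-y"] weight_split[where y=y and z=x] by (simp add: norm_minus_commute)
    then have "(1 + norm x) ^ N \<le> (1 + norm y) ^ N * (1 + norm (x - y)) ^ N"
      unfolding power_mult_distrib[symmetric] by (intro power_mono) auto
    then have 1: "1 / ((1 + norm y) ^ N * (1 + norm (x - y)) ^ N) \<le> 1 / (1 + norm x) ^ N"
      using pos by (intro divide_left_mono mult_pos_pos) auto
    have "norm (test_fun \<phi> y * \<psi> (x - 1 *\<^sub>R y)) \<le> (D / (1 + norm y) ^ (N + ?n)) * (C / (1 + norm (x - y)) ^ N)"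
      unfolding norm_mult scaleR_one using D C by (intro mult_mono) auto
    also have "\<dots> = (C * D / (1 + norm y) ^ ?n) * (1 / ((1 + norm y) ^ N * (1 + norm (x - y)) ^ N))"
      by (simp add: power_add mult_ac)
    also have "\<dots> \<le> (C * D / (1 + norm y) ^ ?n) * (1 / (1 + norm x) ^ N)"
      using C D by (intro mult_left_mono 1) auto
    finally show ?thesis by (simp add: mult_ac)
  qed
  define J where "J = (LINT y|lborel. 1 / (1 + norm (y::real^'n)) ^ ?n)"
  have "norm (block \<phi> \<psi> 1 x) \<le> (C * D * J) / (1 + norm x) ^ N" for x
  proof -
    have i: "integrable lborel (\<lambda>y. (C * D / (1 + norm x) ^ N) * (1 / (1 + norm (y::real^'n)) ^ ?n))"
      by (intro integrable_mult_right integrable_decay_vec)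
    have "norm (block \<phi> \<psi> 1 x) \<le> (LINT y|lborel. (C * D / (1 + norm x) ^ N) * (1 / (1 + norm (y::real^'n)) ^ ?n))"
    proof -
      have "norm (block \<phi> \<psi> 1 x) \<le> (LINT y|lborel. norm (test_fun \<phi> y * \<psi> (x - 1 *\<^sub>R y)))"
        unfolding block_def by (rule integral_norm_bound)
      also have "\<dots> \<le> (LINT y|lborel. (C * D / (1 + norm x) ^ N) * (1 / (1 + norm (y::real^'n)) ^ ?n))"
        by (rule integral_mono'[OF i le]) (use C D in simp)
      finally show ?thesis .
    qed
    also have "\<dots> = (C * D / (1 + norm x) ^ N) * J" unfolding J_def by (rule integral_mult_right_zero)
    finally show ?thesis by simp
  qed
  then show ?thesis by blast
qed

lemma block_scale:
  "block \<phi> (\<lambda>x. \<psi> (c *\<^sub>R x)) 1 x = block \<phi> \<psi> c (c *\<^sub>R x)"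
  by (simp add: block_def scaleR_diff_right)

text \<open>If the integral of |\<phi>|^2, the value at 0, vanished, then \<open>\<phi>\<close>
  would be 0 almost everywhere and so would be its transform everywhere. Continuity, by dominated
  convergence, spreads the lower bound to a ball.\<close>

lemma block_near_0:
  fixes \<phi> :: "real^'n::finite \<Rightarrow> complex"
  assumes \<phi>: "\<phi> \<in> schwartz" and nz: "fourier \<phi> \<xi>0 \<noteq> 0"
  obtains c d where "0 < c" "0 < d" "\<And>x. norm x < d \<Longrightarrow> c \<le> norm (block \<phi> \<phi> 1 x)"
proof -
  obtain B where B: "\<And>x. norm (\<phi> x) \<le> B" by (rule schwartz_bounded[OF \<phi>]) blast
  note [measurable] = test_fun_measurable[OF \<phi>] schwartz_measurable[OF \<phi>]
  have int: "integrable lborel (\<lambda>y. test_fun \<phi> y * \<phi> (- y))"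
  proof (rule integrable_test_fun_mult[OF \<phi>])
    show "(\<lambda>y. \<phi> (- y)) \<in> borel_measurable borel" by measurable
  qed (rule B)
  have sq: "test_fun \<phi> y * \<phi> (- y) = of_real ((norm (\<phi> (- y)))^2)" for y
    unfolding test_fun_def by (subst complex_norm_square) (rule mult.commute)
  have b0: "block \<phi> \<phi> 1 0 = of_real (LINT y|lborel. (norm (\<phi> (- y)))^2)"
    by (simp only: block_def scaleR_one diff_0 sq integral_complex_of_real)
  have ir: "integrable lborel (\<lambda>y. (norm (\<phi> (- y)))^2)"
    using integrable_Re[OF int] unfolding sq by simp
  have "(LINT y|lborel. (norm (\<phi> (- y)))^2) \<noteq> 0"
  proof
    assume "(LINT y|lborel. (norm (\<phi> (- y)))^2) = 0"
    then have "AE y in lborel. (norm (\<phi> (- y)))^2 = 0"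
      using integral_nonneg_eq_0_iff_AE[OF ir] by simp
    then have ae: "AE y in lborel. cis (- (y \<bullet> \<xi>0)) * test_fun \<phi> y = 0"
      by eventually_elim (simp add: test_fun_def)
    have "fourier (test_fun \<phi>) \<xi>0 = 0"
      unfolding fourier_def by (rule integral_eq_zero_AE[OF ae])
    then show False using nz fourier_test_fun[OF \<phi>] by simp
  qed
  then have nz0: "0 < norm (block \<phi> \<phi> 1 0)" unfolding b0 norm_of_real by (simp only: zero_less_abs_iff not_False_eq_True)
  have "isCont (block \<phi> \<phi> 1) 0"
    unfolding continuous_at_sequentially o_def
  proof (intro allI impI)
    fix u :: "nat \<Rightarrow> real^'n" assume u: "u \<longlonglongrightarrow> 0"
    show "(\<lambda>n. block \<phi> \<phi> 1 (u n)) \<longlonglongrightarrow> block \<phi> \<phi> 1 0"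
      unfolding block_def
    proof (rule integral_dominated_convergence[where w="\<lambda>y. B * norm (test_fun \<phi> y)"])
      show "integrable lborel (\<lambda>y. B * norm (test_fun \<phi> y))"
        by (intro integrable_mult_right integrable_norm test_fun_integrable \<phi>)
      show "AE y in lborel. (\<lambda>n. test_fun \<phi> y * \<phi> (u n - 1 *\<^sub>R y)) \<longlonglongrightarrow> test_fun \<phi> y * \<phi> (0 - 1 *\<^sub>R y)"
      proof (rule AE_I2, rule tendsto_mult[OF tendsto_const])
        fix y
        have "(\<lambda>n. u n - 1 *\<^sub>R y) \<longlonglongrightarrow> 0 - 1 *\<^sub>R y" by (intro tendsto_intros u)
        then show "(\<lambda>n. \<phi> (u n - 1 *\<^sub>R y)) \<longlonglongrightarrow> \<phi> (0 - 1 *\<^sub>R y)"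
          by (rule continuous_on_tendsto_compose[OF schwartz_continuous[OF \<phi>]]) auto
      qed
      show "AE y in lborel. norm (test_fun \<phi> y * \<phi> (u n - 1 *\<^sub>R y)) \<le> B * norm (test_fun \<phi> y)" for n
        using mult_left_mono[OF B norm_ge_zero] by (intro AE_I2) (simp add: norm_mult mult.commute[of B])
    qed measurable
  qed
  then have "isCont (\<lambda>x. norm (block \<phi> \<phi> 1 x)) 0" by (intro continuous_intros)
  then obtain d where d: "0 < d" "\<And>x. dist x 0 < d \<Longrightarrow> dist (norm (block \<phi> \<phi> 1 x)) (norm (block \<phi> \<phi> 1 0)) < norm (block \<phi> \<phi> 1 0) / 2"
    unfolding continuous_at_eps_delta using nz0 half_gt_zero by metis
  show thesis
  proof (rule that[of "norm (block \<phi> \<phi> 1 0) / 2" d])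
    fix x :: "real^'n" assume "norm x < d"
    then have "dist (norm (block \<phi> \<phi> 1 x)) (norm (block \<phi> \<phi> 1 0)) < norm (block \<phi> \<phi> 1 0) / 2"
      by (intro d) simp
    then show "norm (block \<phi> \<phi> 1 0) / 2 \<le> norm (block \<phi> \<phi> 1 x)"
      unfolding dist_real_def by linarith
  qed (use d nz0 in auto)
qed

text \<open>A product of annuli close to the origin lies in the ball of radius d: each coordinate is
  at most 2^(-m), and m is chosen with n 2^(-m) < d.\<close>

lemma herz_mixed_norm_pos:
  fixes p q :: "ennreal^'n::{finite,linorder}" and \<alpha> :: "real^'n::{finite,linorder}"
    and f :: "real^'n::{finite,linorder} \<Rightarrow> complex"
  assumes p: "\<And>i. 0 < p $ i" and q: "\<And>i. 0 < q $ i"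
    and c: "0 < c" and d: "0 < d" "\<And>x. norm x < d \<Longrightarrow> c \<le> norm (f x)"
  shows "0 < herz_mixed_norm p \<alpha> q f"
proof -
  have "0 < d / real CARD('n)" using d by simp
  then obtain m where m: "(1 / 2) ^ m < d / real CARD('n)"
    using real_arch_pow_inv[of "d / real CARD('n)" "1/2"] by auto
  define k where "k = - int m"
  have k: "2 powi k = (1 / 2 :: real) ^ m"
    by (simp add: k_def power_int_minus power_one_over inverse_eq_divide)
  have h: "ennreal c \<le> ennreal (norm (f x))" if x: "\<And>j. j \<in> UNIV \<Longrightarrow> x $ j \<in> annulus k" for x :: "real^'n::{finite,linorder}"
  proof -
    have "norm x \<le> (\<Sum>i\<in>UNIV. \<bar>x $ i\<bar>)" by (rule norm_le_l1_cart)
    also have "\<dots> \<le> (\<Sum>i\<in>(UNIV::'n set). (1 / 2) ^ m)"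
      using x by (intro sum_mono) (auto simp: annulus_def k intro: less_imp_le)
    also have "\<dots> < d" using m by (simp add: less_divide_eq mult.commute)
    finally show ?thesis by (intro ennreal_leI d)
  qed
  have "0 < ennreal c" using c by simp
  then have "\<exists>c'>0. \<forall>x::real^'n::{finite,linorder}. (\<forall>j\<in>UNIV - set (sorted_list_of_set UNIV). x $ j \<in> annulus k) \<longrightarrow>
      c' \<le> herz_partial_norm p \<alpha> q (sorted_list_of_set UNIV) (\<lambda>x. ennreal (norm (f x))) x"
    by (rule herz_partial_norm_pos[OF p q _ h])
  then obtain c' where "0 < c'" "\<And>x. c' \<le> herz_partial_norm p \<alpha> q (sorted_list_of_set UNIV) (\<lambda>x. ennreal (norm (f x))) x"
    by auto
  then show ?thesis unfolding herz_mixed_norm_def by (meson less_le_trans)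
qed

lemma eLp_count_indicator_le:
  assumes "finite S" "0 < q"
  shows "eLp (count_space UNIV) q (\<lambda>k. A * indicator S k) \<le> A * ennreal (real (card S) powr recip q)"
  using assms(2)
proof (cases rule: exponent_cases)
  case 1
  show ?thesis
  proof (cases "S = {}")
    case False
    then have "1 \<le> real (card S) powr 0" using assms(1) by simp
    then have "A * 1 \<le> A * ennreal (real (card S) powr recip q)" using 1 False assms(1) by simp
    then show ?thesis using 1
      by (subst 1, subst eLp_infinity_le_iff) (auto simp: indicator_def)
  qed simp
next
  case (2 r)
  have "epow (A * indicator S k) r = epow A r * indicator S k" for k
    by (auto simp: indicator_def)
  then have "eLp (count_space UNIV) q (\<lambda>k. A * indicator S k) = epow (epow A r * ennreal (real (card S))) (1 / r)"
    using 2 assms(1) by (simp add: eLp_def nn_integral_cmult ennreal_of_nat_eq_real_of_nat)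
  also have "\<dots> = A * ennreal (real (card S) powr recip q)"
    using 2 by (simp add: epow_mult epow_epow epow_ennreal)
  finally show ?thesis by simp
qed

lemma admissible_support:
  assumes "admissible \<Phi> \<phi>"
  shows "fourier \<Phi> \<xi> \<noteq> 0 \<Longrightarrow> norm \<xi> \<le> 2"
    "fourier \<phi> \<xi> \<noteq> 0 \<Longrightarrow> 1/2 \<le> norm \<xi>" "fourier \<phi> \<xi> \<noteq> 0 \<Longrightarrow> norm \<xi> \<le> 2"
proof -
  have "\<xi> \<in> S" if "supp (fourier g) \<subseteq> S" "fourier g \<xi> \<noteq> 0" for g :: "real^'a \<Rightarrow> complex" and S \<xi>
    using that closure_subset[of "{\<xi>. fourier g \<xi> \<noteq> 0}"] by (auto simp: supp_def)
  then show "fourier \<Phi> \<xi> \<noteq> 0 \<Longrightarrow> norm \<xi> \<le> 2"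
    "fourier \<phi> \<xi> \<noteq> 0 \<Longrightarrow> 1/2 \<le> norm \<xi>" "fourier \<phi> \<xi> \<noteq> 0 \<Longrightarrow> norm \<xi> \<le> 2"
    using assms unfolding admissible_def by fastforce+
qed

lemma admissible_fourier_nonzero:
  fixes \<phi> :: "real^'n::finite \<Rightarrow> complex"
  assumes "admissible \<Phi> \<phi>"
  obtains \<xi> where "fourier \<phi> \<xi> \<noteq> 0"
proof -
  obtain c where c: "0 < c" "\<And>\<xi>. 3/5 \<le> norm \<xi> \<Longrightarrow> norm \<xi> \<le> 5/3 \<Longrightarrow> c \<le> norm (fourier \<phi> \<xi>)"
    using assms unfolding admissible_def by blast
  obtain \<xi> :: "real^'n" where \<xi>: "norm \<xi> = 1" using vector_choose_size[of 1] by auto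
  have "c \<le> norm (fourier \<phi> \<xi>)" by (rule c(2)) (simp_all add: \<xi>)
  then have "fourier \<phi> \<xi> \<noteq> 0" using c(1) by auto
  then show thesis by (rule that)
qed

text \<open>The test distributions are the dilates, by \<open>2\<^sup>j\<close>, of one function with spectrum in the annulus of
  \<open>\<phi>\<close>: only the five blocks next to the \<open>j\<close>-th one do not vanish, and they scale exactly.\<close>

theorem besov_embedding_necessary:
  fixes \<Phi> \<phi> :: "real^'n::{finite,linorder} \<Rightarrow> complex"
    and p q r \<theta> :: "ennreal^'n::{finite,linorder}" and \<alpha>1 \<alpha>2 :: "real^'n::{finite,linorder}"
  assumes adm: "admissible \<Phi> \<phi>"
    and pq: "\<And>i. 0 < q $ i" "\<And>i. q $ i \<le> p $ i" and r: "\<And>i. 0 < r $ i" and \<theta>: "\<And>i. 0 < \<theta> $ i"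
    and \<beta>: "0 < \<beta>"
    and \<alpha>: "\<And>i. - recip (p $ i) < \<alpha>1 $ i" "\<And>i. \<alpha>1 $ i \<le> \<alpha>2 $ i"
    and emb: "besov_embedding \<Phi> \<phi> q \<alpha>2 \<theta> s2 p \<alpha>1 r s1 \<beta>"
  shows "s1 - (\<Sum>i\<in>UNIV. recip (p $ i) + \<alpha>1 $ i) \<le> s2 - (\<Sum>i\<in>UNIV. recip (q $ i) + \<alpha>2 $ i)"
proof -
  have p: "0 < p $ i" for i using pq(1)[of i] pq(2)[of i] by (rule less_le_trans)
  define \<sigma>p where "\<sigma>p = (\<Sum>i\<in>UNIV. recip (p $ i) + \<alpha>1 $ i)"
  define \<sigma>q where "\<sigma>q = (\<Sum>i\<in>UNIV. recip (q $ i) + \<alpha>2 $ i)"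
  define n where "n = real CARD('n)"
  note bl = admissible_bandlimited[OF adm]
  have \<phi>: "\<phi> \<in> schwartz" using bl(2) by (simp add: bandlimited_def)
  have \<Phi>: "\<Phi> \<in> schwartz" using bl(1) by (simp add: bandlimited_def)
  define T where "T j = dilate 1 ((1/2) ^ j) (test_dist \<phi>)" for j :: nat
  have T: "T j \<in> tempered_distributions" for j
    unfolding T_def by (intro dilate_tempered test_dist_tempered \<phi>) simp
  \<comment> \<open>The block at the level d relative to the test distribution, rescaled to unit
    frequency. Up to dilations and powers of 2, all blocks of positive index of all T j are among
    the V d.\<close>
  define V where "V d = block \<phi> (\<lambda>z. \<phi> (2 powi d *\<^sub>R z)) 1" for d :: int
  have \<phi>d: "(\<lambda>z. \<phi> (2 powi d *\<^sub>R z)) \<in> schwartz" for d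
    using schwartz_scale[OF \<phi>, of "2 powi d" 1] by simp
  have Vm: "V d \<in> borel_measurable borel" for d
    unfolding V_def by (rule block_measurable[OF \<phi> \<phi>d])
  \<comment> \<open>For |d| = 2 the two closed annuli in frequency still touch, so vanishing is
    claimed only from |d| = 3 on.\<close>
  have V0: "V d x = 0" if d: "3 \<le> \<bar>d\<bar>" for d x
  proof -
    have "V d x = block \<phi> \<phi> (2 powi d) (2 powi d *\<^sub>R x)" unfolding V_def by (rule block_scale)
    also have "\<dots> = 0"
    proof (rule block_eq_0[OF \<phi> bl(2)])
      fix \<xi>
      show "fourier \<phi> \<xi> = 0 \<or> fourier \<phi> (2 powi d *\<^sub>R \<xi>) = 0"
      proof (rule ccontr)
        assume "\<not> (fourier \<phi> \<xi> = 0 \<or> fourier \<phi> (2 powi d *\<^sub>R \<xi>) = 0)"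
        then have a: "1/2 \<le> norm \<xi>" "norm \<xi> \<le> 2" "1/2 \<le> 2 powi d * norm \<xi>" "2 powi d * norm \<xi> \<le> 2"
          using admissible_support(2,3)[OF adm, of \<xi>] admissible_support(2,3)[OF adm, of "2 powi d *\<^sub>R \<xi>"] by auto
        show False
        proof (cases "0 \<le> d")
          case True
          then have "(2::real) powi 3 \<le> 2 powi d" using d by (intro power_int_increasing) auto
          then have "8 \<le> (2::real) powi d" by simp
          then have "8 * (1/2) \<le> 2 powi d * norm \<xi>" using a by (intro mult_mono) auto
          then show False using a by simp
        next
          case False
          then have "(2::real) powi d \<le> 2 powi (-3)" using d by (intro power_int_increasing) auto
          then have "(2::real) powi d \<le> 1/8" by (simp add: power_int_minus)
          then have "2 powi d * norm \<xi> \<le> 1/8 * 2" using a by (intro mult_mono) auto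
          then show False using a by simp
        qed
      qed
    qed
    finally show ?thesis .
  qed
  have conv_l: "conv (resolution \<Phi> \<phi> l) (T j) = (\<lambda>x. 2 ^ (l * CARD('n)) * V (int l - int j) (2 ^ j *\<^sub>R x))" if "l \<noteq> 0" for l j
  proof
    fix x :: "real^'n::{finite,linorder}"
    define \<psi> where "\<psi> = resolution \<Phi> \<phi> l"
    have \<psi>: "\<psi> = (\<lambda>x. 2 ^ (l * CARD('n)) * \<phi> (2 ^ l *\<^sub>R x))" using that by (simp add: \<psi>_def resolution_def)
    have \<psi>S: "\<psi> \<in> schwartz" unfolding \<psi> by (rule schwartz_scale[OF \<phi>]) simp
    have h: "(2::real) powi (int l - int j) * 2 ^ j = 2 ^ l" "(2::real) ^ l * (1/2) ^ j = 2 powi (int l - int j)"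
      by (simp_all add: power_int_diff power_one_over)
    have arg: "2 ^ l *\<^sub>R (x - (1/2) ^ j *\<^sub>R y) = 2 powi (int l - int j) *\<^sub>R (2 ^ j *\<^sub>R x - 1 *\<^sub>R y)" for y
      unfolding scaleR_diff_right scaleR_scaleR h mult_1_right ..
    have "conv \<psi> (T j) x = block \<phi> \<psi> ((1/2) ^ j) x"
      unfolding T_def by (rule conv_test_dist[OF \<psi>S]) simp
    also have "\<dots> = (LINT y|lborel. 2 ^ (l * CARD('n)) * (test_fun \<phi> y * \<phi> (2 powi (int l - int j) *\<^sub>R (2 ^ j *\<^sub>R x - 1 *\<^sub>R y))))"
      unfolding block_def \<psi> arg by (simp only: mult.left_commute)
    also have "\<dots> = 2 ^ (l * CARD('n)) * V (int l - int j) (2 ^ j *\<^sub>R x)"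
      unfolding V_def block_def by (rule integral_mult_right_zero)
    finally show "conv (resolution \<Phi> \<phi> l) (T j) x = 2 ^ (l * CARD('n)) * V (int l - int j) (2 ^ j *\<^sub>R x)"
      by (simp add: \<psi>_def)
  qed
  \<comment> \<open>The spectrum of T j starts at modulus 2^(j-1), which for j \<ge> 3 is beyond the
    ball of radius 2 that contains the spectrum of \<open>\<Phi>\<close>. The same condition keeps
    the levels j - 2, ..., j + 2 positive.\<close>
  have conv_0: "conv (resolution \<Phi> \<phi> 0) (T j) = (\<lambda>x. 0)" if j: "3 \<le> j" for j
  proof
    fix x
    have "conv \<Phi> (T j) x = block \<phi> \<Phi> ((1/2) ^ j) x"
      unfolding T_def by (rule conv_test_dist[OF \<Phi>]) simp
    also have "\<dots> = 0"
    proof (rule block_eq_0[OF \<phi> bl(1)])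
      fix \<xi>
      show "fourier \<Phi> \<xi> = 0 \<or> fourier \<phi> ((1/2) ^ j *\<^sub>R \<xi>) = 0"
      proof (rule ccontr)
        assume "\<not> (fourier \<Phi> \<xi> = 0 \<or> fourier \<phi> ((1/2) ^ j *\<^sub>R \<xi>) = 0)"
        then have a: "norm \<xi> \<le> 2" "1/2 \<le> (1/2) ^ j * norm \<xi>"
          using admissible_support(1)[OF adm, of \<xi>] admissible_support(2)[OF adm, of "(1/2) ^ j *\<^sub>R \<xi>"] by auto
        have "(1/2 :: real) ^ j \<le> (1/2) ^ 3" using j by (intro power_decreasing) auto
        then have "(1/2) ^ j * norm \<xi> \<le> (1/2) ^ 3 * 2" using a by (intro mult_mono) auto
        then show False using a by (simp add: power3_eq_cube)
      qed
    qed
    finally show "conv (resolution \<Phi> \<phi> 0) (T j) x = 0" by (simp add: resolution_def)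
  qed
  \<comment> \<open>The dimension n comes from the factor 2^(l n) in the resolution. It appears in
    the same way on both sides of the embedding and cancels in the comparison of exponents.\<close>
  have norm_l: "ennreal (2 powr (real l * s)) * herz_mixed_norm P a R (conv (resolution \<Phi> \<phi> l) (T j))
      = ennreal (2 powr (real j * (s + n - (\<Sum>i\<in>UNIV. recip (P $ i) + a $ i))) * 2 powr (real_of_int (int l - int j) * (s + n))) *
        herz_mixed_norm P a R (V (int l - int j))"
    if l: "l \<noteq> 0" and PR: "\<And>i. 0 < P $ i" "\<And>i. 0 < R $ i"
    for l j s and P R :: "ennreal^'n::{finite,linorder}" and a :: "real^'n::{finite,linorder}"
  proof -
    define \<sigma> where "\<sigma> = (\<Sum>i\<in>UNIV. recip (P $ i) + a $ i)"
    have [measurable]: "(\<lambda>x. V (int l - int j) (2 ^ j *\<^sub>R x)) \<in> borel_measurable borel"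
      using Vm by measurable
    have 1: "herz_mixed_norm P a R (conv (resolution \<Phi> \<phi> l) (T j))
       = ennreal (2 ^ (l * CARD('n))) * (ennreal (2 powr (- real j * \<sigma>)) * herz_mixed_norm P a R (V (int l - int j)))"
      unfolding conv_l[OF l]
      by (subst herz_mixed_norm_cmult[OF PR]) (simp_all add: herz_mixed_norm_scale[OF PR Vm] \<sigma>_def norm_power)
    have e: "real l * s + (real l * n + (- real j * \<sigma>)) = real j * (s + n - \<sigma>) + real_of_int (int l - int j) * (s + n)"
      by (simp add: algebra_simps)
    have "(2::real) ^ (l * CARD('n)) = 2 powr (real l * n)"
      by (simp add: n_def powr_realpow[symmetric])
    then have "2 powr (real l * s) * (2 ^ (l * CARD('n)) * 2 powr (- real j * \<sigma>))
       = 2 powr (real j * (s + n - \<sigma>)) * 2 powr (real_of_int (int l - int j) * (s + n))"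
      by (simp only: powr_add[symmetric] e)
    moreover have "ennreal (2 powr (real l * s)) * (ennreal (2 ^ (l * CARD('n))) * (ennreal (2 powr (- real j * \<sigma>)) * z))
      = ennreal (2 powr (real l * s) * (2 ^ (l * CARD('n)) * 2 powr (- real j * \<sigma>))) * z" for z
      by (simp add: ennreal_mult mult.assoc)
    ultimately show ?thesis by (simp only: 1 \<sigma>_def)
  qed
  have fin: "herz_mixed_norm q \<alpha>2 \<theta> (V d) < \<infinity>" for d
  proof (rule herz_mixed_norm_rapid_decay_finite[OF pq(1) \<theta> _ Vm])
    show "0 < \<alpha>2 $ i + recip (q $ i)" for i
      using \<alpha>[of i] recip_antimono[OF pq(1) pq(2), of i] by linarith
    show "\<exists>C. \<forall>x. norm (V d x) \<le> C / (1 + norm x) ^ N" for N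
      unfolding V_def by (rule block_decay[OF \<phi> \<phi>d])
  qed
  define b where "b d = enn2real (herz_mixed_norm q \<alpha>2 \<theta> (V d))" for d
  have b: "herz_mixed_norm q \<alpha>2 \<theta> (V d) = ennreal (b d)" "0 \<le> b d" for d
    using fin[of d] by (simp_all add: b_def less_top)
  define B where "B = (\<Sum>d\<in>{-2..2}. 2 powr (real_of_int d * (s2 + n)) * b d)"
  have B: "2 powr (real_of_int d * (s2 + n)) * b d \<le> B" if "d \<in> {-2..2}" for d
    unfolding B_def using that b(2) by (intro member_le_sum) auto
  have B0: "0 \<le> B" unfolding B_def using b(2) by (intro sum_nonneg) auto
  \<comment> \<open>At most five levels contribute, hence 5^(1/\<beta>).\<close>
  define W where "W = 5 powr recip \<beta>"
  have upper: "besov_norm \<Phi> \<phi> q \<alpha>2 \<theta> s2 \<beta> (T j) \<le> ennreal (2 powr (real j * (s2 + n - \<sigma>q)) * B * W)" if j: "3 \<le> j" for j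
  proof -
    define A where "A = 2 powr (real j * (s2 + n - \<sigma>q)) * B"
    have le: "ennreal (2 powr (real l * s2)) * herz_mixed_norm q \<alpha>2 \<theta> (conv (resolution \<Phi> \<phi> l) (T j))
      \<le> ennreal A * indicator {j - 2..j + 2} l" for l
    proof (cases "l \<in> {j - 2..j + 2}")
      case True
      then have l: "l \<noteq> 0" and d: "int l - int j \<in> {-2..2}" using j by auto
      have "2 powr (real_of_int (int l - int j) * (s2 + n)) * b (int l - int j) \<le> B" by (rule B[OF d])
      then have "2 powr (real j * (s2 + n - \<sigma>q)) * (2 powr (real_of_int (int l - int j) * (s2 + n)) * b (int l - int j)) \<le> A"
        unfolding A_def by (intro mult_left_mono) auto
      then show ?thesis
        using norm_l[where s=s2 and j=j and P=q and R=\<theta> and a=\<alpha>2, OF l pq(1) \<theta>] True b(2)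
        by (simp add: b \<sigma>q_def[symmetric] ennreal_mult[symmetric] mult.assoc ennreal_leI)
    next
      case False
      have "conv (resolution \<Phi> \<phi> l) (T j) = (\<lambda>x. 0)"
      proof (cases "l = 0")
        case True
        then show ?thesis using conv_0[OF j] by simp
      next
        case l: False
        have "3 \<le> \<bar>int l - int j\<bar>" using False j by auto
        then show ?thesis using conv_l[OF l] V0 by simp
      qed
      then show ?thesis by simp
    qed
    have "besov_norm \<Phi> \<phi> q \<alpha>2 \<theta> s2 \<beta> (T j) \<le> eLp (count_space UNIV) \<beta> (\<lambda>l::nat. ennreal A * indicator {j - 2..j + 2} l)"
      unfolding besov_norm_def lq_norm_eq by (intro eLp_mono le) auto
    also have "\<dots> \<le> ennreal A * ennreal (real (card {j - 2..j + 2}) powr recip \<beta>)"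
      by (intro eLp_count_indicator_le \<beta>) simp
    also have "real (card {j - 2..j + 2}) = 5" using j by simp
    finally show ?thesis using B0 by (simp add: A_def W_def ennreal_mult)
  qed
  define D where "D = herz_mixed_norm p \<alpha>1 r (V 0)"
  have D: "0 < D"
  proof -
    obtain \<xi> where \<xi>: "fourier \<phi> \<xi> \<noteq> 0" by (rule admissible_fourier_nonzero[OF adm])
    obtain c d where cd: "0 < c" "0 < d" "\<And>x. norm x < d \<Longrightarrow> c \<le> norm (block \<phi> \<phi> 1 x)"
      by (rule block_near_0[OF \<phi> \<xi>]) blast
    show ?thesis unfolding D_def V_def by (rule herz_mixed_norm_pos[OF p r cd(1,2)]) (simp add: cd(3))
  qed
  \<comment> \<open>Only a positive lower bound for D matters. A real minorant allows computing with
    reals and also covers an infinite D.\<close>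
  obtain D' where D': "0 < D'" "ennreal D' \<le> D"
  proof (cases D)
    case (real x)
    then show thesis using D that[of x] by simp
  next
    case top
    then show thesis using that[of 1] by simp
  qed
  have lower: "ennreal (2 powr (real j * (s1 + n - \<sigma>p)) * D') \<le> besov_norm \<Phi> \<phi> p \<alpha>1 r s1 \<beta> (T j)" if j: "3 \<le> j" for j
  proof -
    have "ennreal (2 powr (real j * (s1 + n - \<sigma>p)) * D') \<le> ennreal (2 powr (real j * (s1 + n - \<sigma>p))) * D"
      using D' by (simp add: ennreal_mult mult_left_mono)
    also have "\<dots> = ennreal (2 powr (real j * s1)) * herz_mixed_norm p \<alpha>1 r (conv (resolution \<Phi> \<phi> j) (T j))"
      using norm_l[where s=s1 and j=j and l=j and P=p and R=r and a=\<alpha>1, OF _ p r] j by (simp add: D_def \<sigma>p_def)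
    also have "\<dots> \<le> besov_norm \<Phi> \<phi> p \<alpha>1 r s1 \<beta> (T j)"
      unfolding besov_norm_def lq_norm_eq
      using eLp_count_ge[OF \<beta>, of "\<lambda>k::nat. ennreal (2 powr (real k * s1)) * herz_mixed_norm p \<alpha>1 r (conv (resolution \<Phi> \<phi> k) (T j))" j] .
    finally show ?thesis .
  qed
  obtain C where C: "\<And>f. f \<in> besov_space \<Phi> \<phi> q \<alpha>2 \<theta> s2 \<beta> \<Longrightarrow> besov_norm \<Phi> \<phi> p \<alpha>1 r s1 \<beta> f \<le> ennreal C * besov_norm \<Phi> \<phi> q \<alpha>2 \<theta> s2 \<beta> f"
    using emb unfolding besov_embedding_def embedded_def by blast
  define K where "K = \<bar>C\<bar> * B * W / D'"
  define e where "e = (s1 - \<sigma>p) - (s2 - \<sigma>q)"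
  have key: "2 powr (real j * e) \<le> K" if j: "3 \<le> j" for j
  proof -
    have "T j \<in> besov_space \<Phi> \<phi> q \<alpha>2 \<theta> s2 \<beta>"
      using upper[OF j] T by (auto simp: besov_space_def less_top top_unique intro: le_less_trans)
    then have "besov_norm \<Phi> \<phi> p \<alpha>1 r s1 \<beta> (T j) \<le> ennreal C * besov_norm \<Phi> \<phi> q \<alpha>2 \<theta> s2 \<beta> (T j)" by (rule C)
    also have "\<dots> \<le> ennreal \<bar>C\<bar> * ennreal (2 powr (real j * (s2 + n - \<sigma>q)) * B * W)"
      by (intro mult_mono upper j ennreal_leI) auto
    finally have "ennreal (2 powr (real j * (s1 + n - \<sigma>p)) * D') \<le> ennreal (\<bar>C\<bar> * (2 powr (real j * (s2 + n - \<sigma>q)) * B * W))"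
      using order_trans[OF lower[OF j]] B0 by (simp add: ennreal_mult W_def)
    moreover have "0 \<le> \<bar>C\<bar> * (2 powr (real j * (s2 + n - \<sigma>q)) * B * W)" using B0 by (simp add: W_def)
    ultimately have "2 powr (real j * (s1 + n - \<sigma>p)) * D' \<le> \<bar>C\<bar> * (2 powr (real j * (s2 + n - \<sigma>q)) * B * W)"
      by (simp only: ennreal_le_iff)
    moreover have "2 powr (real j * (s1 + n - \<sigma>p)) = 2 powr (real j * (s2 + n - \<sigma>q)) * 2 powr (real j * e)"
      unfolding powr_add[symmetric] by (simp add: e_def algebra_simps)
    ultimately have "2 powr (real j * (s2 + n - \<sigma>q)) * (2 powr (real j * e) * D') \<le> 2 powr (real j * (s2 + n - \<sigma>q)) * (\<bar>C\<bar> * B * W)"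
      by (simp only: mult_ac)
    then have "2 powr (real j * e) * D' \<le> \<bar>C\<bar> * B * W" by simp
    then show ?thesis using D' by (simp add: K_def le_divide_eq)
  qed
  have "e \<le> 0"
  proof (rule ccontr)
    assume "\<not> e \<le> 0"
    then have e: "0 < e" by simp
    \<comment> \<open>With x = j e ln 2 \<ge> |K| the inequality x < exp x gives 2^(j e) > K; the
      summand 3 makes the bound of \<open>key\<close> applicable.\<close>
    define j where "j = nat \<lceil>\<bar>K\<bar> / (e * ln 2)\<rceil> + 3"
    have "\<bar>K\<bar> / (e * ln 2) \<le> real j" unfolding j_def by linarith
    then have "\<bar>K\<bar> \<le> real j * (e * ln 2)" using e by (simp add: divide_le_eq)
    also have "real j * (e * ln 2) < exp (real j * (e * ln 2))"
      using exp_ge_add_one_self[of "real j * (e * ln 2)"] by linarith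
    also have "\<dots> = 2 powr (real j * e)" by (simp add: powr_def mult_ac)
    also have "\<dots> \<le> K" by (rule key) (simp add: j_def)
    finally show False by simp
  qed
  then show ?thesis by (simp add: e_def \<sigma>p_def \<sigma>q_def)
qed

text \<open>The case distinction for \<theta> is made in each coordinate, so it also covers vectors
  with equality in some coordinates and strict inequality in the others.\<close>

theorem theorem5p2:
  fixes \<Phi> \<phi> :: "real^'n::{finite,linorder} \<Rightarrow> complex"
    and s1 s2 :: real
    and p q r \<nu> \<theta> :: "ennreal^'n::{finite,linorder}"
    and \<alpha>1 \<alpha>2 :: "real^'n::{finite,linorder}"
    and \<beta> :: ennreal
  assumes "admissible \<Phi> \<phi>"
    and "\<forall>i. 0 < q $ i \<and> q $ i \<le> p $ i"
    and "\<forall>i. 0 < r $ i" and "\<forall>i. 0 < \<nu> $ i"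
    and "0 < \<beta>"
    and "\<forall>i. - recip (p $ i) < \<alpha>1 $ i \<and> \<alpha>1 $ i \<le> \<alpha>2 $ i"
    and "\<forall>i. (\<alpha>2 $ i = \<alpha>1 $ i \<longrightarrow> \<theta> $ i = r $ i) \<and> (\<alpha>2 $ i > \<alpha>1 $ i \<longrightarrow> \<theta> $ i = \<nu> $ i)"
  shows "(s1 - (\<Sum>i\<in>UNIV. recip (p $ i)) - (\<Sum>i\<in>UNIV. \<alpha>1 $ i)
            \<le> s2 - (\<Sum>i\<in>UNIV. recip (q $ i)) - (\<Sum>i\<in>UNIV. \<alpha>2 $ i)
          \<longrightarrow> besov_embedding \<Phi> \<phi> q \<alpha>2 \<theta> s2 p \<alpha>1 r s1 \<beta>)
       \<and> (besov_embedding \<Phi> \<phi> q \<alpha>2 \<theta> s2 p \<alpha>1 r s1 \<beta>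
          \<longrightarrow> s1 - (\<Sum>i\<in>UNIV. recip (p $ i)) - (\<Sum>i\<in>UNIV. \<alpha>1 $ i)
            \<le> s2 - (\<Sum>i\<in>UNIV. recip (q $ i)) - (\<Sum>i\<in>UNIV. \<alpha>2 $ i))"
proof -
  have pq: "0 < q $ i" "q $ i \<le> p $ i" and \<alpha>: "- recip (p $ i) < \<alpha>1 $ i" "\<alpha>1 $ i \<le> \<alpha>2 $ i"
    and r: "0 < r $ i" and \<theta>r: "\<alpha>1 $ i = \<alpha>2 $ i \<Longrightarrow> \<theta> $ i = r $ i" for i
    using assms by auto
  have \<theta>: "0 < \<theta> $ i" for i
    using assms(3,4,6,7) by (cases "\<alpha>2 $ i = \<alpha>1 $ i") (simp_all add: less_le)
  show ?thesis
    using besov_embedding_sufficient[OF assms(1) pq r \<theta> assms(5) \<alpha> \<theta>r, of s1 s2]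
      besov_embedding_necessary[OF assms(1) pq r \<theta> assms(5) \<alpha>, of s2 s1]
    by (simp add: sum.distrib diff_diff_eq)
qed

end
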